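(* Let $\mathscr R\in L^\infty(\mathbb{R})$ be $1$-periodic and bounded from below by a positive constant. For $\lambda>0$ let $c(\lambda)$ be the speed defined in the context. Then the map $\lambda\in(0,+\infty)\mapsto c(\lambda)$ is $C^\infty$ and nonincreasing, and $$\lim_{\lambda\downarrow0}c(\lambda)=\operatorname{ess\,sup}_z\mathscr R(z),\qquad\lim_{\lambda\to+\infty}c(\lambda)=\int_0^1\mathscr R(z)\,dz.$$ More precisely, $c'(\lambda)<0$ for all $\lambda>0$ as soon as $\mathscr R$ is not (a.e. equal to) a constant.
   Context: For each $\lambda>0$ there is a unique pair $(c,h)\in\mathbb{R}\times W^{1,\infty}(\mathbb{R})$ such that $$-c+\mathscr R(z)\sqrt{1+h^2}=\lambda\,\frac{h_z}{1+h^2}\ \text{ for a.e. }z\in\mathbb{R},\qquad h(z+1)=h(z),\qquad\int_0^1h(t)\,dt=0.$$ This pair is denoted $(c(\lambda),h(\cdot,\lambda))$. *)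

theory Defs
  imports "HOL-Probability.Essential_Supremum"
begin

text \<open>
  Elements of Lebesgue and Sobolev spaces are represented by functions; pointwise identities
  between them (periodicity in particular) are accordingly required almost everywhere.
\<close>

text \<open>On an open set, this is being of class \<open>C\<^sup>\<infinity>\<close>: \<^const>\<open>deriv\<close> only depends on the values near
  the point, so the iterates of \<^const>\<open>deriv\<close> are the successive derivatives.\<close>
definition smooth_on :: "real set \<Rightarrow> (real \<Rightarrow> real) \<Rightarrow> bool" where
  "smooth_on S f \<longleftrightarrow> (\<forall>n. \<forall>x\<in>S. ((deriv ^^ n) f) differentiable (at x))"

definition test_function :: "(real \<Rightarrow> real) \<Rightarrow> bool" where
  "test_function \<phi> \<longleftrightarrow> smooth_on UNIV \<phi> \<and> compact (closure {x. \<phi> x \<noteq> 0})"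

definition L_infinity :: "(real \<Rightarrow> real) set" where
  "L_infinity = {f \<in> borel_measurable lebesgue. \<exists>K. AE x in lebesgue. \<bar>f x\<bar> \<le> K}"

definition locally_integrable :: "(real \<Rightarrow> real) \<Rightarrow> bool" where
  "locally_integrable f \<longleftrightarrow> (\<forall>K. compact K \<longrightarrow> set_integrable lebesgue K f)"

definition has_weak_deriv :: "(real \<Rightarrow> real) \<Rightarrow> (real \<Rightarrow> real) \<Rightarrow> bool" where
  "has_weak_deriv f g \<longleftrightarrow> locally_integrable f \<and> locally_integrable g \<and>
    (\<forall>\<phi>. test_function \<phi> \<longrightarrow>
      (LINT x|lebesgue. f x * deriv \<phi> x) = - (LINT x|lebesgue. g x * \<phi> x))"

definition W1_infinity :: "(real \<Rightarrow> real) set" where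
  "W1_infinity = {f \<in> L_infinity. \<exists>g\<in>L_infinity. has_weak_deriv f g}"

definition speed_profile :: "(real \<Rightarrow> real) \<Rightarrow> real \<Rightarrow> real \<Rightarrow> (real \<Rightarrow> real) \<Rightarrow> bool" where
  "speed_profile R lam c h \<longleftrightarrow>
    h \<in> W1_infinity \<and>
    (\<exists>hz. has_weak_deriv h hz \<and>
      (AE z in lebesgue. - c + R z * sqrt (1 + (h z)\<^sup>2) = lam * (hz z / (1 + (h z)\<^sup>2)))) \<and>
    (AE z in lebesgue. h (z + 1) = h z) \<and>
    (LINT t:{0..1}|lebesgue. h t) = 0"

text \<open>Only the profile \<open>h\<close> is subject to identification almost everywhere; the speed is a
  number and is determined uniquely.\<close>
definition speed :: "(real \<Rightarrow> real) \<Rightarrow> real \<Rightarrow> real" where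
  "speed R lam = (THE c. \<exists>h. speed_profile R lam c h)"

end

theory Submission
  imports Defs "HOL-Library.Periodic_Fun"
begin

text \<open>
  The equation becomes tame in the variable \<open>s = h / sqrt (1 + h\<^sup>2)\<close>, the sine of the angle between
  the front and the horizontal: \<open>h\<close> solves it with speed \<open>c\<close> iff
  \[ \lambda s' = R - c \sqrt{1 - s^2},\qquad |s| < 1,\quad s\ \hbox{1-periodic},\quad
     \int_0^1 h = 0,\ h = s / \sqrt{1 - s^2}. \]
  A du Bois-Reymond argument passes between the weak formulation and this equation for a continuous
  \<open>s\<close> that is the integral of its derivative (\<open>profile_imp_speed_profile\<close>,
  \<open>speed_profile_imp_profile\<close>). The derivative of the right-hand side in \<open>s\<close> is \<open>c h\<close>. So the
  difference of two solutions solves a linear equation whose coefficient is close to \<open>c h / \<lambda>\<close>, and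
  the condition \<open>\<integral> h = 0\<close> says that the period map \<open>a \<mapsto> s(1)\<close>, \<open>s(0) = a\<close>, has
  derivative 1 at its fixed point. Everything rests on the integrating factor of that linear equation.

  Uniqueness. Two profiles have slopes of equal mean, so they cross. Along one period starting at a
  crossing, the integrating factor gives a balance (\<open>profile_crossing_balance\<close>) which forces equal
  speeds if the parameters agree, and Lipschitz dependence on \<open>\<lambda>\<close> if they do not.

  Existence. After truncating the square root the Cauchy problem is globally solvable. Take the least
  \<open>c\<close> for which the period map satisfies \<open>s(1) \<le> a\<close> for some \<open>a\<close>. At this speed the period map is
  nowhere below the diagonal and touches it, so its derivative at the contact point is 1, that is
  \<open>\<integral> h = 0\<close> (\<open>profile_exists\<close>). At an extremum of \<open>s\<close> the equation bounds \<open>|s|\<close> away from 1,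
  uniformly in \<open>\<lambda>\<close>, so the truncation is invisible.

  Regularity. The difference quotients of \<open>c\<close> and of \<open>s\<close> in \<open>\<lambda>\<close> satisfy a linear
  \<open>2 \<times> 2\<close> system (periodicity and the mean of the slope) whose coefficients depend continuously on the
  two profiles and whose determinant is nonzero on the diagonal. Hence \<open>c\<close> and \<open>s\<close> are differentiable,
  and their derivatives are obtained from \<open>\<lambda>\<close>, \<open>c\<close>, \<open>s\<close> by arithmetic, square roots,
  exponentials and integration in \<open>z\<close>. The derivatives are thus as smooth in \<open>\<lambda>\<close> as \<open>c\<close> and
  \<open>s\<close> are, and induction gives smoothness (\<open>param_smooth_speed_prof\<close>). The formula reads
  \[ c'(\lambda) = - \frac{c}{\lambda}\,\frac{\int_0^1 W h s}{\int_0^1 W \sqrt{1 - s^2}},\qquad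
     W(z) = \exp\Bigl(-\frac{c}{\lambda}\int_0^z h\Bigr), \]
  with \<open>h s \<ge> 0\<close>; it vanishes only if \<open>s = 0\<close>, and then \<open>R = c\<close> almost everywhere.

  Limits. Integrating \<open>\<lambda> s' \<ge> R - c\<close> over an interval on which the mean of \<open>R\<close> exceeds \<open>K\<close>
  shows \<open>c \<ge> K\<close> for small \<open>\<lambda>\<close>, and such intervals exist for every \<open>K\<close> below the essential
  supremum. For large \<open>\<lambda>\<close> one has \<open>|s| \<le> M / \<lambda>\<close>, where \<open>M\<close> bounds \<open>R\<close>, while
  \<open>c \<integral> sqrt (1 - s\<^sup>2) = \<integral> R\<close>.
\<close>

section \<open>Primitives of locally bounded functions\<close>

definition loc_bounded :: "(real \<Rightarrow> real) \<Rightarrow> bool" where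
  "loc_bounded g \<longleftrightarrow> g \<in> borel_measurable lebesgue \<and> (\<forall>a b. bounded (g ` {a..b}))"

text \<open>A substitute for absolute continuity with a locally bounded derivative \<open>g\<close>. It avoids
  differentiation almost everywhere; the function \<open>g\<close> matters only up to null sets.\<close>
definition primitive :: "(real \<Rightarrow> real) \<Rightarrow> (real \<Rightarrow> real) \<Rightarrow> bool" where
  "primitive f g \<longleftrightarrow> loc_bounded g \<and> (\<forall>a b. a \<le> b \<longrightarrow> (g has_integral (f b - f a)) {a..b})"

definition signed_integral :: "(real \<Rightarrow> real) \<Rightarrow> real \<Rightarrow> real" where
  "signed_integral g z = (if 0 \<le> z then integral {0..z} g else - integral {z..0} g)"

lemma loc_boundedI:
  assumes "g \<in> borel_measurable lebesgue" "\<And>N. \<exists>K. \<forall>x. \<bar>x\<bar> \<le> N \<longrightarrow> \<bar>g x\<bar> \<le> K"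
  shows "loc_bounded g"
  unfolding loc_bounded_def
proof (intro conjI allI)
  fix a b :: real
  obtain K where K: "\<forall>x. \<bar>x\<bar> \<le> max \<bar>a\<bar> \<bar>b\<bar> \<longrightarrow> \<bar>g x\<bar> \<le> K" using assms(2) by blast
  show "bounded (g ` {a..b})"
    unfolding bounded_iff by (rule exI[of _ K]) (use K in auto)
qed (use assms in auto)

lemma loc_boundedE:
  assumes "loc_bounded g"
  obtains K where "K \<ge> 0" "\<And>x. a \<le> x \<Longrightarrow> x \<le> b \<Longrightarrow> \<bar>g x\<bar> \<le> K"
proof -
  have "bounded (g ` {a..b})" using assms unfolding loc_bounded_def by blast
  then obtain K where "K > 0" "\<And>x. x \<in> {a..b} \<Longrightarrow> \<bar>g x\<bar> \<le> K"
    unfolding bounded_pos by auto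
  then show ?thesis using that[of K] by auto
qed

lemma loc_bounded_bounded:
  assumes "g \<in> borel_measurable lebesgue" "\<And>x. \<bar>g x\<bar> \<le> K"
  shows "loc_bounded g"
  using assms by (intro loc_boundedI) auto

lemma loc_bounded_continuous:
  assumes "continuous_on UNIV g" shows "loc_bounded g"
  unfolding loc_bounded_def
proof (intro conjI allI)
  show "g \<in> borel_measurable lebesgue"
    using borel_measurable_continuous_onI[OF assms] by (simp add: measurable_completion)
  show "bounded (g ` {a..b})" for a b
    by (intro compact_imp_bounded compact_continuous_image continuous_on_subset[OF assms]) auto
qed

lemma loc_bounded_const [simp]: "loc_bounded (\<lambda>x. c)"
  by (intro loc_bounded_continuous) auto

lemma loc_bounded_mult:
  assumes "loc_bounded f" "loc_bounded g" shows "loc_bounded (\<lambda>x. f x * g x)"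
proof -
  have [measurable]: "f \<in> borel_measurable lebesgue" "g \<in> borel_measurable lebesgue"
    using assms by (auto simp: loc_bounded_def)
  show ?thesis
  proof (rule loc_boundedI)
    fix N :: real
    obtain K where K: "K \<ge> 0" "\<And>x. -N \<le> x \<Longrightarrow> x \<le> N \<Longrightarrow> \<bar>f x\<bar> \<le> K"
      using loc_boundedE[OF assms(1), of "-N" N] by metis
    obtain K' where K': "K' \<ge> 0" "\<And>x. -N \<le> x \<Longrightarrow> x \<le> N \<Longrightarrow> \<bar>g x\<bar> \<le> K'"
      using loc_boundedE[OF assms(2), of "-N" N] by metis
    show "\<exists>K. \<forall>x. \<bar>x\<bar> \<le> N \<longrightarrow> \<bar>f x * g x\<bar> \<le> K"
      by (rule exI[of _ "K * K'"]) (auto simp: abs_mult intro!: mult_mono K K')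
  qed measurable
qed

lemma loc_bounded_add:
  assumes "loc_bounded f" "loc_bounded g" shows "loc_bounded (\<lambda>x. f x + g x)"
proof -
  have [measurable]: "f \<in> borel_measurable lebesgue" "g \<in> borel_measurable lebesgue"
    using assms by (auto simp: loc_bounded_def)
  show ?thesis
    unfolding loc_bounded_def
    using bounded_plus_comp[of f _ g] assms by (auto simp: loc_bounded_def)
qed

lemma loc_bounded_cmult: "loc_bounded f \<Longrightarrow> loc_bounded (\<lambda>x. c * f x)"
  by (intro loc_bounded_mult) auto

lemma loc_bounded_minus: "loc_bounded f \<Longrightarrow> loc_bounded (\<lambda>x. - f x)"
  using loc_bounded_cmult[of f "-1"] by simp

lemma loc_bounded_diff: "loc_bounded f \<Longrightarrow> loc_bounded g \<Longrightarrow> loc_bounded (\<lambda>x. f x - g x)"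
  using loc_bounded_add[OF _ loc_bounded_minus, of f g] by simp

lemma loc_bounded_divide: "loc_bounded f \<Longrightarrow> loc_bounded (\<lambda>x. f x / c)"
  using loc_bounded_cmult[of f "1/c"] by simp

lemma loc_bounded_abs: "loc_bounded f \<Longrightarrow> loc_bounded (\<lambda>x. \<bar>f x\<bar>)"
  unfolding loc_bounded_def bounded_iff by auto

lemma loc_bounded_compose_continuous:
  assumes "continuous_on UNIV f" "continuous_on U F" "\<And>x. f x \<in> U"
  shows "loc_bounded (\<lambda>x. F (f x))"
  by (intro loc_bounded_continuous continuous_on_compose2[OF assms(2) assms(1)]) (use assms in auto)

lemma loc_bounded_absolutely_integrable:
  assumes "loc_bounded g" shows "g absolutely_integrable_on {a..b}"
proof -
  obtain K where K: "\<And>x. a \<le> x \<Longrightarrow> x \<le> b \<Longrightarrow> \<bar>g x\<bar> \<le> K" using loc_boundedE[OF assms] by metis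
  show ?thesis
    using assms K unfolding loc_bounded_def
    by (intro measurable_bounded_by_integrable_imp_absolutely_integrable[where g="\<lambda>_. K"])
       (auto intro: measurable_restrict_space1)
qed

lemma loc_bounded_integrable:
  assumes "loc_bounded g" shows "g integrable_on {a..b}"
  using loc_bounded_absolutely_integrable[OF assms] set_lebesgue_integral_eq_integral(1) by blast

lemma primitive_loc_bounded: "primitive f g \<Longrightarrow> loc_bounded g"
  by (simp add: primitive_def)

lemma primitive_integral: "primitive f g \<Longrightarrow> a \<le> b \<Longrightarrow> integral {a..b} g = f b - f a"
  by (auto simp: primitive_def intro: integral_unique)

lemma primitive_has_integral: "primitive f g \<Longrightarrow> a \<le> b \<Longrightarrow> (g has_integral (f b - f a)) {a..b}"
  by (auto simp: primitive_def)

lemma primitive_signed_integral: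
  assumes "loc_bounded g" shows "primitive (signed_integral g) g"
  unfolding primitive_def
proof (intro conjI allI impI)
  fix a b :: real assume ab: "a \<le> b"
  have i: "g integrable_on {x..y}" for x y using loc_bounded_integrable[OF assms] .
  have "signed_integral g b - signed_integral g a = integral {a..b} g"
  proof (cases "0 \<le> a")
    case True
    then show ?thesis
      using Henstock_Kurzweil_Integration.integral_combine[of 0 a b g] i ab by (auto simp: signed_integral_def)
  next
    case a: False
    show ?thesis
    proof (cases "0 \<le> b")
      case True
      then show ?thesis
        using Henstock_Kurzweil_Integration.integral_combine[of a 0 b g] i a ab by (auto simp: signed_integral_def)
    next
      case False
      then show ?thesis
        using Henstock_Kurzweil_Integration.integral_combine[of a b 0 g] i a ab by (auto simp: signed_integral_def)
    qed
  qed
  then show "(g has_integral signed_integral g b - signed_integral g a) {a..b}"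
    using i integrable_integral by metis
qed (use assms in auto)

lemma signed_integral_0 [simp]: "signed_integral g 0 = 0"
  by (simp add: signed_integral_def)

lemma primitive_add: "primitive f g \<Longrightarrow> primitive f' g' \<Longrightarrow> primitive (\<lambda>x. f x + f' x) (\<lambda>x. g x + g' x)"
  unfolding primitive_def
  by (auto intro!: loc_bounded_add) (metis has_integral_add add_diff_add)

lemma primitive_cmult: "primitive f g \<Longrightarrow> primitive (\<lambda>x. c * f x) (\<lambda>x. c * g x)"
  unfolding primitive_def
  by (auto intro!: loc_bounded_cmult) (metis has_integral_mult_right right_diff_distrib)

lemma primitive_diff: "primitive f g \<Longrightarrow> primitive f' g' \<Longrightarrow> primitive (\<lambda>x. f x - f' x) (\<lambda>x. g x - g' x)"
  using primitive_add[OF _ primitive_cmult[of f' g' "-1"], of f g] by simp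

lemma primitive_const [simp]: "primitive (\<lambda>x. c) (\<lambda>x. 0)"
  by (auto simp: primitive_def)

lemma primitive_add_const: "primitive f g \<Longrightarrow> primitive (\<lambda>x. f x + c) g"
  using primitive_add[of f g "\<lambda>x. c" "\<lambda>x. 0"] by simp

lemma primitive_mono:
  assumes "primitive f g" "primitive f' g'" "a \<le> b" "\<And>x. a \<le> x \<Longrightarrow> x \<le> b \<Longrightarrow> g x \<le> g' x"
  shows "f b - f a \<le> f' b - f' a"
  using has_integral_le[OF primitive_has_integral[OF assms(1,3)] primitive_has_integral[OF assms(2,3)]] assms(4)
  by auto

lemma primitive_id: "primitive (\<lambda>x. c * x) (\<lambda>x. c)"
  unfolding primitive_def
proof (intro conjI allI impI)
  fix a b :: real assume "a \<le> b"
  then show "((\<lambda>x. c) has_integral c * b - c * a) {a..b}"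
    using has_integral_const_real[of c a b] by (simp add: algebra_simps)
qed simp

lemma primitive_abs_le:
  assumes "primitive f g" "a \<le> b" "\<And>x. a \<le> x \<Longrightarrow> x \<le> b \<Longrightarrow> \<bar>g x\<bar> \<le> K"
  shows "\<bar>f b - f a\<bar> \<le> K * (b - a)"
proof -
  have "f b - f a \<le> K * b - K * a"
    using assms(3) by (intro primitive_mono[OF assms(1) primitive_id assms(2)]) (auto simp: abs_le_iff)
  moreover have "-K * b - -K * a \<le> f b - f a"
    by (intro primitive_mono[OF primitive_id assms(1,2)]) (use assms(3) in force)
  ultimately show ?thesis by (simp add: algebra_simps abs_le_iff)
qed

lemma primitive_locally_lipschitz:
  assumes "primitive f g"
  obtains K where "K > 0" "\<And>x y. \<bar>x\<bar> \<le> N \<Longrightarrow> \<bar>y\<bar> \<le> N \<Longrightarrow> \<bar>f x - f y\<bar> \<le> K * \<bar>x - y\<bar>"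
proof -
  obtain K where K: "K \<ge> 0" "\<And>x. -N \<le> x \<Longrightarrow> x \<le> N \<Longrightarrow> \<bar>g x\<bar> \<le> K"
    using loc_boundedE[OF primitive_loc_bounded[OF assms], of "-N" N] by metis
  have *: "\<bar>f y - f x\<bar> \<le> (K + 1) * \<bar>y - x\<bar>" if "\<bar>x\<bar> \<le> N" "\<bar>y\<bar> \<le> N" "x \<le> y" for x y
  proof -
    have "\<bar>f y - f x\<bar> \<le> K * (y - x)"
      using that by (intro primitive_abs_le[OF assms]) (auto intro: K)
    also have "\<dots> \<le> (K + 1) * \<bar>y - x\<bar>" using that by (simp add: mult_right_mono)
    finally show ?thesis .
  qed
  show ?thesis
  proof (rule that[of "K + 1"])
    fix x y assume "\<bar>x\<bar> \<le> N" "\<bar>y\<bar> \<le> N"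
    then show "\<bar>f x - f y\<bar> \<le> (K + 1) * \<bar>x - y\<bar>"
      using *[of x y] *[of y x] by (cases "x \<le> y") (auto simp: abs_minus_commute)
  qed (use K in auto)
qed

lemma primitive_continuous:
  assumes "primitive f g" shows "continuous_on UNIV f"
proof -
  have "isCont f x" for x
  proof -
    obtain K where K: "K > 0" "\<And>u v. \<bar>u\<bar> \<le> \<bar>x\<bar> + 1 \<Longrightarrow> \<bar>v\<bar> \<le> \<bar>x\<bar> + 1 \<Longrightarrow> \<bar>f u - f v\<bar> \<le> K * \<bar>u - v\<bar>"
      using primitive_locally_lipschitz[OF assms] by metis
    have "((\<lambda>y. f y - f x) \<longlongrightarrow> 0) (at x)"
    proof (rule Lim_null_comparison)
      show "\<forall>\<^sub>F y in at x. norm (f y - f x) \<le> K * \<bar>y - x\<bar>"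
        unfolding eventually_at by (rule exI[of _ 1]) (auto simp: dist_real_def intro!: K)
      show "((\<lambda>y. K * \<bar>y - x\<bar>) \<longlongrightarrow> 0) (at x)" by (auto intro!: tendsto_eq_intros)
    qed
    then show ?thesis by (simp add: isCont_def LIM_zero_iff)
  qed
  then show ?thesis by (simp add: continuous_at_imp_continuous_on)
qed

lemma loc_bounded_primitive: "primitive f g \<Longrightarrow> loc_bounded f"
  by (intro loc_bounded_continuous primitive_continuous)

text \<open>At a point where the integrand is continuous the primitive is classically differentiable. The case of
  value zero is the one needed: it is used after subtracting a linear function.\<close>
lemma primitive_zero_derivative:
  assumes "primitive f g" "isCont g x" "g x = 0"
  shows "(f has_real_derivative 0) (at x)"
  unfolding has_field_derivative_def has_derivative_at2
proof (intro conjI)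
  show "((\<lambda>y. (1 / norm (y - x)) *\<^sub>R (f y - (f x + 0 * (y - x)))) \<longlongrightarrow> 0) (at x)"
  proof (rule tendstoI)
    fix e :: real assume e: "e > 0"
    obtain d where d: "d > 0" "\<And>y. \<bar>y - x\<bar> < d \<Longrightarrow> \<bar>g y\<bar> < e / 2"
      using assms(2,3) e unfolding continuous_at_eps_delta
      by (metis diff_zero dist_real_def half_gt_zero real_norm_def)
    have 1: "\<bar>f y - f x\<bar> \<le> e / 2 * \<bar>y - x\<bar>" if "\<bar>y - x\<bar> < d" for y
    proof (cases "x \<le> y")
      case True
      then show ?thesis
        using primitive_abs_le[OF assms(1) True, of "e/2"] less_imp_le[OF d(2)] that by auto
    next
      case False
      then show ?thesis
        using primitive_abs_le[OF assms(1), of y x "e/2"] less_imp_le[OF d(2)] that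
        by (auto simp: abs_minus_commute[of "f y"])
    qed
    have 2: "e / 2 * \<bar>y - x\<bar> < e * \<bar>y - x\<bar>" if "y \<noteq> x" for y
      using that e by (intro mult_strict_right_mono) auto
    have "\<bar>f y - f x\<bar> / \<bar>y - x\<bar> < e" if "\<bar>y - x\<bar> < d" "y \<noteq> x" for y
      using le_less_trans[OF 1[OF that(1)] 2[OF that(2)]] that by (subst pos_divide_less_eq) auto
    then show "\<forall>\<^sub>F y in at x. dist ((1 / norm (y - x)) *\<^sub>R (f y - (f x + 0 * (y - x)))) 0 < e"
      unfolding eventually_at using d(1) by (intro exI[of _ d]) (auto simp: dist_real_def)
  qed
qed (simp add: bounded_linear_mult_right)

lemma primitive_compose_zero_derivative:
  assumes "primitive f g" "(F has_real_derivative 0) (at (f x))"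
  shows "((\<lambda>y. F (f y)) has_real_derivative 0) (at x)"
  unfolding has_field_derivative_def has_derivative_at2
proof (intro conjI)
  obtain K where K: "K > 0" "\<And>u v. \<bar>u\<bar> \<le> \<bar>x\<bar> + 1 \<Longrightarrow> \<bar>v\<bar> \<le> \<bar>x\<bar> + 1 \<Longrightarrow> \<bar>f u - f v\<bar> \<le> K * \<bar>u - v\<bar>"
    using primitive_locally_lipschitz[OF assms(1)] by metis
  show "((\<lambda>y. (1 / norm (y - x)) *\<^sub>R (F (f y) - (F (f x) + 0 * (y - x)))) \<longlongrightarrow> 0) (at x)"
  proof (rule tendstoI)
    fix e :: real assume e: "e > 0"
    define e' where "e' = e / (2 * K)"
    have "e' > 0" using e K by (simp add: e'_def)
    then obtain d where d: "d > 0" "\<And>u. \<bar>u - f x\<bar> < d \<Longrightarrow> \<bar>F u - F (f x)\<bar> \<le> e' * \<bar>u - f x\<bar>"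
      using assms(2) unfolding has_field_derivative_def has_derivative_at_alt
      by (metis (no_types, lifting) diff_zero lambda_zero mult_zero_left real_norm_def)
    have "\<bar>F (f y) - F (f x)\<bar> / \<bar>y - x\<bar> < e" if y: "\<bar>y - x\<bar> < min 1 (d / K)" "y \<noteq> x" for y
    proof -
      have l: "\<bar>f y - f x\<bar> \<le> K * \<bar>y - x\<bar>" using y by (intro K) auto
      also have "\<dots> < d" using y K by (simp add: field_simps)
      finally have "\<bar>F (f y) - F (f x)\<bar> \<le> e' * \<bar>f y - f x\<bar>" by (rule d)
      also have "\<dots> \<le> e' * (K * \<bar>y - x\<bar>)" using l \<open>e' > 0\<close> by (intro mult_left_mono) auto
      also have "\<dots> = e / 2 * \<bar>y - x\<bar>" using K by (simp add: e'_def)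
      also have "\<dots> < e * \<bar>y - x\<bar>" using y e by (intro mult_strict_right_mono) auto
      finally show ?thesis using y by (simp add: pos_divide_less_eq)
    qed
    then show "\<forall>\<^sub>F y in at x. dist ((1 / norm (y - x)) *\<^sub>R (F (f y) - (F (f x) + 0 * (y - x)))) 0 < e"
      unfolding eventually_at using d(1) K(1) by (intro exI[of _ "min 1 (d/K)"]) (auto simp: dist_real_def)
  qed
qed (simp add: bounded_linear_mult_right)

text \<open>The function \<open>x \<mapsto> F (f x) - \<integral> F'(f) g\<close> has derivative zero at every point \<open>x\<close>, although neither
  term need be differentiable there: subtract \<open>F'(f x) f\<close> from both. The first difference is \<open>f\<close> followed by a
  function with derivative zero at \<open>f x\<close>, and \<open>f\<close> is locally Lipschitz; the second is the primitive of a
  function that tends to zero at \<open>x\<close>.\<close>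
lemma primitive_chain:
  assumes fg: "primitive f g" and U: "open U" "\<And>x. f x \<in> U"
    and F: "\<And>u. u \<in> U \<Longrightarrow> (F has_real_derivative F' u) (at u)" and F': "continuous_on U F'"
  shows "primitive (\<lambda>x. F (f x)) (\<lambda>x. F' (f x) * g x)"
proof -
  have cf: "continuous_on UNIV f" using primitive_continuous[OF fg] .
  have cF: "continuous_on UNIV (\<lambda>x. F' (f x))"
    by (rule continuous_on_compose2[OF F' cf]) (use U in auto)
  have lb: "loc_bounded (\<lambda>x. F' (f x) * g x)"
    by (intro loc_bounded_mult loc_bounded_continuous cF primitive_loc_bounded[OF fg])
  let ?G = "signed_integral (\<lambda>x. F' (f x) * g x)"
  have G: "primitive ?G (\<lambda>x. F' (f x) * g x)" by (rule primitive_signed_integral[OF lb])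
  \<comment> \<open>both terms are compared with the linearization \<open>F' (f x) * f\<close> at the point \<open>x\<close>\<close>
  have "((\<lambda>y. F (f y) - ?G y) has_real_derivative 0) (at x)" for x
  proof -
    have 1: "((\<lambda>y. F (f y) - F' (f x) * f y) has_real_derivative 0) (at x)"
      by (rule primitive_compose_zero_derivative[OF fg, where F="\<lambda>u. F u - F' (f x) * u"])
         (auto intro!: derivative_eq_intros F U)
    have P: "primitive (\<lambda>y. ?G y - F' (f x) * f y) (\<lambda>y. F' (f y) * g y - F' (f x) * g y)"
      by (intro primitive_diff G primitive_cmult fg)
    have "isCont (\<lambda>y. F' (f y) * g y - F' (f x) * g y) x"
    proof -
      obtain K where K: "K \<ge> 0" "\<And>y. x - 1 \<le> y \<Longrightarrow> y \<le> x + 1 \<Longrightarrow> \<bar>g y\<bar> \<le> K"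
        using loc_boundedE[OF primitive_loc_bounded[OF fg], of "x-1" "x+1"] by metis
      have "((\<lambda>y. F' (f y) * g y - F' (f x) * g y) \<longlongrightarrow> 0) (at x)"
      proof (rule Lim_null_comparison)
        show "\<forall>\<^sub>F y in at x. norm (F' (f y) * g y - F' (f x) * g y) \<le> K * \<bar>F' (f y) - F' (f x)\<bar>"
          unfolding eventually_at
          by (rule exI[of _ 1])
             (auto simp: dist_real_def abs_mult left_diff_distrib[symmetric] mult.commute[of K] intro!: mult_left_mono K)
        have "((\<lambda>y. F' (f y)) \<longlongrightarrow> F' (f x)) (at x)"
          using cF by (auto simp: continuous_on_eq_continuous_at isCont_def)
        then show "((\<lambda>y. K * \<bar>F' (f y) - F' (f x)\<bar>) \<longlongrightarrow> 0) (at x)"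
          by (auto intro!: tendsto_eq_intros)
      qed
      then show ?thesis by (simp add: isCont_def)
    qed
    then have 2: "((\<lambda>y. ?G y - F' (f x) * f y) has_real_derivative 0) (at x)"
      by (intro primitive_zero_derivative[OF P]) auto
    show ?thesis using DERIV_diff[OF 1 2] by simp
  qed
  then obtain c where c: "\<And>y. F (f y) - ?G y = c" using DERIV_isconst_all[of "\<lambda>y. F (f y) - ?G y"] by metis
  then have "(\<lambda>x. F (f x)) = (\<lambda>x. ?G x + c)" by (auto simp: fun_eq_iff algebra_simps)
  then show ?thesis using primitive_add_const[OF G] by simp
qed

text \<open>By polarization the product rule is the chain rule for the square.\<close>
lemma primitive_mult:
  assumes f: "primitive f f'" and g: "primitive g g'"
  shows "primitive (\<lambda>x. f x * g x) (\<lambda>x. f' x * g x + f x * g' x)"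
proof -
  have sq: "primitive (\<lambda>x. (u x)^2) (\<lambda>x. (2 * u x) * u' x)" if "primitive u u'" for u u'
    by (rule primitive_chain[OF that, where U=UNIV and F="\<lambda>u. u^2" and F'="\<lambda>u. 2 * u"])
       (auto intro!: derivative_eq_intros continuous_intros)
  have 1: "primitive (\<lambda>x. (1/2) * ((f x + g x)^2 - (f x)^2 - (g x)^2))
    (\<lambda>x. (1/2) * ((2 * (f x + g x)) * (f' x + g' x) - (2 * f x) * f' x - (2 * g x) * g' x))"
    by (intro primitive_diff sq primitive_add primitive_cmult f g)
  have 2: "(\<lambda>x. (1/2) * ((f x + g x)^2 - (f x)^2 - (g x)^2)) = (\<lambda>x. f x * g x)"
    by (auto simp: power2_eq_square algebra_simps)
  have 3: "(\<lambda>x. (1/2) * ((2 * (f x + g x)) * (f' x + g' x) - (2 * f x) * f' x - (2 * g x) * g' x))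
     = (\<lambda>x. f' x * g x + f x * g' x)"
    by (auto simp: algebra_simps)
  show ?thesis using 1 unfolding 2 3 .
qed

lemma primitive_derivative:
  assumes "\<And>x. (f has_real_derivative g x) (at x)" "continuous_on UNIV g"
  shows "primitive f g"
  unfolding primitive_def
proof (intro conjI allI impI)
  fix a b :: real assume "a \<le> b"
  then show "(g has_integral f b - f a) {a..b}"
    by (intro fundamental_theorem_of_calculus)
       (auto intro!: has_field_derivative_at_within assms simp: has_real_derivative_iff_has_vector_derivative[symmetric])
qed (use loc_bounded_continuous[OF assms(2)] in auto)

lemma signed_integral_derivative:
  assumes "continuous_on UNIV g"
  shows "(signed_integral g has_real_derivative g x) (at x)"
proof -
  have "primitive (\<lambda>y. signed_integral g y - g x * y) (\<lambda>y. g y - g x)"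
    by (intro primitive_diff primitive_id primitive_signed_integral loc_bounded_continuous assms)
  then have "((\<lambda>y. signed_integral g y - g x * y) has_real_derivative 0) (at x)"
    by (rule primitive_zero_derivative) (use assms in \<open>auto simp: continuous_on_eq_continuous_at intro!: continuous_intros\<close>)
  then have "((\<lambda>y. (signed_integral g y - g x * y) + g x * y) has_real_derivative 0 + g x) (at x)"
    by (intro DERIV_add) (auto intro!: derivative_eq_intros)
  then show ?thesis by simp
qed

lemma primitive_cong:
  assumes "primitive f g" "\<And>x. g' x = g x" shows "primitive f g'"
  using assms(1) ext[of g' g, OF assms(2)] by simp

lemma primitive_unique:
  assumes "primitive f g" "primitive f' g"
  shows "f x - f' x = f a - f' a"
proof (cases "a \<le> x")
  case True
  then show ?thesis using primitive_integral[OF assms(1) True] primitive_integral[OF assms(2) True] by simp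
next
  case False
  then have "x \<le> a" by simp
  then show ?thesis using primitive_integral[OF assms(1)] primitive_integral[OF assms(2)] by force
qed

lemma primitive_shift:
  assumes "primitive f g" shows "primitive (\<lambda>x. f (x + t)) (\<lambda>x. g (x + t))"
  unfolding primitive_def
proof (intro conjI allI impI)
  have [measurable]: "(\<lambda>x. x + t) \<in> lebesgue \<rightarrow>\<^sub>M lebesgue"
    using lebesgue_affine_measurable[of "\<lambda>_. 1" t] by (simp add: add.commute)
  have [measurable]: "g \<in> borel_measurable lebesgue" using assms by (auto simp: primitive_def loc_bounded_def)
  show "loc_bounded (\<lambda>x. g (x + t))"
  proof (rule loc_boundedI)
    show "(\<lambda>x. g (x + t)) \<in> borel_measurable lebesgue" by measurable
    fix N :: real
    obtain K where K: "\<And>x. -N + t \<le> x \<Longrightarrow> x \<le> N + t \<Longrightarrow> \<bar>g x\<bar> \<le> K"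
      using loc_boundedE[OF primitive_loc_bounded[OF assms], of "-N+t" "N+t"] by metis
    show "\<exists>K. \<forall>x. \<bar>x\<bar> \<le> N \<longrightarrow> \<bar>g (x + t)\<bar> \<le> K"
      by (rule exI[of _ K]) (auto intro!: K)
  qed
  fix a b :: real assume "a \<le> b"
  then have "(g has_integral f (b + t) - f (a + t)) (cbox (a + t) (b + t))"
    using primitive_has_integral[OF assms, of "a + t" "b + t"] by simp
  then have "((\<lambda>x. g (x + t)) has_integral f (b + t) - f (a + t)) (cbox a b)"
    using has_integral_affinity[of g _ "a + t" "b + t" 1 t] by simp
  then show "((\<lambda>x. g (x + t)) has_integral f (b + t) - f (a + t)) {a..b}" by simp
qed

lemma primitive_AE_cong:
  assumes "primitive f g" "loc_bounded g'" "AE x in lebesgue. g' x = g x"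
  shows "primitive f g'"
  unfolding primitive_def
proof (intro conjI allI impI)
  obtain N where N: "\<And>x. x \<in> space lebesgue - N \<Longrightarrow> g' x = g x" "N \<in> null_sets lebesgue"
    using AE_E3[OF assms(3)] by blast
  fix a b :: real assume "a \<le> b"
  show "(g' has_integral f b - f a) {a..b}"
    by (rule has_integral_spike[OF _ _ primitive_has_integral[OF assms(1) \<open>a \<le> b\<close>], of N])
       (use N in \<open>auto simp: negligible_iff_null_sets\<close>)
qed (use assms in auto)

text \<open>The workhorse: it is applied to differences of solutions of the profile equation, where \<open>A\<close> is a
  difference quotient of the nonlinearity.\<close>
lemma linear_ode_integrating_factor:
  assumes d: "primitive d (\<lambda>z. A z * d z + B z)" and A: "loc_bounded A"
  shows "primitive (\<lambda>z. exp (- signed_integral A z) * d z) (\<lambda>z. exp (- signed_integral A z) * B z)"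
proof -
  have 1: "primitive (\<lambda>z. - signed_integral A z) (\<lambda>z. - A z)"
    using primitive_cmult[OF primitive_signed_integral[OF A], of "-1"] by simp
  have "primitive (\<lambda>z. exp (- signed_integral A z)) (\<lambda>z. exp (- signed_integral A z) * - A z)"
    by (rule primitive_chain[OF 1, where U=UNIV and F=exp and F'=exp])
       (auto intro!: derivative_eq_intros continuous_intros)
  from primitive_mult[OF this d] show ?thesis
    by (rule primitive_cong) (auto simp: algebra_simps)
qed

section \<open>Functions determined by their integrals over intervals\<close>

text \<open>On a fine tagged division, Henstock's lemma replaces each \<open>|g(x)| |k|\<close> by \<open>|\<integral>\<^sub>k g| = - \<integral>\<^sub>k g\<close> with small
  total error, and these terms add up to \<open>- \<integral> g\<close>. This replaces Lebesgue's differentiation theorem.\<close>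
lemma integral_abs_le_of_nonpos_interval_integrals:
  fixes g :: "real \<Rightarrow> real"
  assumes g: "loc_bounded g" and nonpos: "\<And>a b. a \<le> b \<Longrightarrow> integral {a..b} g \<le> 0"
  shows "integral {a..b} (\<lambda>x. \<bar>g x\<bar>) \<le> - integral {a..b} g"
proof (rule field_le_epsilon)
  fix e :: real assume "e > 0"
  have ig: "g integrable_on cbox a b" "(\<lambda>x. \<bar>g x\<bar>) integrable_on cbox a b"
    using loc_bounded_integrable[OF g] loc_bounded_integrable[OF loc_bounded_abs[OF g]] by auto
  obtain \<gamma>1 where \<gamma>1: "gauge \<gamma>1" "\<And>p. \<lbrakk>p tagged_partial_division_of (cbox a b); \<gamma>1 fine p\<rbrakk> \<Longrightarrow>
      (\<Sum>(x,k)\<in>p. norm (measure lborel k *\<^sub>R g x - integral k g)) < e / 2"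
    using Henstock_lemma[OF ig(1), of "e/2"] \<open>e > 0\<close> by auto
  obtain \<gamma>2 where \<gamma>2: "gauge \<gamma>2" "\<And>p. \<lbrakk>p tagged_division_of (cbox a b); \<gamma>2 fine p\<rbrakk> \<Longrightarrow>
      norm ((\<Sum>(x,k)\<in>p. measure lborel k *\<^sub>R \<bar>g x\<bar>) - integral (cbox a b) (\<lambda>x. \<bar>g x\<bar>)) < e / 2"
    using integrable_integral[OF ig(2), unfolded has_integral] \<open>e > 0\<close> by (meson half_gt_zero)
  obtain p where p: "p tagged_division_of (cbox a b)" "\<gamma>1 fine p" "\<gamma>2 fine p"
    using fine_division_exists[OF gauge_Int[OF \<gamma>1(1) \<gamma>2(1)]] fine_Int by metis
  have "(\<Sum>(x,k)\<in>p. measure lborel k *\<^sub>R \<bar>g x\<bar>)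
      \<le> (\<Sum>(x,k)\<in>p. norm (measure lborel k *\<^sub>R g x - integral k g) - integral k g)"
  proof (rule sum_mono, clarify)
    fix x k assume "(x, k) \<in> p"
    then obtain u v where k: "k = cbox u v" "x \<in> k" using tagged_division_ofD[OF p(1)] by metis
    then have "integral k g \<le> 0" using nonpos[of u v] by auto
    moreover have "measure lborel k *\<^sub>R \<bar>g x\<bar> = \<bar>measure lborel k *\<^sub>R g x\<bar>" by (simp add: abs_mult)
    ultimately show "measure lborel k *\<^sub>R \<bar>g x\<bar> \<le> norm (measure lborel k *\<^sub>R g x - integral k g) - integral k g"
      unfolding real_norm_def by linarith
  qed
  also have "\<dots> = (\<Sum>(x,k)\<in>p. norm (measure lborel k *\<^sub>R g x - integral k g)) - integral (cbox a b) g"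
    unfolding integral_combine_tagged_division_topdown[OF ig(1) p(1)]
    by (simp add: sum_subtractf split_def)
  also have "\<dots> \<le> e / 2 - integral (cbox a b) g"
    using \<gamma>1(2)[OF _ p(2)] p(1) by (force simp: tagged_division_of_def)
  finally show "integral {a..b} (\<lambda>x. \<bar>g x\<bar>) \<le> - integral {a..b} g + e"
    using \<gamma>2(2)[OF p(1,3)] by (auto simp: abs_if split: if_splits)
qed

text \<open>The preceding bound says that \<open>|g| + g\<close>, which is nonnegative, has integral at most zero.\<close>
lemma AE_nonpos_of_interval_integrals:
  fixes g :: "real \<Rightarrow> real"
  assumes g: "loc_bounded g" and nonpos: "\<And>a b. a \<le> b \<Longrightarrow> integral {a..b} g \<le> 0"
  shows "AE x in lebesgue. g x \<le> 0"
proof -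
  let ?G = "\<lambda>x. \<bar>g x\<bar> + g x"
  have G: "loc_bounded ?G" by (intro loc_bounded_add loc_bounded_abs g)
  have "AE x in lebesgue. indicator {-real n..real n} x *\<^sub>R ?G x = 0" for n
  proof -
    have 1: "set_integrable lebesgue {-real n..real n} ?G" using loc_bounded_absolutely_integrable[OF G] .
    then have i: "integrable lebesgue (\<lambda>x. indicator {-real n..real n} x *\<^sub>R ?G x)"
      by (simp add: set_integrable_def)
    have "(LINT x|lebesgue. indicator {-real n..real n} x *\<^sub>R ?G x) = integral {-real n..real n} ?G"
      using set_lebesgue_integral_eq_integral(2)[OF 1] by (simp add: set_lebesgue_integral_def)
    also have "\<dots> = integral {-real n..real n} (\<lambda>x. \<bar>g x\<bar>) + integral {-real n..real n} g"
      by (intro Henstock_Kurzweil_Integration.integral_add loc_bounded_integrable loc_bounded_abs g)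
    also have "\<dots> \<le> 0"
      using integral_abs_le_of_nonpos_interval_integrals[OF assms, of "- real n" "real n"] by auto
    finally have "(LINT x|lebesgue. indicator {-real n..real n} x *\<^sub>R ?G x) \<le> 0" .
    moreover have nn: "indicator {-real n..real n} x *\<^sub>R ?G x \<ge> 0" for x
      by (auto simp: indicator_def)
    ultimately have "(LINT x|lebesgue. indicator {-real n..real n} x *\<^sub>R ?G x) = 0"
      by (intro antisym integral_nonneg_AE) auto
    then show ?thesis using integral_nonneg_eq_0_iff_AE[OF i] nn by auto
  qed
  then have "AE x in lebesgue. \<forall>n::nat. indicator {-real n..real n} x *\<^sub>R ?G x = 0"
    by (subst AE_all_countable) blast
  then show ?thesis
  proof (rule AE_mp, intro AE_I2 impI)
    fix x assume *: "\<forall>n::nat. indicator {-real n..real n} x *\<^sub>R ?G x = 0"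
    obtain n :: nat where "\<bar>x\<bar> \<le> real n" using real_arch_simple by blast
    then show "g x \<le> 0" using *[rule_format, of n] by (auto simp: indicator_def abs_le_iff split: if_splits)
  qed
qed

lemma AE_eq_zero_of_interval_integrals:
  fixes g :: "real \<Rightarrow> real"
  assumes g: "loc_bounded g" and zero: "\<And>a b. a \<le> b \<Longrightarrow> integral {a..b} g = 0"
  shows "AE x in lebesgue. g x = 0"
proof -
  have "AE x in lebesgue. g x \<le> 0" using zero by (intro AE_nonpos_of_interval_integrals g) auto
  moreover have "AE x in lebesgue. - g x \<le> 0"
    using zero by (intro AE_nonpos_of_interval_integrals loc_bounded_minus g) auto
  ultimately show ?thesis by eventually_elim auto
qed

text \<open>The integral of the difference vanishes identically, hence so does its derivative.\<close>
lemma continuous_AE_eq_imp_eq: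
  fixes f g :: "real \<Rightarrow> real"
  assumes "continuous_on UNIV f" "continuous_on UNIV g" "AE x in lebesgue. f x = g x"
  shows "f x = g x"
proof -
  have d: "continuous_on UNIV (\<lambda>x. f x - g x)" by (intro continuous_intros assms)
  have 0: "primitive (\<lambda>x. 0) (\<lambda>x. f x - g x)"
    by (rule primitive_AE_cong[OF primitive_const loc_bounded_continuous[OF d]]) (use assms(3) in auto)
  let ?G = "signed_integral (\<lambda>x. f x - g x)"
  have "?G y = 0" for y
    using primitive_unique[OF 0 primitive_signed_integral[OF primitive_loc_bounded[OF 0]], of y 0] by simp
  then have "?G = (\<lambda>y. 0)" by auto
  then show ?thesis using signed_integral_derivative[OF d, of x] DERIV_unique[OF _ DERIV_const] by force
qed

section \<open>Families depending smoothly on a parameter\<close>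

text \<open>\<open>f l z\<close> is \<open>n\<close> times differentiable in the parameter \<open>l\<close>, with derivatives jointly continuous in
  \<open>(l, z)\<close>. Joint continuity makes the notion stable under integration in \<open>z\<close>; no smoothness in
  \<open>z\<close> is asked for, since the coefficient of the equation is only measurable there. Functions of \<open>l\<close>
  alone are treated as families constant in \<open>z\<close>.\<close>
primrec param_smooth :: "nat \<Rightarrow> real set \<Rightarrow> (real \<Rightarrow> real \<Rightarrow> real) \<Rightarrow> bool" where
  "param_smooth 0 S f \<longleftrightarrow> continuous_on (S \<times> UNIV) (\<lambda>x. f (fst x) (snd x))"
| "param_smooth (Suc n) S f \<longleftrightarrow> continuous_on (S \<times> UNIV) (\<lambda>x. f (fst x) (snd x)) \<and>
    (\<exists>g. param_smooth n S g \<and> (\<forall>l\<in>S. \<forall>z. ((\<lambda>l. f l z) has_real_derivative g l z) (at l)))"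

lemma param_smooth_continuous:
  "param_smooth n S f \<Longrightarrow> continuous_on (S \<times> UNIV) (\<lambda>x. f (fst x) (snd x))"
  by (cases n) auto

lemma param_smooth_SucI:
  assumes "param_smooth n S f" "param_smooth n S g"
    "\<And>l z. l \<in> S \<Longrightarrow> ((\<lambda>l. f l z) has_real_derivative g l z) (at l)"
  shows "param_smooth (Suc n) S f"
  using assms by (auto intro: param_smooth_continuous)

lemma param_smooth_SucE:
  assumes "param_smooth (Suc n) S f"
  obtains g where "param_smooth n S g"
    "\<And>l z. l \<in> S \<Longrightarrow> ((\<lambda>l. f l z) has_real_derivative g l z) (at l)"
  using assms by auto

lemma param_smooth_SucD: "param_smooth (Suc n) S f \<Longrightarrow> param_smooth n S f"
proof (induction n arbitrary: f)
  case (Suc n)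
  obtain g where "param_smooth (Suc n) S g"
    "\<forall>l\<in>S. \<forall>z. ((\<lambda>l. f l z) has_real_derivative g l z) (at l)"
    using Suc.prems unfolding param_smooth.simps(2)[of "Suc n"] by blast
  then show ?case
    using param_smooth_continuous[OF Suc.prems] Suc.IH by (subst param_smooth.simps(2)) blast
qed simp

lemma param_smooth_const_param: "continuous_on UNIV h \<Longrightarrow> param_smooth n S (\<lambda>l z. h z)"
proof (induction n arbitrary: h)
  case 0
  have "continuous_on (S \<times> (UNIV::real set)) (\<lambda>x. h (snd x))"
    by (rule continuous_on_compose2[OF 0 continuous_on_snd]) (auto intro: continuous_on_id)
  then show ?case by simp
next
  case (Suc n)
  show ?case
    by (rule param_smooth_SucI[OF Suc.IH[OF Suc.prems] Suc.IH[of "\<lambda>z. 0"]]) auto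
qed

lemma param_smooth_const [simp]: "param_smooth n S (\<lambda>l z. c)"
  by (intro param_smooth_const_param) auto

lemma param_smooth_id: "param_smooth n S (\<lambda>l z. l)"
proof (cases n)
  case (Suc m)
  have "param_smooth m S (\<lambda>l z. l)"
    by (induction m) (auto intro!: continuous_intros exI[of _ "\<lambda>l z. 1"])
  then show ?thesis unfolding Suc by (rule param_smooth_SucI[OF _ param_smooth_const[of _ _ 1]]) auto
qed (auto intro!: continuous_intros)

lemma param_smooth_add:
  "param_smooth n S f \<Longrightarrow> param_smooth n S g \<Longrightarrow> param_smooth n S (\<lambda>l z. f l z + g l z)"
proof (induction n arbitrary: f g)
  case 0
  then show ?case by (auto intro!: continuous_intros)
next
  case (Suc n)
  obtain f' where f': "param_smooth n S f'" "\<And>l z. l \<in> S \<Longrightarrow> ((\<lambda>l. f l z) has_real_derivative f' l z) (at l)"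
    using param_smooth_SucE[OF Suc.prems(1)] by metis
  obtain g' where g': "param_smooth n S g'" "\<And>l z. l \<in> S \<Longrightarrow> ((\<lambda>l. g l z) has_real_derivative g' l z) (at l)"
    using param_smooth_SucE[OF Suc.prems(2)] by metis
  show ?case
    by (rule param_smooth_SucI[OF Suc.IH[OF Suc.prems[THEN param_smooth_SucD]] Suc.IH[OF f'(1) g'(1)]])
       (auto intro!: DERIV_add f' g')
qed

lemma param_smooth_mult:
  "param_smooth n S f \<Longrightarrow> param_smooth n S g \<Longrightarrow> param_smooth n S (\<lambda>l z. f l z * g l z)"
proof (induction n arbitrary: f g)
  case 0
  then show ?case by (auto intro!: continuous_intros)
next
  case (Suc n)
  obtain f' where f': "param_smooth n S f'" "\<And>l z. l \<in> S \<Longrightarrow> ((\<lambda>l. f l z) has_real_derivative f' l z) (at l)"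
    using param_smooth_SucE[OF Suc.prems(1)] by metis
  obtain g' where g': "param_smooth n S g'" "\<And>l z. l \<in> S \<Longrightarrow> ((\<lambda>l. g l z) has_real_derivative g' l z) (at l)"
    using param_smooth_SucE[OF Suc.prems(2)] by metis
  note D = Suc.prems[THEN param_smooth_SucD]
  show ?case
    by (rule param_smooth_SucI[OF Suc.IH[OF D] param_smooth_add[OF Suc.IH[OF f'(1) D(2)] Suc.IH[OF g'(1) D(1)]]])
       (auto intro!: DERIV_mult f' g')
qed

lemma param_smooth_cmult: "param_smooth n S f \<Longrightarrow> param_smooth n S (\<lambda>l z. c * f l z)"
  by (intro param_smooth_mult) auto

lemma param_smooth_minus: "param_smooth n S f \<Longrightarrow> param_smooth n S (\<lambda>l z. - f l z)"
  using param_smooth_cmult[of n S f "-1"] by simp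

lemma param_smooth_diff:
  "param_smooth n S f \<Longrightarrow> param_smooth n S g \<Longrightarrow> param_smooth n S (\<lambda>l z. f l z - g l z)"
  using param_smooth_add[OF _ param_smooth_minus, of n S f g] by simp

lemma param_smooth_exp: "param_smooth n S f \<Longrightarrow> param_smooth n S (\<lambda>l z. exp (f l z))"
proof (induction n arbitrary: f)
  case 0
  then show ?case by (auto intro!: continuous_intros)
next
  case (Suc n)
  obtain f' where f': "param_smooth n S f'" "\<And>l z. l \<in> S \<Longrightarrow> ((\<lambda>l. f l z) has_real_derivative f' l z) (at l)"
    using param_smooth_SucE[OF Suc.prems(1)] by metis
  note E = Suc.IH[OF param_smooth_SucD[OF Suc.prems]]
  show ?case
    by (rule param_smooth_SucI[OF E param_smooth_mult[OF E f'(1)]])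
       (auto intro!: DERIV_fun_exp f')
qed

lemma param_smooth_inverse:
  "param_smooth n S f \<Longrightarrow> (\<And>l z. l \<in> S \<Longrightarrow> f l z \<noteq> 0) \<Longrightarrow> param_smooth n S (\<lambda>l z. inverse (f l z))"
proof (induction n arbitrary: f)
  case 0
  then show ?case by (auto intro!: continuous_intros)
next
  case (Suc n)
  obtain f' where f': "param_smooth n S f'" "\<And>l z. l \<in> S \<Longrightarrow> ((\<lambda>l. f l z) has_real_derivative f' l z) (at l)"
    using param_smooth_SucE[OF Suc.prems(1)] by metis
  note E = Suc.IH[OF param_smooth_SucD[OF Suc.prems(1)] Suc.prems(2)]
  show ?case
    by (rule param_smooth_SucI[OF E param_smooth_minus[OF param_smooth_mult[OF f'(1) param_smooth_mult[OF E E]]]])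
       (auto intro!: derivative_eq_intros f' simp: Suc.prems(2))
qed

lemma param_smooth_divide:
  "param_smooth n S f \<Longrightarrow> param_smooth n S g \<Longrightarrow> (\<And>l z. l \<in> S \<Longrightarrow> g l z \<noteq> 0) \<Longrightarrow>
    param_smooth n S (\<lambda>l z. f l z / g l z)"
  unfolding divide_inverse by (intro param_smooth_mult param_smooth_inverse)

lemma param_smooth_sqrt:
  "param_smooth n S f \<Longrightarrow> (\<And>l z. l \<in> S \<Longrightarrow> f l z > 0) \<Longrightarrow> param_smooth n S (\<lambda>l z. sqrt (f l z))"
proof (induction n arbitrary: f)
  case 0
  then show ?case by (auto intro!: continuous_intros)
next
  case (Suc n)
  obtain f' where f': "param_smooth n S f'" "\<And>l z. l \<in> S \<Longrightarrow> ((\<lambda>l. f l z) has_real_derivative f' l z) (at l)"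
    using param_smooth_SucE[OF Suc.prems(1)] by metis
  note E = Suc.IH[OF param_smooth_SucD[OF Suc.prems(1)] Suc.prems(2)]
  have nz: "2 * sqrt (f l z) \<noteq> 0" if "l \<in> S" for l z using Suc.prems(2)[OF that, of z] by simp
  show ?case
  proof (rule param_smooth_SucI[OF E param_smooth_divide[OF f'(1) param_smooth_cmult[OF E, of 2] nz]])
    fix l z assume l: "l \<in> S"
    have "((\<lambda>l. sqrt (f l z)) has_real_derivative inverse (sqrt (f l z)) / 2 * f' l z) (at l)"
      by (rule DERIV_chain2[OF DERIV_real_sqrt[OF Suc.prems(2)[OF l]] f'(2)[OF l]])
    then show "((\<lambda>l. sqrt (f l z)) has_real_derivative f' l z / (2 * sqrt (f l z))) (at l)"
      by (simp add: divide_simps mult.commute)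
  qed
qed

lemma param_smooth_freeze: "param_smooth n S f \<Longrightarrow> param_smooth n S (\<lambda>l z. f l z0)"
proof (induction n arbitrary: f)
  case 0
  have c: "continuous_on (S \<times> (UNIV::real set)) (\<lambda>x. (fst x, z0))" by (intro continuous_intros)
  have "(\<lambda>x. (fst x, z0)) ` (S \<times> (UNIV::real set)) \<subseteq> S \<times> UNIV" by auto
  from continuous_on_compose2[OF param_smooth_continuous[OF 0] c this] show ?case by simp
next
  case (Suc n)
  obtain f' where f': "param_smooth n S f'" "\<And>l z. l \<in> S \<Longrightarrow> ((\<lambda>l. f l z) has_real_derivative f' l z) (at l)"
    using param_smooth_SucE[OF Suc.prems(1)] by metis
  show ?case
    by (rule param_smooth_SucI[OF Suc.IH[OF param_smooth_SucD[OF Suc.prems(1)]] Suc.IH[OF f'(1)]]) (rule f'(2))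
qed

lemma param_smooth_slice:
  assumes "param_smooth n S f" "l \<in> S" shows "continuous_on UNIV (f l)"
proof -
  have "continuous_on UNIV (\<lambda>z. (\<lambda>x. f (fst x) (snd x)) (l, z))"
    by (rule continuous_on_compose2[OF param_smooth_continuous[OF assms(1)]])
       (use assms in \<open>auto intro!: continuous_intros\<close>)
  then show ?thesis by simp
qed

text \<open>With the variable \<open>z\<close> moved into the integrand, continuity and differentiation under the integral
  sign apply on a fixed interval and for both signs of \<open>z\<close>.\<close>
lemma signed_integral_rescale:
  assumes "continuous_on UNIV g"
  shows "signed_integral g z = z * integral (cbox 0 1) (\<lambda>u. g (z * u))"
proof -
  have "((\<lambda>u. z * g (z * u)) has_integral signed_integral g (z * 1) - signed_integral g (z * 0)) {0..1}"
  proof (rule fundamental_theorem_of_calculus)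
    fix x :: real
    have "((\<lambda>u. signed_integral g (z * u)) has_real_derivative g (z * x) * z) (at x)"
      by (rule DERIV_chain2[OF signed_integral_derivative[OF assms]]) (auto intro!: derivative_eq_intros)
    then show "((\<lambda>u. signed_integral g (z * u)) has_vector_derivative z * g (z * x)) (at x within {0..1})"
      by (auto simp: has_real_derivative_iff_has_vector_derivative[symmetric] mult.commute
          intro: has_field_derivative_at_within)
  qed auto
  from integral_unique[OF this] show ?thesis by simp
qed

lemma param_smooth_signed_integral:
  assumes S: "open S"
  shows "param_smooth n S f \<Longrightarrow> param_smooth n S (\<lambda>l z. signed_integral (f l) z)"
proof (induction n arbitrary: f)
  have cont: "continuous_on (S \<times> UNIV) (\<lambda>x. signed_integral (f (fst x)) (snd x))"
    if f: "param_smooth 0 S f" for f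
  proof -
    have c: "continuous_on ((S \<times> (UNIV::real set)) \<times> cbox (0::real) 1) (\<lambda>p. (fst (fst p), snd (fst p) * snd p))"
      by (intro continuous_intros)
    have "continuous_on ((S \<times> UNIV) \<times> cbox 0 1) (\<lambda>p. (\<lambda>x. f (fst x) (snd x)) (fst (fst p), snd (fst p) * snd p))"
      by (rule continuous_on_compose2[OF param_smooth_continuous[OF f] c]) auto
    then have "continuous_on (S \<times> UNIV) (\<lambda>x. integral (cbox 0 1) (\<lambda>u. f (fst x) (snd x * u)))"
      by (intro integral_continuous_on_param) (simp add: split_def)
    then have "continuous_on (S \<times> UNIV) (\<lambda>x. snd x * integral (cbox 0 1) (\<lambda>u. f (fst x) (snd x * u)))"
      by (intro continuous_intros)
    then show ?thesis
      by (rule continuous_on_cong[THEN iffD1, rotated 2])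
         (use signed_integral_rescale[OF param_smooth_slice[OF f]] in auto)
  qed
  {
    case 0
    then show ?case using cont by simp
  next
    case (Suc n)
    obtain g where g: "param_smooth n S g" "\<And>l z. l \<in> S \<Longrightarrow> ((\<lambda>l. f l z) has_real_derivative g l z) (at l)"
      using param_smooth_SucE[OF Suc.prems(1)] by metis
    show ?case
    proof (rule param_smooth_SucI[OF Suc.IH[OF param_smooth_SucD[OF Suc.prems(1)]] Suc.IH[OF g(1)]])
      fix l z assume l: "l \<in> S"
      then obtain r where r: "r > 0" "ball l r \<subseteq> S" using S by (meson open_contains_ball)
      have c: "continuous_on (ball l r \<times> cbox (0::real) 1) (\<lambda>p. (fst p, z * snd p))"
        by (intro continuous_intros)
      have "continuous_on (ball l r \<times> cbox 0 1) (\<lambda>p. (\<lambda>x. g (fst x) (snd x)) (fst p, z * snd p))"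
        by (rule continuous_on_compose2[OF param_smooth_continuous[OF g(1)] c]) (use r in auto)
      then have cg: "continuous_on (ball l r \<times> cbox 0 1) (\<lambda>(l, u). g l (z * u))" by (simp add: split_def)
      have inf: "(\<lambda>u. f k (z * u)) integrable_on cbox 0 1" if "k \<in> ball l r" for k
      proof -
        have k: "k \<in> S" using that r by auto
        have c: "continuous_on UNIV (\<lambda>u. z * u)" by (intro continuous_intros)
        have "continuous_on UNIV (\<lambda>u. f k (z * u))"
          by (rule continuous_on_compose2[OF param_smooth_slice[OF Suc.prems k] c subset_UNIV])
        then show ?thesis using continuous_on_subset integrable_continuous by blast
      qed
      have df: "((\<lambda>l. f l (z * t)) has_real_derivative g k (z * t)) (at k within ball l r)" if "k \<in> ball l r" for k t
        using that r by (intro has_field_derivative_at_within[OF g(2)]) auto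
      have "((\<lambda>l. integral (cbox 0 1) (\<lambda>u. f l (z * u))) has_real_derivative
          integral (cbox 0 1) (\<lambda>u. g l (z * u))) (at l within ball l r)"
        by (rule leibniz_rule_field_derivative[OF df inf cg]) (use r in auto)
      then have "((\<lambda>l. integral (cbox 0 1) (\<lambda>u. f l (z * u))) has_real_derivative
          integral (cbox 0 1) (\<lambda>u. g l (z * u))) (at l)"
        using r(1) by (subst (asm) at_within_open) auto
      then have "((\<lambda>l. z * integral (cbox 0 1) (\<lambda>u. f l (z * u))) has_real_derivative
          z * integral (cbox 0 1) (\<lambda>u. g l (z * u))) (at l)"
        by (rule DERIV_cmult)
      then have "((\<lambda>l. signed_integral (f l) z) has_real_derivative
          z * integral (cbox 0 1) (\<lambda>u. g l (z * u))) (at l)"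
        by (rule has_field_derivative_transform_within_open[OF _ S l])
           (rule signed_integral_rescale[OF param_smooth_slice[OF Suc.prems], symmetric])
      then show "((\<lambda>l. signed_integral (f l) z) has_real_derivative signed_integral (g l) z) (at l)"
        using signed_integral_rescale[OF param_smooth_slice[OF g(1) l], of z] by simp
    qed
  }
qed

text \<open>Derivatives of a family are only known on the open parameter set, so iterates of \<open>deriv\<close> must be
  compared locally.\<close>
lemma deriv_funpow_cong_open:
  assumes "open S" "\<And>x. x \<in> S \<Longrightarrow> f x = g x" "x \<in> S"
  shows "(deriv ^^ n) f x = (deriv ^^ n) g x"
  using assms(3)
proof (induction n arbitrary: x)
  case (Suc n)
  have "eventually (\<lambda>y. (deriv ^^ n) f y = (deriv ^^ n) g y) (nhds x)"
    using eventually_nhds_in_open[OF assms(1) Suc.prems] by eventually_elim (rule Suc.IH)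
  then show ?case by (simp add: deriv_cong_ev)
qed (use assms in auto)

lemma param_smooth_imp_smooth_on:
  assumes S: "open S" and f: "\<And>n. param_smooth n S (\<lambda>l z. f l)"
  shows "smooth_on S f"
proof -
  have *: "((deriv ^^ n) (\<lambda>l. f l z)) differentiable (at l)"
    if "param_smooth (Suc n) S f" "l \<in> S" for f :: "real \<Rightarrow> real \<Rightarrow> real" and l z n
    using that
  proof (induction n arbitrary: f l)
    case 0
    then show ?case by (auto simp: real_differentiable_def)
  next
    case (Suc n)
    obtain g where g: "param_smooth (Suc n) S g" "\<And>l z. l \<in> S \<Longrightarrow> ((\<lambda>l. f l z) has_real_derivative g l z) (at l)"
      using param_smooth_SucE[OF Suc.prems(1)] by metis
    have 1: "(deriv ^^ n) (\<lambda>l. g l z) differentiable (at l)" by (rule Suc.IH[OF g(1) Suc.prems(2)])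
    have 2: "(deriv ^^ n) (\<lambda>l. g l z) y = (deriv ^^ Suc n) (\<lambda>l. f l z) y" if "y \<in> S" for y
      unfolding funpow_Suc_right o_apply
      using deriv_funpow_cong_open[OF S, of "\<lambda>l. g l z" "deriv (\<lambda>l. f l z)" y n] DERIV_imp_deriv[OF g(2)] that
      by auto
    obtain D where D: "((deriv ^^ n) (\<lambda>l. g l z) has_derivative D) (at l)"
      using 1 unfolding differentiable_def by blast
    have "((deriv ^^ Suc n) (\<lambda>l. f l z) has_derivative D) (at l)"
      by (rule has_derivative_transform_within_open[OF D S Suc.prems(2) 2])
    then show ?case unfolding differentiable_def by blast
  qed
  show ?thesis unfolding smooth_on_def using *[OF f] by blast
qed

lemma param_smooth_subset: "param_smooth n S f \<Longrightarrow> T \<subseteq> S \<Longrightarrow> param_smooth n T f"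
proof (induction n arbitrary: f)
  case 0
  then have "T \<times> (UNIV::real set) \<subseteq> S \<times> UNIV" by auto
  from continuous_on_subset[OF param_smooth_continuous[OF 0(1)] this] show ?case by simp
next
  case (Suc n)
  obtain g where g: "param_smooth n S g" "\<And>l z. l \<in> S \<Longrightarrow> ((\<lambda>l. f l z) has_real_derivative g l z) (at l)"
    using param_smooth_SucE[OF Suc.prems(1)] by metis
  show ?case
    by (rule param_smooth_SucI[OF Suc.IH[OF param_smooth_SucD[OF Suc.prems(1)] Suc.prems(2)] Suc.IH[OF g(1) Suc.prems(2)]])
       (use g(2) Suc.prems(2) in auto)
qed

lemma param_smooth_param_slice:
  assumes "param_smooth n S f" shows "continuous_on S (\<lambda>l. f l z)"
proof -
  have c: "continuous_on S (\<lambda>l. (l, z))" by (intro continuous_intros)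
  from continuous_on_compose2[OF param_smooth_continuous[OF assms] c] show ?thesis by auto
qed

section \<open>Weak derivatives on the line\<close>

lemma integral_compact_support:
  assumes u: "loc_bounded u" and z: "\<And>x. \<bar>x\<bar> > N \<Longrightarrow> u x = 0"
  shows "integrable lebesgue u" "(LINT x|lebesgue. u x) = integral {-N..N} u"
proof -
  have e: "(\<lambda>x. indicator {-N..N} x *\<^sub>R u x) = u"
  proof
    fix x show "indicator {-N..N} x *\<^sub>R u x = u x"
      using z[of x] by (cases "\<bar>x\<bar> > N") (auto simp: indicator_def)
  qed
  have s: "set_integrable lebesgue {-N..N} u" by (rule loc_bounded_absolutely_integrable[OF u])
  show "integrable lebesgue u" using s unfolding set_integrable_def e .
  show "(LINT x|lebesgue. u x) = integral {-N..N} u"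
    using set_lebesgue_integral_eq_integral(2)[OF s] unfolding set_lebesgue_integral_def e .
qed

lemma loc_bounded_locally_integrable:
  assumes "loc_bounded f" shows "locally_integrable f"
  unfolding locally_integrable_def
proof (intro allI impI)
  fix K :: "real set" assume K: "compact K"
  then obtain N where N: "\<And>x. x \<in> K \<Longrightarrow> \<bar>x\<bar> \<le> N" using compact_imp_bounded bounded_real by metis
  show "set_integrable lebesgue K f"
  proof (rule set_integrable_subset[OF loc_bounded_absolutely_integrable[OF assms]])
    show "K \<in> sets lebesgue" using lmeasurable_compact[OF K] by auto
    show "K \<subseteq> {-N..N}" using N by (auto simp: abs_le_iff minus_le_iff)
  qed
qed

text \<open>What integration by parts needs of a test function; the bound \<open>N\<close> is taken beyond the support so that
  the derivative vanishes there too.\<close>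
lemma test_functionD:
  assumes "test_function \<phi>"
  obtains N where "primitive \<phi> (deriv \<phi>)" "continuous_on UNIV (deriv \<phi>)" "N \<ge> 0"
    "\<forall>x. \<bar>x\<bar> \<ge> N \<longrightarrow> \<phi> x = 0" "\<forall>x. \<bar>x\<bar> > N \<longrightarrow> deriv \<phi> x = 0"
proof -
  have sm: "\<And>n x. (deriv ^^ n) \<phi> differentiable (at x)" and cpt: "compact (closure {x. \<phi> x \<noteq> 0})"
    using assms by (auto simp: test_function_def smooth_on_def)
  have d: "(\<phi> has_real_derivative deriv \<phi> x) (at x)" for x
    using sm[of 0 x] by (simp add: DERIV_deriv_iff_real_differentiable)
  have c: "continuous_on UNIV (deriv \<phi>)"
    using sm[of "Suc 0"] by (intro continuous_at_imp_continuous_on ballI differentiable_imp_continuous_within) simp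
  obtain N where N: "\<And>x. x \<in> closure {x. \<phi> x \<noteq> 0} \<Longrightarrow> \<bar>x\<bar> \<le> N"
    using compact_imp_bounded[OF cpt] bounded_real by metis
  define M where "M = max 0 N + 1"
  have z: "\<phi> x = 0" if "\<bar>x\<bar> \<ge> M" for x
  proof (rule ccontr)
    assume "\<phi> x \<noteq> 0"
    then have "x \<in> closure {x. \<phi> x \<noteq> 0}" by (intro closure_subset[THEN subsetD]) simp
    then show False using N[of x] that by (simp add: M_def)
  qed
  have "deriv \<phi> x = 0" if "\<bar>x\<bar> > M" for x
  proof -
    have "open {x::real. \<bar>x\<bar> > M}" by (intro open_Collect_less continuous_intros)
    moreover have "((\<lambda>x. 0) has_real_derivative 0) (at x)" by simp
    ultimately have "(\<phi> has_real_derivative 0) (at x)"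
      using that z by (elim has_field_derivative_transform_within_open[of _ _ _ "{x. \<bar>x\<bar> > M}"]) auto
    then show ?thesis using DERIV_imp_deriv by blast
  qed
  then show ?thesis
    by (intro that[of M] primitive_derivative d c) (use z in \<open>auto simp: M_def\<close>)
qed

lemma primitive_has_weak_deriv:
  assumes fg: "primitive f g" shows "has_weak_deriv f g"
  unfolding has_weak_deriv_def
proof (intro conjI allI impI)
  show "locally_integrable f" "locally_integrable g"
    using loc_bounded_primitive[OF fg] primitive_loc_bounded[OF fg]
    by (auto intro: loc_bounded_locally_integrable)
  fix \<phi> assume "test_function \<phi>"
  then obtain N where \<phi>: "primitive \<phi> (deriv \<phi>)" "continuous_on UNIV (deriv \<phi>)" "N \<ge> 0"
    "\<forall>x. \<bar>x\<bar> \<ge> N \<longrightarrow> \<phi> x = 0" "\<forall>x. \<bar>x\<bar> > N \<longrightarrow> deriv \<phi> x = 0"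
    by (rule test_functionD)
  have P: "primitive (\<lambda>x. f x * \<phi> x) (\<lambda>x. g x * \<phi> x + f x * deriv \<phi> x)"
    by (rule primitive_mult[OF fg \<phi>(1)])
  have l: "loc_bounded (\<lambda>x. g x * \<phi> x)" "loc_bounded (\<lambda>x. f x * deriv \<phi> x)"
    by (intro loc_bounded_mult primitive_loc_bounded[OF fg] loc_bounded_primitive[OF fg]
        loc_bounded_primitive[OF \<phi>(1)] primitive_loc_bounded[OF \<phi>(1)])+
  have "integral {-N..N} (\<lambda>x. g x * \<phi> x + f x * deriv \<phi> x) = f N * \<phi> N - f (-N) * \<phi> (-N)"
    using primitive_integral[OF P, of "-N" N] \<phi>(3) by simp
  then have "integral {-N..N} (\<lambda>x. g x * \<phi> x) + integral {-N..N} (\<lambda>x. f x * deriv \<phi> x) = 0"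
    using \<phi>(3,4) l by (simp add: Henstock_Kurzweil_Integration.integral_add loc_bounded_integrable)
  then show "(LINT x|lebesgue. f x * deriv \<phi> x) = - (LINT x|lebesgue. g x * \<phi> x)"
    using integral_compact_support(2)[OF l(1), of N] integral_compact_support(2)[OF l(2), of N] \<phi>(4,5) by auto
qed

text \<open>The class of functions \<open>p(1/x) exp(-1/x)\<close>, extended by zero to \<open>x \<le> 0\<close>, is closed under
  differentiation, which makes the smoothness of \<open>exp(-1/x)\<close> an induction.\<close>
definition flat :: "real poly \<Rightarrow> real \<Rightarrow> real" where
  "flat p x = (if x \<le> 0 then 0 else poly p (1 / x) * exp (- (1 / x)))"

lemma flat_tendsto_0: "(flat p \<longlongrightarrow> 0) (at 0)"
proof (rule filterlim_split_at)
  have "eventually (\<lambda>x::real. x < 0) (at_left 0)" by (simp add: eventually_at_filter)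
  then have "eventually (\<lambda>x. 0 = flat p x) (at_left 0)" by eventually_elim (simp add: flat_def)
  then show "(flat p \<longlongrightarrow> 0) (at_left 0)" by (rule Lim_transform_eventually[OF tendsto_const])
next
  have "((\<lambda>y. \<Sum>i\<le>degree p. coeff p i * (y ^ i / exp y)) \<longlongrightarrow> (\<Sum>i\<le>degree p. coeff p i * 0)) at_top"
    by (intro tendsto_intros tendsto_power_div_exp_0)
  then have "((\<lambda>y. poly p y * exp (- y)) \<longlongrightarrow> 0) at_top"
    by (simp add: poly_altdef sum_distrib_right sum_divide_distrib exp_minus field_simps)
  moreover have "filterlim (\<lambda>x::real. 1 / x) at_top (at_right 0)"
    using filterlim_inverse_at_top_right by (simp add: inverse_eq_divide)
  ultimately have "((\<lambda>x. poly p (1 / x) * exp (- (1 / x))) \<longlongrightarrow> 0) (at_right 0)"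
    by (rule filterlim_compose)
  moreover have "eventually (\<lambda>x. poly p (1 / x) * exp (- (1 / x)) = flat p x) (at_right 0)"
    using eventually_at_right_less by eventually_elim (simp add: flat_def)
  ultimately show "(flat p \<longlongrightarrow> 0) (at_right 0)" by (rule Lim_transform_eventually)
qed

lemma flat_derivative:
  "(flat p has_real_derivative flat ([:0, 0, 1:] * (p - pderiv p)) x) (at x)"
proof -
  consider "x < 0" | "x = 0" | "x > 0" by linarith
  then show ?thesis
  proof cases
    case 1
    have "((\<lambda>x. 0) has_real_derivative 0) (at x)" by simp
    then have "(flat p has_real_derivative 0) (at x)"
      by (rule has_field_derivative_transform_within_open[of _ _ _ "{..<0}"]) (use 1 in \<open>auto simp: flat_def\<close>)
    then show ?thesis using 1 by (simp add: flat_def)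
  next
    case 2
    have "eventually (\<lambda>h. flat (pCons 0 p) h = (flat p (0 + h) - flat p 0) / h) (at 0)"
      unfolding eventually_at by (rule exI[of _ 1]) (auto simp: flat_def)
    then have "((\<lambda>h. (flat p (0 + h) - flat p 0) / h) \<longlongrightarrow> 0) (at 0)"
      by (rule Lim_transform_eventually[OF flat_tendsto_0])
    then show ?thesis using 2 by (simp add: DERIV_def flat_def)
  next
    case 3
    have "((\<lambda>x. poly p (1 / x) * exp (- (1 / x))) has_real_derivative
      poly ([:0, 0, 1:] * (p - pderiv p)) (1 / x) * exp (- (1 / x))) (at x)"
      using 3
      by (auto intro!: derivative_eq_intros DERIV_chain2[OF poly_DERIV] simp: field_simps power2_eq_square)
    then have "(flat p has_real_derivative poly ([:0, 0, 1:] * (p - pderiv p)) (1 / x) * exp (- (1 / x))) (at x)"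
      by (rule has_field_derivative_transform_within_open[of _ _ _ "{0<..}"]) (use 3 in \<open>auto simp: flat_def\<close>)
    then show ?thesis using 3 by (simp add: flat_def)
  qed
qed

lemma param_smooth_flat_affine: "param_smooth n UNIV (\<lambda>l z. flat p (\<alpha> * l + \<beta>))"
proof (induction n arbitrary: p)
  have d: "((\<lambda>l. flat p (\<alpha> * l + \<beta>)) has_real_derivative
      \<alpha> * flat ([:0, 0, 1:] * (p - pderiv p)) (\<alpha> * l + \<beta>)) (at l)" for p l
  proof -
    have "((\<lambda>l. \<alpha> * l + \<beta>) has_real_derivative \<alpha>) (at l)" by (auto intro!: derivative_eq_intros)
    from DERIV_chain2[OF flat_derivative this] show ?thesis by (simp add: mult.commute)
  qed
  {
    case 0
    have "continuous_on UNIV (\<lambda>l. flat p (\<alpha> * l + \<beta>))"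
      using d by (meson DERIV_isCont continuous_at_imp_continuous_on)
    from continuous_on_compose2[OF this continuous_on_fst[OF continuous_on_id]] show ?case by auto
  next
    case (Suc n)
    show ?case by (rule param_smooth_SucI[OF Suc.IH param_smooth_cmult[OF Suc.IH] d])
  }
qed

text \<open>The product of \<open>exp(-1/(n(x - a)))\<close> and \<open>exp(-1/(n(b - x)))\<close> on \<open>(a, b)\<close>: smooth
  functions between 0 and 1 increasing to the indicator of the interval.\<close>
definition bump :: "real \<Rightarrow> real \<Rightarrow> nat \<Rightarrow> real \<Rightarrow> real" where
  "bump a b n x = flat 1 (real n * (x - a)) * flat 1 (real n * (b - x))"

lemma param_smooth_bump: "param_smooth k UNIV (\<lambda>l z. bump a b n l)"
proof -
  have "param_smooth k UNIV (\<lambda>l z. flat 1 (real n * l + - real n * a) * flat 1 (- real n * l + real n * b))"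
    by (intro param_smooth_mult param_smooth_flat_affine)
  then show ?thesis by (simp add: bump_def algebra_simps)
qed

lemma bump_outside: "x \<notin> {a<..<b} \<Longrightarrow> bump a b n x = 0"
  by (auto simp: bump_def flat_def mult_nonneg_nonpos)

lemma bump_bounds: "0 \<le> bump a b n x" "bump a b n x \<le> 1"
  by (auto simp: bump_def flat_def intro!: mult_le_one)

lemma bump_tendsto: "(\<lambda>n. bump a b n x) \<longlonglongrightarrow> indicator {a<..<b} x"
proof (cases "x \<in> {a<..<b}")
  case False
  then show ?thesis by (simp add: bump_outside)
next
  case True
  have lim: "(\<lambda>n. flat 1 (real n * c)) \<longlonglongrightarrow> 1" if "c > 0" for c
  proof -
    have "(\<lambda>n. exp (- (inverse (real n) * (1 / c)))) \<longlonglongrightarrow> exp (- (0 * (1 / c)))"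
      by (intro tendsto_intros lim_inverse_n)
    moreover have "eventually (\<lambda>n. exp (- (inverse (real n) * (1 / c))) = flat 1 (real n * c)) sequentially"
      using eventually_gt_at_top[of 0] by eventually_elim (use that in \<open>auto simp: flat_def field_simps mult_le_0_iff\<close>)
    ultimately show ?thesis by (auto intro: Lim_transform_eventually)
  qed
  have "(\<lambda>n. bump a b n x) \<longlonglongrightarrow> 1 * 1"
    unfolding bump_def using True by (intro tendsto_mult lim) auto
  then show ?thesis using True by simp
qed

lemma continuous_bump: "continuous_on UNIV (bump a b n)"
proof -
  have "isCont (bump a b n) x" for x
    using param_smooth_SucE[OF param_smooth_bump[of "Suc 0" a b n]] DERIV_isCont by (metis UNIV_I)
  then show ?thesis by (simp add: continuous_at_imp_continuous_on)
qed

lemma bump_integral_pos: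
  assumes "n > 0" "c \<le> a" "a < b" "b \<le> d" shows "integral {c..d} (bump a b n) > 0"
proof -
  have c: "continuous_on {c..d} (bump a b n)" using continuous_bump continuous_on_subset by blast
  have "integral {c..d} (bump a b n) \<ge> 0"
    by (intro Henstock_Kurzweil_Integration.integral_nonneg integrable_continuous_real c) (simp add: bump_bounds)
  moreover have "integral {c..d} (bump a b n) \<noteq> 0"
  proof
    assume "integral {c..d} (bump a b n) = 0"
    then have "(bump a b n has_integral 0) (cbox c d)"
      using integrable_integral[OF integrable_continuous_real[OF c]] by simp
    then have "bump a b n ((a + b) / 2) = 0"
      using has_integral_0_cbox_imp_0[of c d "bump a b n"] c assms by (auto simp: bump_bounds)
    moreover have "real n * ((a + b) / 2 - a) > 0" "real n * (b - (a + b) / 2) > 0"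
      using assms by (auto simp: field_simps)
    then have "bump a b n ((a + b) / 2) > 0" unfolding bump_def flat_def by (auto simp: not_le)
    ultimately show False by simp
  qed
  ultimately show ?thesis by simp
qed

text \<open>The primitive starting at \<open>-N\<close> vanishes to the left of \<open>-N\<close>, and to the right of \<open>N\<close> because the
  total integral is zero.\<close>
lemma test_function_antiderivative:
  assumes w: "\<And>n. param_smooth n UNIV (\<lambda>l z. w l)" and out: "\<And>x. \<bar>x\<bar> \<ge> N \<Longrightarrow> w x = 0"
    and N: "N \<ge> 0" and zero: "integral {-N..N} w = 0"
  shows "\<exists>\<phi>. test_function \<phi> \<and> deriv \<phi> = w"
proof -
  have c: "continuous_on UNIV w"
  proof -
    have "isCont w x" for x
      using param_smooth_SucE[OF w[of "Suc 0"]] DERIV_isCont by (metis UNIV_I)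
    then show ?thesis by (simp add: continuous_at_imp_continuous_on)
  qed
  define \<phi> where "\<phi> = (\<lambda>x. signed_integral w x - signed_integral w (-N))"
  have d: "(\<phi> has_real_derivative w x) (at x)" for x
    unfolding \<phi>_def using DERIV_diff[OF signed_integral_derivative[OF c] DERIV_const] by simp
  have P: "primitive \<phi> w" by (rule primitive_derivative[OF d c])
  have z: "\<phi> x = 0" if "\<bar>x\<bar> \<ge> N" for x
  proof (cases "x \<le> -N")
    case True
    have "\<bar>\<phi> (-N) - \<phi> x\<bar> \<le> 0 * (-N - x)"
      by (rule primitive_abs_le[OF P True]) (use N out in auto)
    then show ?thesis by (simp add: \<phi>_def)
  next
    case False
    then have x: "N \<le> x" using that by auto
    have "\<bar>\<phi> x - \<phi> N\<bar> \<le> 0 * (x - N)"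
      by (rule primitive_abs_le[OF P x]) (use N out in auto)
    moreover have "\<phi> N = \<phi> (-N)" using primitive_integral[OF P, of "-N" N] zero N by simp
    ultimately show ?thesis by (simp add: \<phi>_def)
  qed
  have "param_smooth n UNIV (\<lambda>l z. \<phi> l)" for n
  proof (induction n)
    case 0
    have "continuous_on UNIV \<phi>" by (rule primitive_continuous[OF P])
    from continuous_on_compose2[OF this continuous_on_fst[OF continuous_on_id]] show ?case by auto
  next
    case (Suc n)
    show ?case by (rule param_smooth_SucI[OF Suc w d])
  qed
  then have "smooth_on UNIV \<phi>" by (intro param_smooth_imp_smooth_on) auto
  moreover have "x \<in> {-N..N}" if "\<phi> x \<noteq> 0" for x using z[of x] that by force
  then have "{x. \<phi> x \<noteq> 0} \<subseteq> {-N..N}" by blast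
  then have "closure {x. \<phi> x \<noteq> 0} \<subseteq> {-N..N}" by (rule closure_minimal) simp
  then have "compact (closure {x. \<phi> x \<noteq> 0})"
    unfolding compact_eq_bounded_closed using bounded_subset[OF bounded_closed_interval] by auto
  moreover have "deriv \<phi> = w" using DERIV_imp_deriv[OF d] by auto
  ultimately show ?thesis unfolding test_function_def by blast
qed

text \<open>A bump minus the right multiple of a fixed bump has integral zero, so it is the derivative of a test
  function. Hence \<open>\<integral> F \<psi> = k \<integral> \<psi>\<close> for all bumps \<open>\<psi>\<close>, with \<open>k\<close> read off from the fixed one.
  Letting bumps tend to indicators, \<open>F - k\<close> has integral zero over every interval.\<close>
lemma du_Bois_Reymond:
  assumes F: "loc_bounded F"
    and zero: "\<And>\<phi>. test_function \<phi> \<Longrightarrow> (LINT x|lebesgue. F x * deriv \<phi> x) = 0"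
  shows "\<exists>k. AE x in lebesgue. F x = k"
proof -
  have lb: "loc_bounded (bump a b n)" for a b n by (rule loc_bounded_continuous[OF continuous_bump])
  have int: "integrable lebesgue (\<lambda>x. G x * bump a b n x)" if "loc_bounded G" for G a b n
    by (rule integral_compact_support(1)[OF loc_bounded_mult[OF that lb], of "max \<bar>a\<bar> \<bar>b\<bar>"])
       (auto intro!: bump_outside)
  define J where "J = (LINT x|lebesgue. bump 0 1 1 x)"
  define T where "T = (LINT x|lebesgue. F x * bump 0 1 1 x)"
  have "J = integral {-1..1} (bump 0 1 1)"
    unfolding J_def by (rule integral_compact_support(2)[OF lb]) (auto intro!: bump_outside)
  then have J: "J > 0" using bump_integral_pos[of 1 "-1" 0 1 1] by simp
  define k where "k = T / J"
  have G: "loc_bounded (\<lambda>x. F x - k)" by (intro loc_bounded_diff F loc_bounded_const)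
  have b: "(LINT x|lebesgue. (F x - k) * bump a b n x) = 0" for a b n
  proof -
    define \<kappa> where "\<kappa> = (LINT x|lebesgue. bump a b n x) / J"
    define w where "w = (\<lambda>x. bump a b n x - \<kappa> * bump 0 1 1 x)"
    define N where "N = max (max \<bar>a\<bar> \<bar>b\<bar>) 1"
    have ints: "integrable lebesgue (bump a b n)" for a b n using int[of "\<lambda>x. 1"] by simp
    have ws: "param_smooth m UNIV (\<lambda>l z. w l)" for m
      unfolding w_def by (intro param_smooth_diff param_smooth_cmult param_smooth_bump)
    have out: "w x = 0" if "\<bar>x\<bar> \<ge> N" for x
    proof -
      have "x \<notin> {a<..<b}" "x \<notin> {0<..<1}" using that by (auto simp: N_def)
      then show ?thesis by (simp add: w_def bump_outside)
    qed
    have lw: "loc_bounded w" unfolding w_def by (intro loc_bounded_diff loc_bounded_cmult lb)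
    have "integral {-N..N} w = (LINT x|lebesgue. w x)"
      using integral_compact_support(2)[OF lw, of N] out by auto
    also have "\<dots> = (LINT x|lebesgue. bump a b n x) - \<kappa> * J"
      unfolding w_def J_def using ints by simp
    also have "\<dots> = 0" using J by (simp add: \<kappa>_def)
    finally have "integral {-N..N} w = 0" .
    moreover have "N \<ge> 0" by (simp add: N_def)
    ultimately obtain \<phi> where \<phi>: "test_function \<phi>" "deriv \<phi> = w"
      using test_function_antiderivative[OF ws out] by blast
    have "(\<lambda>x. F x * w x) = (\<lambda>x. F x * bump a b n x - \<kappa> * (F x * bump 0 1 1 x))"
      by (auto simp: w_def right_diff_distrib)
    then have "0 = (LINT x|lebesgue. F x * bump a b n x - \<kappa> * (F x * bump 0 1 1 x))"
      using zero[OF \<phi>(1)] unfolding \<phi>(2) by metis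
    also have "\<dots> = (LINT x|lebesgue. F x * bump a b n x) - \<kappa> * T"
      unfolding T_def using int[OF F] by simp
    also have "\<kappa> * T = k * (LINT x|lebesgue. bump a b n x)" by (simp add: \<kappa>_def k_def)
    also have "(LINT x|lebesgue. F x * bump a b n x) - \<dots> = (LINT x|lebesgue. (F x - k) * bump a b n x)"
      using int[OF F] ints by (simp add: left_diff_distrib)
    finally show ?thesis by simp
  qed
  have "integral {a..b} (\<lambda>x. F x - k) = 0" for a b
  proof -
    have [measurable]: "F \<in> borel_measurable lebesgue" using F by (simp add: loc_bounded_def)
    have [measurable]: "bump a b n \<in> borel_measurable lebesgue" for n using lb by (simp add: loc_bounded_def)
    have s: "set_integrable lebesgue {a<..<b} (\<lambda>x. F x - k)"
      by (rule set_integrable_subset[OF loc_bounded_absolutely_integrable[OF G, of a b]]) auto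
    have "(\<lambda>n. LINT x|lebesgue. (F x - k) * bump a b n x) \<longlonglongrightarrow> (LINT x|lebesgue. (F x - k) * indicator {a<..<b} x)"
    proof (rule integral_dominated_convergence[where w="\<lambda>x. \<bar>indicator {a<..<b} x *\<^sub>R (F x - k)\<bar>"])
      show "integrable lebesgue (\<lambda>x. \<bar>indicator {a<..<b} x *\<^sub>R (F x - k)\<bar>)"
        using s unfolding set_integrable_def by (rule integrable_abs)
      show "AE x in lebesgue. (\<lambda>n. (F x - k) * bump a b n x) \<longlonglongrightarrow> (F x - k) * indicator {a<..<b} x"
        by (intro AE_I2 tendsto_intros bump_tendsto)
      show "AE x in lebesgue. norm ((F x - k) * bump a b n x) \<le> \<bar>indicator {a<..<b} x *\<^sub>R (F x - k)\<bar>" for n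
      proof (rule AE_I2)
        fix x show "norm ((F x - k) * bump a b n x) \<le> \<bar>indicator {a<..<b} x *\<^sub>R (F x - k)\<bar>"
          using bump_bounds[of a b n x] bump_outside[of x a b n]
          by (cases "x \<in> {a<..<b}") (auto simp: abs_mult mult_left_le)
      qed
      show "(\<lambda>x. (F x - k) * indicator {a<..<b} x) \<in> borel_measurable lebesgue"
        by (intro borel_measurable_times borel_measurable_diff borel_measurable_indicator) auto
    qed measurable
    then have "(LINT x|lebesgue. (F x - k) * indicator {a<..<b} x) = 0"
      using LIMSEQ_const_iff unfolding b by metis
    then show ?thesis
      using set_lebesgue_integral_eq_integral(2)[OF s] integral_open_interval_real[of a b "\<lambda>x. F x - k"]
      by (simp add: set_lebesgue_integral_def mult.commute)
  qed
  then have "AE x in lebesgue. F x - k = 0" by (intro AE_eq_zero_of_interval_integrals G)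
  then show ?thesis by (intro exI[of _ k]) auto
qed

text \<open>The primitive of \<open>g0\<close> has the same weak derivative as \<open>f\<close>, so the two differ by a constant. The
  representatives \<open>f0\<close> and \<open>g0\<close> are there because members of \<open>L_infinity\<close> are bounded only almost
  everywhere.\<close>
lemma weak_deriv_imp_primitive:
  assumes w: "has_weak_deriv f g" and g0: "loc_bounded g0" "AE x in lebesgue. g x = g0 x"
    and f0: "loc_bounded f0" "AE x in lebesgue. f x = f0 x"
    and m: "f \<in> borel_measurable lebesgue" "g \<in> borel_measurable lebesgue"
  obtains u where "primitive u g0" "AE x in lebesgue. f x = u x"
proof -
  let ?G = "signed_integral g0"
  have G: "primitive ?G g0" by (rule primitive_signed_integral[OF g0(1)])
  have "\<exists>k. AE x in lebesgue. f0 x - ?G x = k"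
  proof (rule du_Bois_Reymond)
    show "loc_bounded (\<lambda>x. f0 x - ?G x)" by (intro loc_bounded_diff f0 loc_bounded_primitive[OF G])
    fix \<phi> assume t: "test_function \<phi>"
    then obtain N where \<phi>: "primitive \<phi> (deriv \<phi>)" "continuous_on UNIV (deriv \<phi>)" "N \<ge> 0"
      "\<forall>x. \<bar>x\<bar> \<ge> N \<longrightarrow> \<phi> x = 0" "\<forall>x. \<bar>x\<bar> > N \<longrightarrow> deriv \<phi> x = 0"
      by (rule test_functionD)
    have l: "loc_bounded (deriv \<phi>)" "loc_bounded \<phi>"
      using primitive_loc_bounded[OF \<phi>(1)] loc_bounded_primitive[OF \<phi>(1)] by auto
    have [measurable]: "f \<in> borel_measurable lebesgue" "g \<in> borel_measurable lebesgue"
      "f0 \<in> borel_measurable lebesgue" "g0 \<in> borel_measurable lebesgue"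
      "\<phi> \<in> borel_measurable lebesgue" "deriv \<phi> \<in> borel_measurable lebesgue"
      using m f0(1) g0(1) l by (auto simp: loc_bounded_def)
    have i: "integrable lebesgue (\<lambda>x. f0 x * deriv \<phi> x)" "integrable lebesgue (\<lambda>x. ?G x * deriv \<phi> x)"
      by (auto intro!: integral_compact_support(1)[of _ N] loc_bounded_mult f0 l loc_bounded_primitive[OF G] simp: \<phi>(5))
    have "(LINT x|lebesgue. f0 x * deriv \<phi> x) = (LINT x|lebesgue. f x * deriv \<phi> x)"
      by (rule integral_cong_AE) (use f0(2) in \<open>auto\<close>)
    also have "\<dots> = - (LINT x|lebesgue. g x * \<phi> x)"
      using w t by (auto simp: has_weak_deriv_def)
    also have "(LINT x|lebesgue. g x * \<phi> x) = (LINT x|lebesgue. g0 x * \<phi> x)"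
      by (rule integral_cong_AE) (use g0(2) in \<open>auto\<close>)
    also have "- \<dots> = (LINT x|lebesgue. ?G x * deriv \<phi> x)"
      using primitive_has_weak_deriv[OF G] t by (auto simp: has_weak_deriv_def)
    finally show "(LINT x|lebesgue. (f0 x - ?G x) * deriv \<phi> x) = 0"
      using i by (simp add: left_diff_distrib)
  qed
  then obtain k where k: "AE x in lebesgue. f0 x - ?G x = k" by blast
  show ?thesis
  proof (rule that[of "\<lambda>x. ?G x + k"])
    show "primitive (\<lambda>x. ?G x + k) g0" by (rule primitive_add_const[OF G])
    show "AE x in lebesgue. f x = ?G x + k" using f0(2) k by eventually_elim auto
  qed
qed

section \<open>The angle variable\<close>

text \<open>If \<open>s\<close> is the sine of an angle in \<open>(-\<pi>/2, \<pi>/2)\<close>, these are its cosine and its tangent.\<close>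
definition cosine :: "real \<Rightarrow> real" where
  "cosine s = sqrt (1 - s\<^sup>2)"

definition slope :: "real \<Rightarrow> real" where
  "slope s = s / cosine s"

text \<open>The difference quotient of \<open>-cosine\<close>, written without a division by \<open>x - y\<close> so that it is continuous
  across the diagonal; its value there is the slope.\<close>
definition secant :: "real \<Rightarrow> real \<Rightarrow> real" where
  "secant x y = (x + y) / (cosine x + cosine y)"

lemma unit_interval_iff: "x \<in> {-1<..<1} \<longleftrightarrow> \<bar>x\<bar> < 1" for x :: real
  by auto

lemma cosine_pos: "\<bar>s\<bar> < 1 \<Longrightarrow> cosine s > 0"
  by (simp add: cosine_def abs_square_less_1)

lemma cosine_le_1: "cosine s \<le> 1"
  by (simp add: cosine_def)

lemma cosine_square: "\<bar>s\<bar> < 1 \<Longrightarrow> (cosine s)\<^sup>2 = 1 - s\<^sup>2"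
  by (simp add: cosine_def abs_square_less_1 less_imp_le)

lemma cosine_0 [simp]: "cosine 0 = 1"
  by (simp add: cosine_def)

lemma continuous_cosine: "continuous_on S cosine"
  unfolding cosine_def by (intro continuous_intros)

lemma cosine_derivative:
  assumes "\<bar>s\<bar> < 1" shows "(cosine has_real_derivative - slope s) (at s)"
proof -
  have p: "0 < 1 - s\<^sup>2" using assms by (simp add: abs_square_less_1)
  have "((\<lambda>s. 1 - s\<^sup>2) has_real_derivative - (2 * s)) (at s)" by (auto intro!: derivative_eq_intros)
  from DERIV_chain2[OF DERIV_real_sqrt[OF p] this]
  have "(cosine has_real_derivative inverse (sqrt (1 - s\<^sup>2)) / 2 * - (2 * s)) (at s)"
    unfolding cosine_def[abs_def] .
  moreover have "inverse (sqrt (1 - s\<^sup>2)) / 2 * - (2 * s) = - slope s"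
    by (simp add: slope_def cosine_def inverse_eq_divide)
  ultimately show ?thesis by simp
qed

lemma slope_derivative:
  assumes "\<bar>s\<bar> < 1" shows "(slope has_real_derivative inverse ((cosine s)^3)) (at s)"
proof -
  have p: "cosine s > 0" using cosine_pos[OF assms] .
  have "(slope has_real_derivative (1 * cosine s - s * (- slope s)) / (cosine s * cosine s)) (at s)"
    unfolding slope_def[abs_def] using p cosine_derivative[OF assms, unfolded slope_def]
    by (intro DERIV_divide) (auto intro!: derivative_eq_intros)
  moreover have "(1 * cosine s - s * (- slope s)) / (cosine s * cosine s) = inverse ((cosine s)^3)"
  proof -
    have "cosine s * cosine s = 1 - s * s" using cosine_square[OF assms] by (simp add: power2_eq_square)
    then have "(cosine s * cosine s + s * s) = 1" by simp
    then show ?thesis using p by (simp add: slope_def field_simps power3_eq_cube)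
  qed
  ultimately show ?thesis by simp
qed

lemma continuous_slope: "continuous_on {-1<..<1} slope"
  by (intro continuous_at_imp_continuous_on ballI DERIV_isCont[OF slope_derivative]) auto

lemma slope_strict_mono:
  assumes "\<bar>x\<bar> < 1" "\<bar>y\<bar> < 1" "x < y" shows "slope x < slope y"
proof (rule DERIV_pos_imp_increasing[OF assms(3)])
  fix u assume "x \<le> u" "u \<le> y"
  then have u: "\<bar>u\<bar> < 1" using assms by auto
  show "\<exists>d. (slope has_real_derivative d) (at u) \<and> d > 0"
    using slope_derivative[OF u] cosine_pos[OF u] by (intro exI[of _ "inverse ((cosine u)^3)"]) simp
qed

lemma cosine_diff:
  assumes "\<bar>x\<bar> < 1" "\<bar>y\<bar> < 1"
  shows "cosine y - cosine x = - secant x y * (y - x)"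
proof -
  have p: "cosine x + cosine y > 0" using cosine_pos[OF assms(1)] cosine_pos[OF assms(2)] by simp
  have "(cosine y - cosine x) * (cosine x + cosine y) = (cosine y)\<^sup>2 - (cosine x)\<^sup>2"
    by (simp add: power2_eq_square algebra_simps)
  also have "\<dots> = - (x + y) * (y - x)"
    using assms by (simp add: cosine_square) (simp add: power2_eq_square algebra_simps)
  finally show ?thesis using p by (simp add: secant_def field_simps)
qed

lemma secant_diag: "secant x x = slope x"
  by (simp add: secant_def slope_def)

lemma continuous_secant: "continuous_on ({-1<..<1} \<times> {-1<..<1}) (\<lambda>p. secant (fst p) (snd p))"
proof -
  have "cosine (fst p) + cosine (snd p) \<noteq> 0" if "p \<in> {-1<..<1} \<times> {-1<..<1}" for p
  proof -
    have "\<bar>fst p\<bar> < 1" "\<bar>snd p\<bar> < 1" using that by (auto simp: mem_Times_iff)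
    then show ?thesis using cosine_pos[of "fst p"] cosine_pos[of "snd p"] by simp
  qed
  then show ?thesis
    unfolding secant_def
    by (intro continuous_intros continuous_on_compose2[OF continuous_cosine[of UNIV]]) auto
qed

lemma AE_lebesgue_translate:
  fixes t :: real
  assumes "AE x in lebesgue. P x" shows "AE x in lebesgue. P (x + t)"
proof -
  obtain N where N: "\<And>x. x \<in> space lebesgue - N \<Longrightarrow> P x" "N \<in> null_sets lebesgue"
    using AE_E3[OF assms] by blast
  have "(+) (-t) ` N \<in> null_sets lebesgue"
    using negligible_translation[of N "-t"] N(2) by (simp add: negligible_iff_null_sets)
  moreover have "{z \<in> space lebesgue. \<not> P (z + t)} \<subseteq> (+) (-t) ` N"
  proof
    fix z assume "z \<in> {z \<in> space lebesgue. \<not> P (z + t)}"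
    then have "z + t \<in> N" using N(1)[of "z + t"] by auto
    then show "z \<in> (+) (-t) ` N" by (intro image_eqI[of _ _ "z + t"]) auto
  qed
  ultimately show ?thesis by (rule AE_I')
qed

lemma periodic_int:
  fixes f :: "real \<Rightarrow> 'a"
  assumes "\<And>z. f (z + 1) = f z" shows "f (z + of_int n) = f z"
proof -
  interpret periodic_fun_simple' f using assms by unfold_locales
  show ?thesis by (rule plus_of_int)
qed

lemma periodic_representative:
  fixes f :: "real \<Rightarrow> 'a"
  assumes "\<And>z. f (z + 1) = f z" shows "\<exists>x\<in>{a..a+1}. f z = f x"
proof -
  have "f z = f (a + frac (z - a) + of_int \<lfloor>z - a\<rfloor>)" by (simp add: frac_def)
  also have "\<dots> = f (a + frac (z - a))" by (rule periodic_int) (rule assms)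
  finally show ?thesis
    using frac_lt_1[of "z - a"] frac_ge_0[of "z - a"] by (intro bexI[of _ "a + frac (z - a)"]) auto
qed

lemma periodic_continuous_bounded:
  fixes f :: "real \<Rightarrow> real"
  assumes "\<And>z. f (z + 1) = f z" "continuous_on UNIV f"
  shows "\<exists>K. \<forall>z. \<bar>f z\<bar> \<le> K"
proof -
  have "bounded (f ` {0..1})"
    by (intro compact_imp_bounded compact_continuous_image continuous_on_subset[OF assms(2)]) auto
  then obtain K where K: "\<And>x. x \<in> {0..1} \<Longrightarrow> \<bar>f x\<bar> \<le> K" unfolding bounded_real by blast
  have "\<bar>f z\<bar> \<le> K" for z
  proof -
    obtain x where "x \<in> {0..0+1}" "f z = f x"
      using periodic_representative[where f=f and a=0 and z=z] assms(1) by blast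
    then show ?thesis using K[of x] by simp
  qed
  then show ?thesis by blast
qed

lemma continuous_slope_compose:
  fixes s :: "real \<Rightarrow> real"
  assumes "continuous_on UNIV s" "\<And>z. \<bar>s z\<bar> < 1" shows "continuous_on UNIV (\<lambda>z. slope (s z))"
proof (rule continuous_on_compose2[OF continuous_slope assms(1)])
  show "range s \<subseteq> {-1<..<1}" using assms(2) unfolding image_subset_iff unit_interval_iff by blast
qed

text \<open>The slope is strictly increasing in the sine, so functions that do not meet have ordered slopes and
  different means.\<close>
lemma equal_mean_slope_cross:
  fixes s0 s1 :: "real \<Rightarrow> real"
  assumes c0: "continuous_on UNIV s0" "\<And>z. \<bar>s0 z\<bar> < 1" and c1: "continuous_on UNIV s1" "\<And>z. \<bar>s1 z\<bar> < 1"
    and eq: "integral {0..1} (\<lambda>z. slope (s1 z)) = integral {0..1} (\<lambda>z. slope (s0 z))"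
  obtains z0 where "z0 \<in> {0..1}" "s1 z0 = s0 z0"
proof -
  have *: "\<exists>z\<in>{0..1}. s1 z \<le> s0 z"
    if c0: "continuous_on UNIV s0" "\<And>z. \<bar>s0 z\<bar> < 1" and c1: "continuous_on UNIV s1" "\<And>z. \<bar>s1 z\<bar> < 1"
    and eq: "integral {0..1} (\<lambda>z. slope (s1 z)) = integral {0..1} (\<lambda>z. slope (s0 z))"
    for s0 s1 :: "real \<Rightarrow> real"
  proof (rule ccontr)
    assume "\<not> ?thesis"
    then have "s0 z < s1 z" if "z \<in> {0..1}" for z using that by (simp add: not_le)
    then have lt: "slope (s0 z) < slope (s1 z)" if "z \<in> {0..1}" for z
      using that by (intro slope_strict_mono c0(2) c1(2))
    let ?d = "\<lambda>z. slope (s1 z) - slope (s0 z)"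
    note cs = continuous_slope_compose[OF c0] continuous_slope_compose[OF c1]
    have c: "continuous_on {0..1} ?d"
      by (intro continuous_intros continuous_on_subset[OF cs(1)] continuous_on_subset[OF cs(2)]) auto
    have i: "(\<lambda>z. slope (s0 z)) integrable_on {0..1}" "(\<lambda>z. slope (s1 z)) integrable_on {0..1}"
      by (auto intro!: loc_bounded_integrable loc_bounded_continuous cs)
    have "integral {0..1} ?d = 0"
      using eq i by (simp add: Henstock_Kurzweil_Integration.integral_diff)
    then have "(?d has_integral 0) (cbox 0 1)"
      using integrable_integral[OF integrable_continuous_real[OF c]] by simp
    then have "?d 0 = 0"
      using has_integral_0_cbox_imp_0[of 0 1 ?d 0] c lt by (auto simp: less_imp_le)
    then show False using lt[of 0] by simp
  qed
  obtain a where a: "a \<in> {0..1}" "s1 a \<le> s0 a" using *[OF c0 c1 eq] by blast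
  obtain b where b: "b \<in> {0..1}" "s0 b \<le> s1 b" using *[OF c1 c0 eq[symmetric]] by blast
  have c: "continuous_on {0..1} (\<lambda>z. s1 z - s0 z)"
    by (intro continuous_intros continuous_on_subset[OF c0(1)] continuous_on_subset[OF c1(1)]) auto
  have "connected ((\<lambda>z. s1 z - s0 z) ` {0..1})"
    by (rule connected_continuous_image[OF c]) simp
  then have "{s1 a - s0 a..s1 b - s0 b} \<subseteq> (\<lambda>z. s1 z - s0 z) ` {0..1}"
    by (rule connected_contains_Icc) (use a b in auto)
  moreover have "0 \<in> {s1 a - s0 a..s1 b - s0 b}" using a b by auto
  ultimately obtain z where "z \<in> {0..1}" "s1 z - s0 z = 0" by (metis (no_types, lifting) imageE subsetD)
  then show ?thesis using that by simp
qed

section \<open>Periodic profiles\<close>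

text \<open>A representative of the coefficient for which periodicity and the bounds hold everywhere.\<close>
locale medium =
  fixes R :: "real \<Rightarrow> real" and m M :: real
  assumes R_measurable [measurable]: "R \<in> borel_measurable lebesgue"
    and m_pos: "0 < m" and R_ge: "\<And>z. m \<le> R z" and R_le: "\<And>z. R z \<le> M"
    and R_periodic: "\<And>z. R (z + 1) = R z"
begin

lemma m_le_M: "m \<le> M" using R_ge R_le order_trans by blast

lemma M_pos: "0 < M" using m_le_M m_pos by simp

lemma loc_bounded_R: "loc_bounded R"
proof (rule loc_bounded_bounded[of _ M])
  show "\<bar>R z\<bar> \<le> M" for z using R_ge[of z] R_le[of z] m_pos by simp
qed measurable

definition profile :: "real \<Rightarrow> real \<Rightarrow> (real \<Rightarrow> real) \<Rightarrow> bool" where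
  "profile lam c s \<longleftrightarrow> primitive s (\<lambda>z. (R z - c * cosine (s z)) / lam) \<and> (\<forall>z. \<bar>s z\<bar> < 1) \<and>
     (\<forall>z. s (z + 1) = s z) \<and> integral {0..1} (\<lambda>z. slope (s z)) = 0"

lemma profileD:
  assumes "profile lam c s"
  shows "primitive s (\<lambda>z. (R z - c * cosine (s z)) / lam)" "\<And>z. \<bar>s z\<bar> < 1" "\<And>z. s (z + 1) = s z"
    "integral {0..1} (\<lambda>z. slope (s z)) = 0" "continuous_on UNIV s"
    "continuous_on UNIV (\<lambda>z. cosine (s z))" "continuous_on UNIV (\<lambda>z. slope (s z))"
proof -
  show 1: "primitive s (\<lambda>z. (R z - c * cosine (s z)) / lam)" and 2: "\<And>z. \<bar>s z\<bar> < 1" and "\<And>z. s (z + 1) = s z"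
    and "integral {0..1} (\<lambda>z. slope (s z)) = 0"
    using assms by (auto simp: profile_def)
  show c: "continuous_on UNIV s" by (rule primitive_continuous[OF 1])
  show "continuous_on UNIV (\<lambda>z. cosine (s z))"
    by (rule continuous_on_compose2[OF continuous_cosine[of UNIV] c]) simp
  show "continuous_on UNIV (\<lambda>z. slope (s z))"
    by (rule continuous_slope_compose[OF c 2])
qed

text \<open>The derivative of the slope is \<open>1 / cosine\<^sup>3\<close>, and \<open>1 + slope\<^sup>2 = 1 / cosine\<^sup>2\<close>; dividing the
  equation for the sine by the cosine gives the equation for the slope.\<close>
lemma profile_imp_speed_profile:
  assumes lam: "lam > 0" and p: "profile lam c s"
  shows "speed_profile R lam c (\<lambda>z. slope (s z))"
proof -
  note s = profileD[OF p]
  let ?hz = "\<lambda>z. inverse ((cosine (s z))^3) * ((R z - c * cosine (s z)) / lam)"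
  have cp: "cosine (s z) > 0" for z using cosine_pos s(2) by blast
  have P: "primitive (\<lambda>z. slope (s z)) ?hz"
  proof (rule primitive_chain[OF s(1), of "{-1<..<1}"])
    show "continuous_on {-1<..<1} (\<lambda>x. inverse (cosine x ^ 3))"
    proof (intro continuous_on_inverse continuous_on_power continuous_cosine ballI)
      fix x :: real assume "x \<in> {-1<..<1}"
      then have "\<bar>x\<bar> < 1" by auto
      from cosine_pos[OF this] show "cosine x ^ 3 \<noteq> 0" by simp
    qed
    show "s z \<in> {-1<..<1}" for z unfolding unit_interval_iff by (rule s(2))
    show "(slope has_real_derivative inverse (cosine u ^ 3)) (at u)" if "u \<in> {-1<..<1}" for u
      by (rule slope_derivative) (use that in \<open>simp only: unit_interval_iff\<close>)
  qed simp
  have "continuous_on UNIV (\<lambda>z. inverse ((cosine (s z))^3))"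
    by (intro continuous_on_inverse continuous_on_power s(6) ballI) (use cp in \<open>simp add: less_imp_neq[symmetric]\<close>)
  then obtain K1 where K1: "\<And>z. \<bar>inverse ((cosine (s z))^3)\<bar> \<le> K1"
    using periodic_continuous_bounded[of "\<lambda>z. inverse ((cosine (s z))^3)"] s(3) by auto
  obtain K2 where K2: "\<And>z. \<bar>slope (s z)\<bar> \<le> K2"
    using periodic_continuous_bounded[OF _ s(7)] s(3) by auto
  have "\<bar>?hz z\<bar> \<le> K1 * ((M + \<bar>c\<bar>) / lam)" for z
  proof -
    have "\<bar>R z - c * cosine (s z)\<bar> \<le> \<bar>R z\<bar> + \<bar>c\<bar> * \<bar>cosine (s z)\<bar>" by (metis abs_mult abs_triangle_ineq4)
    also have "\<dots> \<le> M + \<bar>c\<bar> * 1"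
      using R_ge[of z] R_le[of z] m_pos cp[of z] cosine_le_1[of "s z"] by (intro add_mono mult_left_mono) auto
    finally have "\<bar>(R z - c * cosine (s z)) / lam\<bar> \<le> (M + \<bar>c\<bar>) / lam"
      using lam by (simp add: abs_divide divide_right_mono)
    then show ?thesis unfolding abs_mult using order_trans[OF abs_ge_zero K1[of z]] by (intro mult_mono K1) auto
  qed
  then have Lz: "?hz \<in> L_infinity"
    using primitive_loc_bounded[OF P] unfolding L_infinity_def loc_bounded_def by blast
  have Lh: "(\<lambda>z. slope (s z)) \<in> L_infinity"
    using loc_bounded_primitive[OF P] K2 unfolding L_infinity_def loc_bounded_def by blast
  have w: "has_weak_deriv (\<lambda>z. slope (s z)) ?hz" by (rule primitive_has_weak_deriv[OF P])
  have eq: "- c + R z * sqrt (1 + (slope (s z))\<^sup>2) = lam * (?hz z / (1 + (slope (s z))\<^sup>2))" for z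
  proof -
    define q where "q = cosine (s z)"
    have q: "q > 0" "q\<^sup>2 + (s z)\<^sup>2 = 1" using cp cosine_square[OF s(2), of z] by (auto simp: q_def)
    have 1: "1 + (slope (s z))\<^sup>2 = inverse (q\<^sup>2)"
      using q by (simp add: slope_def q_def[symmetric] field_simps)
    have 2: "sqrt (1 + (slope (s z))\<^sup>2) = inverse q"
      unfolding 1 using q by (simp add: real_sqrt_inverse)
    show ?thesis unfolding 2 unfolding 1 q_def[symmetric]
      using q lam by (simp add: field_simps power2_eq_square power3_eq_cube)
  qed
  have "(LINT t:{0..1}|lebesgue. slope (s t)) = 0"
    using set_lebesgue_integral_eq_integral(2)[OF loc_bounded_absolutely_integrable[OF loc_bounded_primitive[OF P]]] s(4)
    by simp
  then show ?thesis
    unfolding speed_profile_def W1_infinity_def using w Lz Lh eq s(3) by (auto intro!: exI[of _ ?hz])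
qed

text \<open>The equation itself shows that the weak derivative is bounded, so \<open>h\<close> has a representative \<open>u\<close> that is
  a primitive. Inserting \<open>u\<close> into the equation and applying the chain rule to \<open>u / sqrt (1 + u\<^sup>2)\<close>
  gives the profile.\<close>
lemma speed_profile_imp_profile:
  assumes lam: "lam > 0" and p: "speed_profile R lam c h"
  shows "\<exists>s. profile lam c s"
proof -
  obtain hz where hz: "has_weak_deriv h hz"
    "AE z in lebesgue. - c + R z * sqrt (1 + (h z)\<^sup>2) = lam * (hz z / (1 + (h z)\<^sup>2))"
    and hp: "AE z in lebesgue. h (z + 1) = h z" and h0: "(LINT t:{0..1}|lebesgue. h t) = 0"
    and hL: "h \<in> L_infinity"
    using p by (auto simp: speed_profile_def W1_infinity_def)
  obtain K where K: "AE z in lebesgue. \<bar>h z\<bar> \<le> K" and hm[measurable]: "h \<in> borel_measurable lebesgue"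
    using hL by (auto simp: L_infinity_def)
  define f0 where "f0 = (\<lambda>z. max (- \<bar>K\<bar>) (min \<bar>K\<bar> (h z)))"
  have f0m[measurable]: "f0 \<in> borel_measurable lebesgue" unfolding f0_def by measurable
  have f0b: "\<bar>f0 z\<bar> \<le> \<bar>K\<bar>" for z by (auto simp: f0_def)
  have f0l: "loc_bounded f0" by (rule loc_bounded_bounded[OF f0m f0b])
  have f0h: "AE z in lebesgue. h z = f0 z" using K by eventually_elim (auto simp: f0_def)
  define F where "F = (\<lambda>u z. (1 + u\<^sup>2) * ((R z * sqrt (1 + u\<^sup>2) - c) / lam))"
  have Fl: "loc_bounded (\<lambda>z. F (u z) z)" if "loc_bounded u" for u
  proof -
    have u2: "loc_bounded (\<lambda>z. 1 + (u z)\<^sup>2)"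
      unfolding power2_eq_square by (intro loc_bounded_add loc_bounded_mult that) auto
    have "loc_bounded (\<lambda>z. sqrt (1 + (u z)\<^sup>2))"
    proof (rule loc_boundedI)
      have [measurable]: "u \<in> borel_measurable lebesgue" using that by (simp add: loc_bounded_def)
      show "(\<lambda>z. sqrt (1 + (u z)\<^sup>2)) \<in> borel_measurable lebesgue" by measurable
      fix N :: real
      obtain B where B: "\<And>x. -N \<le> x \<Longrightarrow> x \<le> N \<Longrightarrow> \<bar>1 + (u x)\<^sup>2\<bar> \<le> B"
        using loc_boundedE[OF u2, of "-N" N] by metis
      show "\<exists>B. \<forall>x. \<bar>x\<bar> \<le> N \<longrightarrow> \<bar>sqrt (1 + (u x)\<^sup>2)\<bar> \<le> B"
        by (rule exI[of _ "sqrt B"]) (use B in force)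
    qed
    then show ?thesis unfolding F_def
      by (intro loc_bounded_mult u2 loc_bounded_divide loc_bounded_diff loc_bounded_R loc_bounded_const)
  qed
  have hzF: "AE z in lebesgue. hz z = F (f0 z) z"
    using hz(2) f0h
  proof eventually_elim
    case (elim z)
    have p: "1 + (f0 z)\<^sup>2 > 0" by (simp add: add_pos_nonneg)
    have "lam * (hz z / (1 + (f0 z)\<^sup>2)) = R z * sqrt (1 + (f0 z)\<^sup>2) - c" using elim by simp
    then show ?case using p lam by (simp add: F_def field_simps)
  qed
  have hzm: "hz \<in> borel_measurable lebesgue"
  proof -
    have "(\<lambda>z. F (f0 z) z) \<in> borel_measurable lebesgue" using Fl[OF f0l] by (simp add: loc_bounded_def)
    then show ?thesis by (rule borel_measurable_AE) (use hzF in auto)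
  qed
  obtain u where u: "primitive u (\<lambda>z. F (f0 z) z)" "AE x in lebesgue. h x = u x"
    using weak_deriv_imp_primitive[OF hz(1) Fl[OF f0l] hzF f0l f0h hm hzm] .
  have uc: "continuous_on UNIV u" by (rule primitive_continuous[OF u(1)])
  have uF: "primitive u (\<lambda>z. F (u z) z)"
    by (rule primitive_AE_cong[OF u(1) Fl[OF loc_bounded_primitive[OF u(1)]]]) (use u(2) f0h in \<open>eventually_elim, simp\<close>)
  have up: "u (z + 1) = u z" for z
  proof (rule continuous_AE_eq_imp_eq[of "\<lambda>z. u (z + 1)" u])
    show "continuous_on UNIV (\<lambda>z. u (z + 1))"
      by (intro continuous_on_compose2[OF uc] continuous_intros) auto
    have "AE z in lebesgue. h (z + 1) = u (z + 1)" by (rule AE_lebesgue_translate[OF u(2)])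
    then show "AE z in lebesgue. u (z + 1) = u z" using hp u(2) by eventually_elim simp
  qed (rule uc)
  define S where "S = (\<lambda>u::real. u / sqrt (1 + u\<^sup>2))"
  have sq: "sqrt (1 + v\<^sup>2) > 0" for v :: real by (simp add: add_pos_nonneg)
  have Sd: "(S has_real_derivative inverse ((sqrt (1 + v\<^sup>2))^3)) (at v)" for v
  proof -
    have p: "0 < 1 + v\<^sup>2" by (simp add: add_pos_nonneg)
    have "((\<lambda>v. 1 + v\<^sup>2) has_real_derivative 2 * v) (at v)" by (auto intro!: derivative_eq_intros)
    from DERIV_chain2[OF DERIV_real_sqrt[OF p] this]
    have "((\<lambda>v. sqrt (1 + v\<^sup>2)) has_real_derivative inverse (sqrt (1 + v\<^sup>2)) / 2 * (2 * v)) (at v)" .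
    then have "(S has_real_derivative (1 * sqrt (1 + v\<^sup>2) - v * (inverse (sqrt (1 + v\<^sup>2)) / 2 * (2 * v)))
        / (sqrt (1 + v\<^sup>2) * sqrt (1 + v\<^sup>2))) (at v)"
      unfolding S_def using sq[of v] by (intro DERIV_divide) (auto intro!: derivative_eq_intros)
    moreover have "(1 * r - v * (inverse r / 2 * (2 * v))) / (r * r) = inverse (r^3)"
      if "r > 0" "r * r = 1 + v * v" for r
    proof -
      have "r * r - v * v = 1" using that by simp
      then show ?thesis using that(1) by (simp add: field_simps power3_eq_cube)
    qed
    ultimately show ?thesis using sq[of v] p by (simp add: power2_eq_square)
  qed
  let ?s = "\<lambda>z. S (u z)"
  have "primitive ?s (\<lambda>z. inverse ((sqrt (1 + (u z)\<^sup>2))^3) * F (u z) z)"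
  proof (rule primitive_chain[OF uF, of UNIV])
    show "continuous_on UNIV (\<lambda>v. inverse ((sqrt (1 + v\<^sup>2))^3))"
      using sq by (intro continuous_intros) (metis less_irrefl zero_less_power)
  qed (use Sd in auto)
  moreover have co: "cosine (S v) = inverse (sqrt (1 + v\<^sup>2))" for v
  proof -
    have p: "1 + v\<^sup>2 > 0" by (simp add: add_pos_nonneg)
    then have "1 - (S v)\<^sup>2 = inverse (1 + v\<^sup>2)" by (simp add: S_def power_divide field_simps)
    then show ?thesis by (simp add: cosine_def real_sqrt_inverse)
  qed
  ultimately have Ps: "primitive ?s (\<lambda>z. (R z - c * cosine (?s z)) / lam)"
  proof (elim primitive_cong)
    fix z
    define r where "r = sqrt (1 + (u z)\<^sup>2)"
    have r: "r > 0" "1 + (u z)\<^sup>2 = r * r" using sq[of "u z"] by (auto simp: r_def)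
    have "(R z - c * inverse r) / lam = inverse (r^3) * ((r * r) * ((R z * r - c) / lam))"
      using r(1) lam by (simp add: field_simps power3_eq_cube)
    then show "(R z - c * cosine (?s z)) / lam = inverse ((sqrt (1 + (u z)\<^sup>2))^3) * F (u z) z"
      unfolding co F_def r_def[symmetric] unfolding r(2) .
  qed
  have sl: "slope (S v) = v" for v unfolding slope_def co using sq[of v] by (simp add: S_def)
  have "\<bar>S v\<bar> < 1" for v
  proof -
    have "\<bar>v\<bar> < sqrt (1 + v\<^sup>2)" by (rule real_less_rsqrt) simp
    then show ?thesis using sq[of v] by (simp add: S_def abs_divide)
  qed
  moreover have "integral {0..1} (\<lambda>z. slope (?s z)) = 0"
  proof -
    have "integral {0..1} u = (LINT t:{0..1}|lebesgue. u t)"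
      using set_lebesgue_integral_eq_integral(2)[OF loc_bounded_absolutely_integrable[OF loc_bounded_primitive[OF u(1)]]] by simp
    also have "\<dots> = (LINT t:{0..1}|lebesgue. h t)"
    proof -
      have [measurable]: "u \<in> borel_measurable lebesgue"
        using loc_bounded_primitive[OF u(1)] by (simp add: loc_bounded_def)
      show ?thesis unfolding set_lebesgue_integral_def
      proof (rule integral_cong_AE)
        show "(\<lambda>x. indicator {0..1} x *\<^sub>R u x) \<in> borel_measurable lebesgue"
          "(\<lambda>x. indicator {0..1} x *\<^sub>R h x) \<in> borel_measurable lebesgue"
          by (intro borel_measurable_scaleR borel_measurable_indicator; simp)+
      qed (use u(2) in auto)
    qed
    finally show ?thesis using h0 by (simp add: sl)
  qed
  ultimately show ?thesis using Ps up unfolding profile_def by (intro exI[of _ ?s]) auto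
qed

section \<open>Crossing and uniqueness of profiles\<close>

text \<open>Here \<open>(R - c1 cosine s1) / l1\<close> is the derivative of \<open>s1\<close>. Multiplying the second equation by
  \<open>l0 = l1 - (l1 - l0)\<close> removes the irregular coefficient \<open>R\<close> from the difference except through that
  derivative.\<close>
lemma profile_difference:
  assumes l: "l0 > 0" "l1 > 0" and p0: "profile l0 c0 s0" and p1: "profile l1 c1 s1"
  shows "primitive (\<lambda>z. s1 z - s0 z)
    (\<lambda>z. (c0 / l0 * secant (s0 z) (s1 z)) * (s1 z - s0 z)
       + - ((l1 - l0) * ((R z - c1 * cosine (s1 z)) / l1) + (c1 - c0) * cosine (s1 z)) / l0)"
proof (rule primitive_cong[OF primitive_diff[OF profileD(1)[OF p1] profileD(1)[OF p0]]])
  fix z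
  have e: "cosine (s0 z) = cosine (s1 z) + secant (s0 z) (s1 z) * (s1 z - s0 z)"
    using cosine_diff[OF profileD(2)[OF p0] profileD(2)[OF p1], of z z] by simp
  show "(c0 / l0 * secant (s0 z) (s1 z)) * (s1 z - s0 z)
       + - ((l1 - l0) * ((R z - c1 * cosine (s1 z)) / l1) + (c1 - c0) * cosine (s1 z)) / l0 =
       (R z - c1 * cosine (s1 z)) / l1 - (R z - c0 * cosine (s0 z)) / l0"
    unfolding e using l by (simp add: field_simps)
qed

lemma continuous_profile_secant:
  assumes p0: "profile l0 c0 s0" and p1: "profile l1 c1 s1"
  shows "continuous_on UNIV (\<lambda>z. secant (s0 z) (s1 z))"
proof -
  have "continuous_on UNIV (\<lambda>z. (s0 z, s1 z))" by (intro continuous_intros profileD(5)[OF p0] profileD(5)[OF p1])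
  moreover have "range (\<lambda>z. (s0 z, s1 z)) \<subseteq> {-1<..<1} \<times> {-1<..<1}"
    using profileD(2)[OF p0] profileD(2)[OF p1] by (auto simp: abs_less_iff minus_less_iff)
  ultimately show ?thesis using continuous_on_compose2[OF continuous_secant] by fastforce
qed

lemma profiles_cross:
  assumes p0: "profile l0 c0 s0" and p1: "profile l1 c1 s1"
  obtains z0 where "z0 \<in> {0..1}" "s1 z0 = s0 z0"
  using equal_mean_slope_cross[OF profileD(5)[OF p0] profileD(2)[OF p0] profileD(5)[OF p1] profileD(2)[OF p1]]
    profileD(4)[OF p0] profileD(4)[OF p1] by auto

text \<open>The difference of the two profiles vanishes at \<open>z0\<close> and, by periodicity, at \<open>z0 + 1\<close>.\<close>
lemma profile_crossing_balance:
  assumes l: "l0 > 0" "l1 > 0" and p0: "profile l0 c0 s0" and p1: "profile l1 c1 s1"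
    and z0: "s1 z0 = s0 z0"
  shows "((\<lambda>z. exp (- signed_integral (\<lambda>z. c0 / l0 * secant (s0 z) (s1 z)) z) *
     (- ((l1 - l0) * ((R z - c1 * cosine (s1 z)) / l1) + (c1 - c0) * cosine (s1 z)) / l0)) has_integral 0) {z0..z0+1}"
proof -
  have A: "loc_bounded (\<lambda>z. c0 / l0 * secant (s0 z) (s1 z))"
    by (intro loc_bounded_cmult loc_bounded_continuous continuous_profile_secant[OF p0 p1])
  have "s1 (z0 + 1) = s0 (z0 + 1)" using z0 profileD(3)[OF p0] profileD(3)[OF p1] by simp
  then show ?thesis
    using primitive_has_integral[OF linear_ode_integrating_factor[OF profile_difference[OF l p0 p1] A], of z0 "z0+1"] z0
    by simp
qed

text \<open>For equal parameters the balance is \<open>c0 - c1\<close> times the integral of a positive function.\<close>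
lemma profile_speed_unique:
  assumes lam: "lam > 0" and p0: "profile lam c0 s0" and p1: "profile lam c1 s1"
  shows "c1 = c0"
proof -
  obtain z0 where z0: "z0 \<in> {0..1}" "s1 z0 = s0 z0" by (rule profiles_cross[OF p0 p1])
  let ?W = "\<lambda>z. exp (- signed_integral (\<lambda>z. c0 / lam * secant (s0 z) (s1 z)) z)"
  have A: "loc_bounded (\<lambda>z. c0 / lam * secant (s0 z) (s1 z))"
    by (intro loc_bounded_cmult loc_bounded_continuous continuous_profile_secant[OF p0 p1])
  have "((\<lambda>z. ((c0 - c1) / lam) * (?W z * cosine (s1 z))) has_integral 0) {z0..z0+1}"
    using profile_crossing_balance[OF lam lam p0 p1 z0(2)] by (simp add: algebra_simps diff_divide_distrib)
  then have "((\<lambda>z. ?W z * cosine (s1 z)) has_integral 0) {z0..z0+1}" if "c0 \<noteq> c1"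
    using has_integral_mult_right[of "\<lambda>z. ((c0 - c1) / lam) * (?W z * cosine (s1 z))" 0 "{z0..z0+1}" "lam / (c0 - c1)"] that lam
    by simp
  moreover have c: "continuous_on {z0..z0+1} (\<lambda>z. ?W z * cosine (s1 z))"
    by (intro continuous_intros continuous_on_subset[OF profileD(6)[OF p1]]
        continuous_on_subset[OF primitive_continuous[OF primitive_signed_integral[OF A]]]) auto
  ultimately have "?W z0 * cosine (s1 z0) = 0" if "c0 \<noteq> c1"
    using that cosine_pos[OF profileD(2)[OF p1]]
    by (intro has_integral_0_cbox_imp_0[of z0 "z0+1" "\<lambda>z. ?W z * cosine (s1 z)"]) (auto simp: less_imp_le)
  then show ?thesis using cosine_pos[OF profileD(2)[OF p1], of z0] by auto
qed

lemma profile_unique: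
  assumes lam: "lam > 0" and p0: "profile lam c0 s0" and p1: "profile lam c1 s1"
  shows "s1 = s0"
proof
  fix x
  obtain z0 where z0: "z0 \<in> {0..1}" "s1 z0 = s0 z0" by (rule profiles_cross[OF p0 p1])
  let ?A = "\<lambda>z. c0 / lam * secant (s0 z) (s1 z)"
  have A: "loc_bounded ?A"
    by (intro loc_bounded_cmult loc_bounded_continuous continuous_profile_secant[OF p0 p1])
  have "primitive (\<lambda>z. exp (- signed_integral ?A z) * (s1 z - s0 z)) (\<lambda>z. 0)"
    using linear_ode_integrating_factor[OF profile_difference[OF lam lam p0 p1] A] profile_speed_unique[OF lam p0 p1]
    by simp
  from primitive_unique[OF this primitive_const[of 0], of x z0] z0 show "s1 x = s0 x" by simp
qed

end

section \<open>The truncated Cauchy problem and existence of profiles\<close>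

text \<open>Used both for boundedness and for the contraction estimate of the Picard map in a norm weighted by
  \<open>exp(-K |z|)\<close>.\<close>
lemma signed_integral_exp_bound:
  assumes g: "loc_bounded g" and K: "K > 0" and le: "\<And>t. \<bar>g t\<bar> \<le> C * exp (K * \<bar>t\<bar>)"
  shows "\<bar>signed_integral g z\<bar> \<le> C / K * exp (K * \<bar>z\<bar>)"
proof -
  have C: "C \<ge> 0" using le[of 0] abs_ge_zero[of "g 0"] by simp
  have le1: "g t \<le> C * exp (K * \<bar>t\<bar>)" and le2: "- (C * exp (K * \<bar>t\<bar>)) \<le> g t" for t
    using le[of t] by auto
  note I = primitive_signed_integral[OF g]
  show ?thesis
  proof (cases "0 \<le> z")
    case True
    have P: "primitive (\<lambda>t. \<sigma> * (C / K * exp (K * t))) (\<lambda>t. \<sigma> * (C * exp (K * t)))" for \<sigma>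
      by (rule primitive_derivative) (use K in \<open>auto intro!: derivative_eq_intros continuous_intros\<close>)
    have "signed_integral g z - signed_integral g 0 \<le> 1 * (C / K * exp (K * z)) - 1 * (C / K * exp (K * 0))"
    proof (rule primitive_mono[OF I P True])
      show "g x \<le> 1 * (C * exp (K * x))" if "0 \<le> x" for x using le1[of x] that by simp
    qed
    moreover have "-1 * (C / K * exp (K * z)) - -1 * (C / K * exp (K * 0)) \<le> signed_integral g z - signed_integral g 0"
    proof (rule primitive_mono[OF P I True])
      show "-1 * (C * exp (K * x)) \<le> g x" if "0 \<le> x" for x using le2[of x] that by simp
    qed
    moreover have "C / K \<ge> 0" using C K by simp
    ultimately show ?thesis using True by (auto simp: abs_le_iff)
  next
    case False
    then have z: "z \<le> 0" by simp
    have P: "primitive (\<lambda>t. \<sigma> * (- (C / K) * exp (- (K * t)))) (\<lambda>t. \<sigma> * (C * exp (- (K * t))))" for \<sigma>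
      by (rule primitive_derivative) (use K in \<open>auto intro!: derivative_eq_intros continuous_intros\<close>)
    have "signed_integral g 0 - signed_integral g z
        \<le> 1 * (- (C / K) * exp (- (K * 0))) - 1 * (- (C / K) * exp (- (K * z)))"
    proof (rule primitive_mono[OF I P z])
      show "g x \<le> 1 * (C * exp (- (K * x)))" if "x \<le> 0" for x using le1[of x] that by simp
    qed
    moreover have "-1 * (- (C / K) * exp (- (K * 0))) - -1 * (- (C / K) * exp (- (K * z)))
        \<le> signed_integral g 0 - signed_integral g z"
    proof (rule primitive_mono[OF P I z])
      show "-1 * (C * exp (- (K * x))) \<le> g x" if "x \<le> 0" for x using le2[of x] that by simp
    qed
    moreover have "C / K \<ge> 0" using C K by simp
    ultimately show ?thesis using z by (auto simp: abs_le_iff)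
  qed
qed

lemma signed_integral_diff:
  assumes "loc_bounded f" "loc_bounded g"
  shows "signed_integral f z - signed_integral g z = signed_integral (\<lambda>x. f x - g x) z"
  using primitive_unique[OF primitive_diff[OF primitive_signed_integral[OF assms(1)] primitive_signed_integral[OF assms(2)]]
      primitive_signed_integral[OF loc_bounded_diff[OF assms]], of z 0] by simp

text \<open>The Picard map, conjugated by the weight \<open>exp(K |z|)\<close>, acts on bounded continuous functions on the
  whole line and has Lipschitz constant \<open>L / K\<close>; one application of Banach's theorem gives a global
  solution.\<close>
lemma lipschitz_ode_solution_exists:
  assumes r: "loc_bounded r" "\<And>z. \<bar>r z\<bar> \<le> B" and Q: "\<And>x y. \<bar>Q x - Q y\<bar> \<le> L * \<bar>x - y\<bar>"
  shows "\<exists>s. s 0 = a \<and> primitive s (\<lambda>z. r z + Q (s z))"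
proof -
  have L: "L \<ge> 0" using Q[of 1 0] abs_ge_zero[of "Q 1 - Q 0"] by simp
  have B: "B \<ge> 0" using r(2)[of 0] abs_ge_zero[of "r 0"] by linarith
  \<comment> \<open>large enough for the contraction constant \<open>L / K \<le> 1 / 2\<close>, and positive even if \<open>L = 0\<close>\<close>
  define K where "K = 2 * L + 1"
  have K: "K > 0" using L by (simp add: K_def)
  have Qc: "continuous_on UNIV Q"
    by (rule lipschitz_on_continuous_on[of L]) (use Q L in \<open>auto intro!: lipschitz_onI simp: dist_real_def\<close>)
  define g where "g = (\<lambda>w t. r t + Q (exp (K * \<bar>t\<bar>) * w t))"
  define T where "T = (\<lambda>w z. exp (- (K * \<bar>z\<bar>)) * (a + signed_integral (g w) z))"
  have gl: "loc_bounded (g w)" if "continuous_on UNIV w" for w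
    unfolding g_def
    by (intro loc_bounded_add r loc_bounded_compose_continuous[OF _ Qc] continuous_intros that) auto
  have Tb: "T w \<in> bcontfun" if w: "continuous_on UNIV w" "\<And>z. \<bar>w z\<bar> \<le> N" for w N
  proof (rule bcontfun_normI)
    have N: "N \<ge> 0" using w(2)[of 0] by simp
    define C where "C = B + \<bar>Q 0\<bar> + L * N"
    have C: "C \<ge> 0" using B L N by (simp add: C_def)
    have "\<bar>g w t\<bar> \<le> C * exp (K * \<bar>t\<bar>)" for t
    proof -
      let ?e = "exp (K * \<bar>t\<bar>)"
      have e: "?e \<ge> 1" using K by simp
      have "\<bar>Q (?e * w t)\<bar> \<le> \<bar>Q 0\<bar> + L * \<bar>?e * w t\<bar>" using Q[of "?e * w t" 0] by simp
      also have "\<dots> \<le> \<bar>Q 0\<bar> + L * (?e * N)"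
        using w(2) L by (intro add_left_mono mult_left_mono) (auto simp: abs_mult)
      finally have "\<bar>g w t\<bar> \<le> B + (\<bar>Q 0\<bar> + L * (?e * N))"
        unfolding g_def using r(2)[of t] by linarith
      also have "\<dots> \<le> B * ?e + (\<bar>Q 0\<bar> * ?e + L * (?e * N))"
        using e B mult_left_mono[OF e B] mult_left_mono[OF e abs_ge_zero[of "Q 0"]] by simp
      finally show ?thesis by (simp add: C_def algebra_simps)
    qed
    from signed_integral_exp_bound[OF gl[OF w(1)] K this]
    have b: "\<bar>signed_integral (g w) z\<bar> \<le> C / K * exp (K * \<bar>z\<bar>)" for z .
    show "norm (T w z) \<le> \<bar>a\<bar> + C / K" for z
    proof -
      let ?e = "exp (- (K * \<bar>z\<bar>))"
      have "\<bar>a + signed_integral (g w) z\<bar> \<le> \<bar>a\<bar> + C / K * exp (K * \<bar>z\<bar>)" using b[of z] by linarith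
      then have "norm (T w z) \<le> ?e * (\<bar>a\<bar> + C / K * exp (K * \<bar>z\<bar>))"
        unfolding T_def by (simp add: abs_mult)
      also have "\<dots> = ?e * \<bar>a\<bar> + C / K" by (simp add: exp_minus field_simps)
      also have "\<dots> \<le> 1 * \<bar>a\<bar> + C / K" using K by (intro add_right_mono mult_right_mono) auto
      finally show ?thesis by simp
    qed
    show "continuous_on UNIV (T w)"
      unfolding T_def
      by (intro continuous_intros primitive_continuous[OF primitive_signed_integral[OF gl[OF w(1)]]])
  qed
  have wc: "continuous_on UNIV (apply_bcontfun w)" for w :: "real \<Rightarrow>\<^sub>C real" by simp
  have wb: "\<exists>N. \<forall>z. \<bar>apply_bcontfun w z\<bar> \<le> N" for w :: "real \<Rightarrow>\<^sub>C real"
    using norm_bounded[of w] by (metis real_norm_def)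
  define \<Phi> where "\<Phi> = (\<lambda>w :: real \<Rightarrow>\<^sub>C real. Bcontfun (T (apply_bcontfun w)))"
  have \<Phi>: "apply_bcontfun (\<Phi> w) = T (apply_bcontfun w)" for w
  proof -
    obtain N where "\<forall>z. \<bar>apply_bcontfun w z\<bar> \<le> N" using wb by blast
    then have "T (apply_bcontfun w) \<in> bcontfun" using Tb[OF wc] by blast
    then show ?thesis unfolding \<Phi>_def by (rule Bcontfun_inverse)
  qed
  have contr: "dist (\<Phi> v) (\<Phi> w) \<le> 1 / 2 * dist v w" for v w
  proof (rule dist_bound)
    fix z
    let ?D = "dist v w"
    have "\<bar>g v t - g w t\<bar> \<le> (L * ?D) * exp (K * \<bar>t\<bar>)" for t
    proof -
      let ?e = "exp (K * \<bar>t\<bar>)"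
      have "\<bar>g v t - g w t\<bar> \<le> L * \<bar>?e * v t - ?e * w t\<bar>" unfolding g_def using Q by simp
      also have "\<bar>?e * v t - ?e * w t\<bar> = ?e * \<bar>v t - w t\<bar>"
        by (simp add: right_diff_distrib[symmetric] abs_mult)
      also have "L * \<dots> \<le> L * (?e * ?D)"
        using dist_bounded[of v t w] L by (intro mult_left_mono) (auto simp: dist_real_def)
      finally show ?thesis by (simp add: algebra_simps)
    qed
    from signed_integral_exp_bound[OF loc_bounded_diff[OF gl[OF wc] gl[OF wc]] K this]
    have "\<bar>signed_integral (g v) z - signed_integral (g w) z\<bar> \<le> L * ?D / K * exp (K * \<bar>z\<bar>)"
      by (simp add: signed_integral_diff[OF gl[OF wc] gl[OF wc]])
    then have "exp (- (K * \<bar>z\<bar>)) * \<bar>signed_integral (g v) z - signed_integral (g w) z\<bar>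
        \<le> exp (- (K * \<bar>z\<bar>)) * (L * ?D / K * exp (K * \<bar>z\<bar>))" by (intro mult_left_mono) auto
    also have "\<dots> = L * ?D / K" by (simp add: exp_minus field_simps)
    also have "\<dots> \<le> 1 / 2 * ?D"
    proof -
      have "L / K \<le> 1 / 2" using K L by (simp add: K_def field_simps)
      from mult_right_mono[OF this zero_le_dist[of v w]] show ?thesis by simp
    qed
    finally show "dist (apply_bcontfun (\<Phi> v) z) (apply_bcontfun (\<Phi> w) z) \<le> 1 / 2 * ?D"
      unfolding \<Phi> T_def dist_real_def by (simp add: right_diff_distrib[symmetric] abs_mult)
  qed
  obtain w where w: "\<Phi> w = w"
    using banach_fix_type[of "1/2" \<Phi>] contr by auto
  define s where "s = (\<lambda>z. a + signed_integral (g w) z)"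
  have ws: "exp (K * \<bar>z\<bar>) * w z = s z" for z
  proof -
    have "w z = T w z" using \<Phi>[of w] w by simp
    then show ?thesis unfolding T_def s_def by (simp add: exp_minus field_simps)
  qed
  have "primitive s (g w)"
    unfolding s_def using primitive_add_const[OF primitive_signed_integral[OF gl[OF wc]], of w a] by (simp add: add.commute)
  then have "primitive s (\<lambda>z. r z + Q (s z))" unfolding g_def ws .
  then show ?thesis by (intro exI[of _ s]) (simp add: s_def)
qed

text \<open>Gronwall's inequality on a unit interval, read off from the integrating factor.\<close>
lemma linear_ode_bound:
  assumes d: "primitive d (\<lambda>z. A z * d z + B z)" and A: "loc_bounded A" "\<And>z. \<bar>A z\<bar> \<le> L"
    and B: "\<And>z. \<bar>B z\<bar> \<le> \<beta>" and z: "0 \<le> z" "z \<le> 1"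
  shows "\<bar>d z\<bar> \<le> exp (2 * L) * (\<bar>d 0\<bar> + \<beta>)"
proof -
  have L: "L \<ge> 0" using A(2)[of 0] by linarith
  have \<beta>: "\<beta> \<ge> 0" using B[of 0] by linarith
  let ?W = "\<lambda>z. exp (- signed_integral A z)"
  have IA: "\<bar>signed_integral A x\<bar> \<le> L" if "0 \<le> x" "x \<le> 1" for x
  proof -
    have "\<bar>signed_integral A x - signed_integral A 0\<bar> \<le> L * (x - 0)"
      by (rule primitive_abs_le[OF primitive_signed_integral[OF A(1)] that(1) A(2)])
    also have "\<dots> \<le> L * 1" using that L by (intro mult_left_mono) auto
    finally show ?thesis by simp
  qed
  note W = linear_ode_integrating_factor[OF d A(1)]
  have "\<bar>?W z * d z - ?W 0 * d 0\<bar> \<le> exp L * \<beta> * (z - 0)"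
  proof (rule primitive_abs_le[OF W z(1)])
    fix x assume x: "0 \<le> x" "x \<le> z"
    then have "?W x \<le> exp L" using IA[of x] z by auto
    then show "\<bar>?W x * B x\<bar> \<le> exp L * \<beta>" unfolding abs_mult using B[of x] \<beta> by (intro mult_mono) auto
  qed
  also have "\<dots> \<le> exp L * \<beta> * 1" using z \<beta> by (intro mult_left_mono) auto
  finally have "\<bar>?W z * d z\<bar> \<le> \<bar>d 0\<bar> + exp L * \<beta>" by simp
  also have "\<dots> \<le> exp L * \<bar>d 0\<bar> + exp L * \<beta>" using L mult_right_mono[of 1 "exp L" "\<bar>d 0\<bar>"] by simp
  finally have 1: "?W z * \<bar>d z\<bar> \<le> exp L * (\<bar>d 0\<bar> + \<beta>)" by (simp add: abs_mult distrib_left)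
  have "\<bar>d z\<bar> = exp (signed_integral A z) * (?W z * \<bar>d z\<bar>)" by (simp add: exp_minus)
  also have "\<dots> \<le> exp L * (exp L * (\<bar>d 0\<bar> + \<beta>))"
    by (intro mult_mono 1) (use IA[OF z] in auto)
  also have "\<dots> = exp (2 * L) * (\<bar>d 0\<bar> + \<beta>)" unfolding mult_2 exp_add by (simp only: mult.assoc)
  finally show ?thesis .
qed

context medium
begin

text \<open>At an extremum of a profile \<open>R = c cosine s\<close> heuristically, so the cosine is at least \<open>m / M\<close> as
  \<open>c \<le> M\<close>. Truncating at half of this value leaves room for a strict inequality.\<close>
definition cos_min :: real where "cos_min = m / (2 * M)"

definition sin_max :: real where "sin_max = sqrt (1 - cos_min\<^sup>2)"

definition tcos :: "real \<Rightarrow> real" where "tcos x = cosine (max (- sin_max) (min sin_max x))"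

text \<open>The difference quotient of the truncated cosine. The value on the diagonal is a default; it only enters
  multiplied by \<open>x - y = 0\<close>.\<close>
definition tslope :: "real \<Rightarrow> real \<Rightarrow> real" where
  "tslope x y = (if x = y then 0 else (tcos x - tcos y) / (x - y))"

definition tsol :: "real \<Rightarrow> real \<Rightarrow> (real \<Rightarrow> real) \<Rightarrow> bool" where
  "tsol lam c s \<longleftrightarrow> primitive s (\<lambda>z. (R z - c * tcos (s z)) / lam)"

lemma cos_min: "0 < cos_min" "cos_min < 1" "M * cos_min = m / 2"
  using m_pos M_pos m_le_M by (auto simp: cos_min_def field_simps)

lemma sin_max: "0 < sin_max" "sin_max < 1" "cosine sin_max = cos_min"
proof -
  have "cos_min\<^sup>2 < 1" "0 < cos_min\<^sup>2" using cos_min by (auto simp: abs_square_less_1)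
  then show "0 < sin_max" "sin_max < 1" by (auto simp: sin_max_def)
  show "cosine sin_max = cos_min"
    using \<open>cos_min\<^sup>2 < 1\<close> cos_min by (simp add: cosine_def sin_max_def)
qed

lemma cosine_ge_cos_min: "\<bar>x\<bar> \<le> sin_max \<Longrightarrow> cos_min \<le> cosine x"
proof -
  assume "\<bar>x\<bar> \<le> sin_max"
  then have "x\<^sup>2 \<le> sin_max\<^sup>2" by (metis abs_le_square_iff abs_of_pos sin_max(1))
  then have "cosine sin_max \<le> cosine x" by (simp add: cosine_def)
  then show ?thesis by (simp add: sin_max)
qed

lemma tcos_bounds: "cos_min \<le> tcos x" "tcos x \<le> 1"
  unfolding tcos_def using sin_max by (auto intro!: cosine_ge_cos_min cosine_le_1)

lemma tcos_eq: "\<bar>x\<bar> \<le> sin_max \<Longrightarrow> tcos x = cosine x"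
proof -
  assume "\<bar>x\<bar> \<le> sin_max"
  then have "max (- sin_max) (min sin_max x) = x" by auto
  then show ?thesis by (simp add: tcos_def)
qed

lemma secant_bound:
  assumes u: "\<bar>u\<bar> \<le> sin_max" and v: "\<bar>v\<bar> \<le> sin_max" shows "\<bar>secant u v\<bar> \<le> 1 / cos_min"
proof -
  have d: "cosine u + cosine v \<ge> 2 * cos_min"
    using cosine_ge_cos_min[OF u] cosine_ge_cos_min[OF v] by simp
  have "\<bar>u + v\<bar> \<le> 2" using u v sin_max(2) by linarith
  then have "\<bar>u + v\<bar> / (cosine u + cosine v) \<le> 2 / (2 * cos_min)"
    using d cos_min by (intro frac_le) auto
  then show ?thesis using d cos_min by (simp add: secant_def abs_divide)
qed

lemma tcos_lipschitz: "\<bar>tcos x - tcos y\<bar> \<le> 1 / cos_min * \<bar>x - y\<bar>"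
proof -
  define p where "p = max (- sin_max) (min sin_max x)"
  define q where "q = max (- sin_max) (min sin_max y)"
  have b: "\<bar>p\<bar> \<le> sin_max" "\<bar>q\<bar> \<le> sin_max" using sin_max(1) by (auto simp: p_def q_def)
  then have b1: "\<bar>p\<bar> < 1" "\<bar>q\<bar> < 1" using sin_max(2) by linarith+
  have l: "\<bar>p - q\<bar> \<le> \<bar>x - y\<bar>" unfolding p_def q_def max_def min_def by (auto simp: abs_if)
  have "\<bar>tcos x - tcos y\<bar> = \<bar>secant q p\<bar> * \<bar>p - q\<bar>"
    unfolding tcos_def p_def[symmetric] q_def[symmetric] cosine_diff[OF b1(2) b1(1)] by (simp add: abs_mult)
  also have "\<dots> \<le> 1 / cos_min * \<bar>x - y\<bar>"
    using secant_bound[OF b(2) b(1)] l cos_min by (intro mult_mono) auto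
  finally show ?thesis .
qed

lemma continuous_tcos: "continuous_on UNIV tcos"
  by (rule lipschitz_on_continuous_on[of "1 / cos_min"])
     (use tcos_lipschitz cos_min in \<open>auto intro!: lipschitz_onI simp: dist_real_def\<close>)

lemma tslope: "tcos x - tcos y = tslope x y * (x - y)"
  by (simp add: tslope_def)

lemma tslope_bound: "\<bar>tslope x y\<bar> \<le> 1 / cos_min"
  using tcos_lipschitz[of x y] cos_min by (auto simp: tslope_def abs_divide pos_divide_le_eq)

lemma loc_bounded_tslope:
  assumes "continuous_on UNIV f" "continuous_on UNIV g"
  shows "loc_bounded (\<lambda>z. tslope (f z) (g z))"
proof (rule loc_bounded_bounded[OF _ tslope_bound])
  have [measurable]: "f \<in> borel_measurable lebesgue" "g \<in> borel_measurable lebesgue"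
    using assms loc_bounded_continuous by (auto simp: loc_bounded_def)
  have [measurable]: "tcos \<in> borel_measurable borel" by (rule borel_measurable_continuous_onI[OF continuous_tcos])
  show "(\<lambda>z. tslope (f z) (g z)) \<in> borel_measurable lebesgue" unfolding tslope_def by measurable
qed

lemma tsolD: "tsol lam c s \<Longrightarrow> primitive s (\<lambda>z. (R z - c * tcos (s z)) / lam)"
  by (simp add: tsol_def)

lemma tsol_continuous: "tsol lam c s \<Longrightarrow> continuous_on UNIV s"
  by (intro primitive_continuous[OF tsolD])

lemma tsol_exists:
  assumes lam: "lam > 0" shows "\<exists>s. s 0 = a \<and> tsol lam c s"
proof -
  have "\<exists>s. s 0 = a \<and> primitive s (\<lambda>z. R z / lam + (- (c / lam) * tcos (s z)))"
  proof (rule lipschitz_ode_solution_exists)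
    show "loc_bounded (\<lambda>z. R z / lam)" by (intro loc_bounded_divide loc_bounded_R)
    show "\<bar>R z / lam\<bar> \<le> M / lam" for z
      using R_ge[of z] R_le[of z] m_pos lam by (simp add: abs_divide divide_right_mono)
    show "\<bar>- (c / lam) * tcos x - - (c / lam) * tcos y\<bar> \<le> (\<bar>c / lam\<bar> * (1 / cos_min)) * \<bar>x - y\<bar>" for x y
    proof -
      have "\<bar>- (c / lam) * tcos x - - (c / lam) * tcos y\<bar> = \<bar>c / lam\<bar> * \<bar>tcos x - tcos y\<bar>"
        by (simp only: right_diff_distrib[symmetric] abs_mult abs_minus_cancel)
      also have "\<dots> \<le> \<bar>c / lam\<bar> * (1 / cos_min * \<bar>x - y\<bar>)" by (intro mult_left_mono tcos_lipschitz) simp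
      finally show ?thesis by (simp only: mult.assoc)
    qed
  qed
  then show ?thesis unfolding tsol_def by (simp add: diff_divide_distrib)
qed

lemma tsol_difference:
  assumes lam: "lam > 0" and s: "tsol lam c s" and s': "tsol lam c' s'"
  shows "primitive (\<lambda>z. s' z - s z)
    (\<lambda>z. (- (c / lam) * tslope (s' z) (s z)) * (s' z - s z) + - ((c' - c) / lam) * tcos (s' z))"
proof (rule primitive_cong[OF primitive_diff[OF tsolD[OF s'] tsolD[OF s]]])
  fix z
  have e: "tslope (s' z) (s z) * (s' z - s z) = tcos (s' z) - tcos (s z)" by (rule tslope[symmetric])
  show "(- (c / lam) * tslope (s' z) (s z)) * (s' z - s z) + - ((c' - c) / lam) * tcos (s' z)
    = (R z - c' * tcos (s' z)) / lam - (R z - c * tcos (s z)) / lam"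
    unfolding mult.assoc e using lam by (simp add: field_simps)
qed

lemma loc_bounded_tsol_coeff:
  assumes s: "tsol lam c s" and s': "tsol lam c' s'"
  shows "loc_bounded (\<lambda>z. k * tslope (s' z) (s z))"
  by (intro loc_bounded_cmult loc_bounded_tslope tsol_continuous[OF s] tsol_continuous[OF s'])

lemma tsol_same_speed:
  assumes lam: "lam > 0" and s: "tsol lam c s" and s': "tsol lam c s'"
  shows "exp (- signed_integral (\<lambda>z. - (c / lam) * tslope (s' z) (s z)) x) * (s' x - s x) = s' 0 - s 0"
proof -
  have "primitive (\<lambda>z. exp (- signed_integral (\<lambda>z. - (c / lam) * tslope (s' z) (s z)) z) * (s' z - s z)) (\<lambda>z. 0)"
    using linear_ode_integrating_factor[OF tsol_difference[OF lam s s'] loc_bounded_tsol_coeff[OF s s']] by simp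
  from primitive_unique[OF this primitive_const[of 0], of x 0] show ?thesis by simp
qed

lemma tsol_unique:
  assumes lam: "lam > 0" and s: "tsol lam c s" and s': "tsol lam c s'" and "s' 0 = s 0"
  shows "s' = s"
  using tsol_same_speed[OF lam s s'] assms(4) by (auto simp: fun_eq_iff)

lemma tsol_dependence:
  assumes lam: "lam > 0" and c: "0 \<le> c" "c \<le> M" and s: "tsol lam c s" and s': "tsol lam c' s'" and z: "0 \<le> z" "z \<le> 1"
  shows "\<bar>s' z - s z\<bar> \<le> exp (2 * (M / lam * (1 / cos_min))) * (\<bar>s' 0 - s 0\<bar> + \<bar>c' - c\<bar> / lam)"
proof (rule linear_ode_bound[OF tsol_difference[OF lam s s'] loc_bounded_tsol_coeff[OF s s'] _ _ z])
  show "\<bar>- (c / lam) * tslope (s' z) (s z)\<bar> \<le> M / lam * (1 / cos_min)" for z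
    unfolding abs_mult abs_minus_cancel using c lam M_pos
    by (intro mult_mono tslope_bound) (auto simp: abs_divide divide_right_mono)
  show "\<bar>- ((c' - c) / lam) * tcos (s' z)\<bar> \<le> \<bar>c' - c\<bar> / lam" for z
  proof -
    have "\<bar>- ((c' - c) / lam) * tcos (s' z)\<bar> \<le> \<bar>(c' - c) / lam\<bar> * 1"
      unfolding abs_mult abs_minus_cancel
      using tcos_bounds[of "s' z"] cos_min by (intro mult_left_mono) auto
    then show ?thesis using lam by (simp add: abs_divide)
  qed
qed

text \<open>Where \<open>|s|\<close> reaches the truncation threshold, the right-hand side is at least \<open>m / 2\<close> and \<open>s\<close> is strictly
  increasing nearby. So neither the maximum nor the minimum can be attained there.\<close>
lemma periodic_tsol_bound:
  assumes lam: "lam > 0" and c: "0 \<le> c" "c \<le> M" and s: "tsol lam c s" and per: "\<And>z. s (z + 1) = s z"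
  shows "\<bar>s z\<bar> < sin_max"
proof -
  note P = tsolD[OF s] and sc = tsol_continuous[OF s]
  have kc: "continuous_on UNIV (\<lambda>z. m - c * tcos (s z))"
    by (intro continuous_intros continuous_on_compose2[OF continuous_tcos sc]) auto
  have rise: "\<exists>d>0. s x < s (x + d) \<and> s (x - d) < s x" if x: "\<bar>s x\<bar> \<ge> sin_max" for x
  proof -
    have "tcos (s x) = cos_min"
    proof (cases "s x \<ge> 0")
      case True
      then show ?thesis using x sin_max by (simp add: tcos_def)
    next
      case False
      then have "max (- sin_max) (min sin_max (s x)) = - sin_max" using x sin_max by simp
      then show ?thesis using sin_max by (simp add: tcos_def cosine_def)
    qed
    then have "c * tcos (s x) \<le> m / 2" using mult_right_mono[of c M cos_min] c cos_min(1,3) by simp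
    then have "m - c * tcos (s x) > m / 4" using m_pos by simp
    moreover have "isCont (\<lambda>z. m - c * tcos (s z)) x" using kc by (simp add: continuous_on_eq_continuous_at)
    ultimately obtain e where e0: "e > 0"
      "\<And>z. dist z x < e \<Longrightarrow> dist (m - c * tcos (s z)) (m - c * tcos (s x)) < (m - c * tcos (s x)) - m / 4"
      unfolding continuous_at_eps_delta by (metis diff_gt_0_iff_gt)
    have e: "e > 0" "m - c * tcos (s z) > m / 4" if "dist z x < e" for z
      using e0 e0(2)[OF that] unfolding dist_real_def by linarith+
    note e = e0(1) e(2)
    define d where "d = e / 2"
    have d: "d > 0" using e by (simp add: d_def)
    have ge: "m / (4 * lam) \<le> (R z - c * tcos (s z)) / lam" if "x - d \<le> z" "z \<le> x + d" for z
    proof -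
      have "dist z x < e" using that e by (auto simp: d_def dist_real_def)
      from e(2)[OF this] R_ge[of z] have "m / 4 \<le> R z - c * tcos (s z)" by simp
      then have "m / 4 / lam \<le> (R z - c * tcos (s z)) / lam" using lam by (intro divide_right_mono) auto
      then show ?thesis by simp
    qed
    have "m / (4 * lam) * (x + d) - m / (4 * lam) * x \<le> s (x + d) - s x"
      by (rule primitive_mono[OF primitive_id P]) (use d ge in auto)
    moreover have "m / (4 * lam) * x - m / (4 * lam) * (x - d) \<le> s x - s (x - d)"
      by (rule primitive_mono[OF primitive_id P]) (use d ge in auto)
    moreover have "m / (4 * lam) * d > 0" using d lam m_pos by simp
    ultimately have "s x < s (x + d)" "s (x - d) < s x" unfolding distrib_left right_diff_distrib by linarith+
    then show ?thesis using d by blast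
  qed
  have c01: "continuous_on {0..1} s" using sc continuous_on_subset by blast
  obtain x where x: "x \<in> {0..1}" "\<And>y. y \<in> {0..1} \<Longrightarrow> s y \<le> s x"
    using continuous_attains_sup[OF _ _ c01] by auto
  obtain x' where x': "x' \<in> {0..1}" "\<And>y. y \<in> {0..1} \<Longrightarrow> s x' \<le> s y"
    using continuous_attains_inf[OF _ _ c01] by auto
  have rep: "\<exists>y\<in>{0..1}. s z = s y" for z
    using periodic_representative[where f=s and a=0] per by simp
  have le: "s z \<le> s x" "s x' \<le> s z" for z using rep[of z] x x' by auto
  have "\<bar>s x\<bar> < sin_max" using rise[of x] le by (meson not_le)
  moreover have "\<bar>s x'\<bar> < sin_max" using rise[of x'] le by (meson not_le)
  ultimately show ?thesis using le[of z] by auto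
qed

text \<open>The set of pairs \<open>(a, c)\<close> with \<open>s(1) \<le> a\<close> is compact and contains \<open>(0, M)\<close>; take one with the least
  \<open>c\<close>. Lowering \<open>c\<close> a little would keep a strict inequality, so no \<open>a\<close> satisfies \<open>s(1) < a\<close> at this speed. The
  period map then has a fixed point and is nowhere below the diagonal. The quotients
  \<open>(s(1) - a) / (s(0) - a)\<close> for nearby solutions are at least 1 to the right and at most 1 to the left
  of the fixed point, and tend to \<open>exp (c / \<lambda> \<integral> slope)\<close>.\<close>
lemma profile_exists:
  assumes lam: "lam > 0"
  shows "\<exists>c s. profile lam c s \<and> 0 < c \<and> c \<le> M \<and> (\<forall>z. \<bar>s z\<bar> < sin_max)"
proof -
  obtain S where S: "\<And>a c. S a c 0 = a" "\<And>a c. tsol lam c (S a c)"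
    using tsol_exists[OF lam] by metis
  define E where "E = exp (2 * (M / lam * (1 / cos_min)))"
  have E: "E > 0" by (simp add: E_def)
  have dep: "\<bar>S a' c' z - S a c z\<bar> \<le> E * (\<bar>a' - a\<bar> + \<bar>c' - c\<bar> / lam)"
    if "0 \<le> c" "c \<le> M" "0 \<le> z" "z \<le> 1" for a a' c c' z
    using tsol_dependence[OF lam that(1,2) S(2) S(2) that(3,4), of a' c' a] by (simp add: S(1) E_def)
  let ?Box = "{- sin_max..sin_max} \<times> {0..M}"
  let ?P = "\<lambda>p. S (fst p) (snd p) 1 - fst p"
  have "continuous_on ?Box ?P"
  proof (rule lipschitz_on_continuous_on)
    show "(E * (1 + 1 / lam) + 1)-lipschitz_on ?Box ?P"
    proof (rule lipschitz_onI)
      fix p q assume pq: "p \<in> ?Box" "q \<in> ?Box"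
      have 1: "\<bar>fst p - fst q\<bar> \<le> dist p q" "\<bar>snd p - snd q\<bar> \<le> dist p q"
        using dist_fst_le[of p q] dist_snd_le[of p q] by (auto simp: dist_real_def)
      have "\<bar>S (fst p) (snd p) 1 - S (fst q) (snd q) 1\<bar> \<le> E * (\<bar>fst p - fst q\<bar> + \<bar>snd p - snd q\<bar> / lam)"
        using pq by (intro dep) (auto simp: mem_Times_iff)
      also have "\<dots> \<le> E * (dist p q + dist p q / lam)"
        using 1 E lam by (intro mult_left_mono add_mono divide_right_mono) auto
      finally show "dist (?P p) (?P q) \<le> (E * (1 + 1 / lam) + 1) * dist p q"
        using 1 by (simp add: dist_real_def algebra_simps)
    qed (use E lam in auto)
  qed
  then have "closed (?Box \<inter> ?P -` {..0})"
    by (intro continuous_closed_preimage closed_Times) auto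
  moreover have "bounded (?Box \<inter> ?P -` {..0})"
    by (rule bounded_subset[OF bounded_Times[OF bounded_closed_interval bounded_closed_interval]]) auto
  ultimately have X: "compact (?Box \<inter> ?P -` {..0})" by (simp add: compact_eq_bounded_closed)
  have "S 0 M 1 \<le> 0"
  proof -
    let ?A = "\<lambda>z. - (M / lam) * tslope (S 0 M z) 0"
    have A: "loc_bounded ?A"
      by (intro loc_bounded_cmult loc_bounded_tslope tsol_continuous[OF S(2)]) auto
    have "tcos 0 = 1" using sin_max by (simp add: tcos_eq)
    then have "primitive (S 0 M) (\<lambda>z. ?A z * S 0 M z + (R z - M) / lam)"
      using tslope[of "S 0 M _" 0] lam
      by (intro primitive_cong[OF tsolD[OF S(2)]]) (simp add: field_simps)
    note W = linear_ode_integrating_factor[OF this A]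
    have "exp (- signed_integral ?A 1) * S 0 M 1 - exp (- signed_integral ?A 0) * S 0 M 0 \<le> 0 * 1 - 0 * 0"
      by (rule primitive_mono[OF W primitive_id]) (use R_le lam in \<open>auto simp: mult_le_0_iff divide_le_0_iff\<close>)
    then show ?thesis by (simp add: S(1) mult_le_0_iff)
  qed
  then have "(0, M) \<in> ?Box \<inter> ?P -` {..0}" using sin_max M_pos by auto
  then have ne: "?Box \<inter> ?P -` {..0} \<noteq> {}" by blast
  obtain p where p: "p \<in> ?Box \<inter> ?P -` {..0}" "\<And>q. q \<in> ?Box \<inter> ?P -` {..0} \<Longrightarrow> snd p \<le> snd q"
    using continuous_attains_inf[OF X ne continuous_on_snd[OF continuous_on_id]] by blast
  define a where "a = fst p"
  define c where "c = snd p"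
  have a: "- sin_max \<le> a" "a \<le> sin_max" and c0: "0 \<le> c" "c \<le> M" and Pa: "S a c 1 \<le> a"
    using p(1) by (auto simp: a_def c_def)
  have minc: "c \<le> c'" if "\<bar>a'\<bar> \<le> sin_max" "0 \<le> c'" "c' \<le> M" "S a' c' 1 \<le> a'" for a' c'
    using p(2)[of "(a', c')"] that by (simp add: c_def abs_le_iff minus_le_iff)
  have cpos: "c > 0"
  proof (rule ccontr)
    assume "\<not> c > 0"
    then have "c = 0" using c0 by simp
    then have "primitive (S a c) (\<lambda>z. R z / lam)" using tsolD[OF S(2)[of c a]] by simp
    from primitive_mono[OF primitive_id[of "m / lam"] this, of 0 1]
    have "m / lam \<le> S a c 1 - a" using R_ge lam S(1) by (auto simp: divide_right_mono)
    moreover have "m / lam > 0" using m_pos lam by simp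
    ultimately show False using Pa by simp
  qed
  have P_ge: "S a' c 1 \<ge> a'" if a': "\<bar>a'\<bar> \<le> sin_max" for a'
  proof (rule ccontr)
    assume "\<not> ?thesis"
    then have g: "a' - S a' c 1 > 0" by simp
    \<comment> \<open>a decrease of the speed that moves \<open>s(1)\<close> by at most the gap \<open>a' - s(1)\<close>\<close>
    define \<eta> where "\<eta> = min c ((a' - S a' c 1) * lam / E)"
    have \<eta>: "\<eta> > 0" "\<eta> \<le> c" "E * (\<eta> / lam) \<le> a' - S a' c 1"
    proof -
      show "\<eta> > 0" "\<eta> \<le> c" using g cpos lam E by (auto simp: \<eta>_def)
      have "\<eta> \<le> (a' - S a' c 1) * lam / E" by (simp add: \<eta>_def)
      then show "E * (\<eta> / lam) \<le> a' - S a' c 1" using lam E by (simp add: field_simps)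
    qed
    have "\<bar>S a' (c - \<eta>) 1 - S a' c 1\<bar> \<le> E * (\<bar>a' - a'\<bar> + \<bar>(c - \<eta>) - c\<bar> / lam)"
      by (rule dep) (use c0 in auto)
    then have "S a' (c - \<eta>) 1 \<le> a'" using \<eta> by auto
    then have "c \<le> c - \<eta>" using \<eta> c0 a' by (intro minc[of a']) auto
    then show False using \<eta> by simp
  qed
  define s where "s = S a c"
  have s: "tsol lam c s" "s 0 = a" by (auto simp: s_def S)
  have s1: "s 1 = a" using Pa P_ge[of a] a by (simp add: s_def abs_le_iff minus_le_iff)
  have per: "s (z + 1) = s z" for z
  proof -
    have "tsol lam c (\<lambda>z. s (z + 1))"
      using primitive_shift[OF tsolD[OF s(1)], of 1] R_periodic by (simp add: tsol_def)
    from tsol_unique[OF lam s(1) this] s s1 show ?thesis by (simp add: fun_eq_iff)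
  qed
  have sb: "\<bar>s z\<bar> < sin_max" for z by (rule periodic_tsol_bound[OF lam c0 s(1) per])
  have ab: "\<bar>a\<bar> < sin_max" using sb[of 0] s by simp
  let ?A = "\<lambda>a' z. - (c / lam) * tslope (S a' c z) (s z)"
  have lim: "(\<lambda>n. signed_integral (?A (b n)) 1) \<longlonglongrightarrow> c / lam * integral {0..1} (\<lambda>z. slope (s z))"
    if b: "b \<longlonglongrightarrow> a" "\<And>n. b n \<noteq> a" for b
  proof -
    have "(\<lambda>n. integral {0..1} (?A (b n))) \<longlonglongrightarrow> integral {0..1} (\<lambda>z. - (c / lam) * - slope (s z))"
    proof (rule dominated_convergence(2)[where h="\<lambda>z. \<bar>c / lam\<bar> * (1 / cos_min)"])
      show "?A (b n) integrable_on {0..1}" for n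
        by (intro loc_bounded_integrable loc_bounded_tsol_coeff[OF s(1) S(2)])
      show "(\<lambda>z::real. \<bar>c / lam\<bar> * (1 / cos_min)) integrable_on {0..1}" by (rule loc_bounded_integrable[OF loc_bounded_const])
      show "norm (?A (b n) z) \<le> \<bar>c / lam\<bar> * (1 / cos_min)" for n z
        unfolding real_norm_def abs_mult abs_minus_cancel by (intro mult_left_mono tslope_bound) auto
      fix z :: real assume z: "z \<in> {0..1}"
      \<comment> \<open>distinct solutions never meet, so \<open>tslope\<close> is a true difference quotient here\<close>
      have ne: "S (b n) c z \<noteq> s z" for n
        using tsol_same_speed[OF lam s(1) S(2), of "b n" z] b(2)[of n] by (auto simp: S(1) s)
      have "(\<lambda>n. S (b n) c z - s z) \<longlonglongrightarrow> 0"
      proof (rule Lim_null_comparison)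
        show "\<forall>\<^sub>F n in sequentially. norm (S (b n) c z - s z) \<le> E * \<bar>b n - a\<bar>"
          using dep[OF c0, of z "b _" c a] z by (intro always_eventually) (auto simp: s_def)
        show "(\<lambda>n. E * \<bar>b n - a\<bar>) \<longlonglongrightarrow> 0" using b(1) by (auto intro!: tendsto_eq_intros)
      qed
      then have "(\<lambda>n. S (b n) c z) \<longlonglongrightarrow> s z" by (simp add: LIM_zero_iff)
      then have "filterlim (\<lambda>n. S (b n) c z) (at (s z)) sequentially"
        using ne by (simp add: filterlim_at)
      moreover have "(tcos has_real_derivative - slope (s z)) (at (s z))"
      proof (rule has_field_derivative_transform_within_open)
        show "(cosine has_real_derivative - slope (s z)) (at (s z))"
          using sb[of z] sin_max by (intro cosine_derivative) auto
        show "s z \<in> {- sin_max<..<sin_max}" using sb[of z] by auto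
      qed (auto simp: tcos_eq)
      then have "((\<lambda>y. (tcos y - tcos (s z)) / (y - s z)) \<longlongrightarrow> - slope (s z)) (at (s z))"
        by (simp add: has_field_derivative_iff)
      ultimately have "(\<lambda>n. (tcos (S (b n) c z) - tcos (s z)) / (S (b n) c z - s z)) \<longlonglongrightarrow> - slope (s z)"
        by (rule filterlim_compose[rotated])
      then have "(\<lambda>n. tslope (S (b n) c z) (s z)) \<longlonglongrightarrow> - slope (s z)" using ne by (simp add: tslope_def)
      then show "(\<lambda>n. ?A (b n) z) \<longlonglongrightarrow> - (c / lam) * - slope (s z)" by (intro tendsto_intros)
    qed
    then show ?thesis by (simp add: signed_integral_def)
  qed
  \<comment> \<open>the initial values \<open>a \<plusminus> e n\<close> stay in \<open>{- sin_max..sin_max}\<close>, where the minimality of \<open>c\<close> applies\<close>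
  define \<delta> where "\<delta> = sin_max - \<bar>a\<bar>"
  have \<delta>: "\<delta> > 0" using ab by (simp add: \<delta>_def)
  define e where "e = (\<lambda>n. \<delta> * inverse (real (Suc n)))"
  have e: "e n > 0" "e n \<le> \<delta>" for n
  proof -
    show "e n > 0" using \<delta> by (simp add: e_def)
    have "inverse (real (Suc n)) \<le> 1" by (simp add: inverse_le_1_iff)
    from mult_left_mono[OF this, of \<delta>] show "e n \<le> \<delta>" using \<delta> by (simp add: e_def)
  qed
  have e0: "e \<longlonglongrightarrow> 0" unfolding e_def using tendsto_mult_right_zero[OF LIMSEQ_inverse_real_of_nat] by blast
  have same: "exp (- signed_integral (?A a') 1) * (S a' c 1 - a) = a' - a" for a'
    using tsol_same_speed[OF lam s(1) S(2), of a' 1] s1 s(2) by (simp add: S(1))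
  have "signed_integral (?A (a + e n)) 1 \<ge> 0" for n
  proof -
    have "\<bar>a + e n\<bar> \<le> sin_max" using e[of n] by (simp add: \<delta>_def abs_le_iff) linarith
    from P_ge[OF this] have g: "S (a + e n) c 1 - a \<ge> e n" by simp
    have "exp (- signed_integral (?A (a + e n)) 1) * (S (a + e n) c 1 - a) \<le> 1 * (S (a + e n) c 1 - a)"
      using same[of "a + e n"] g by simp
    then have "exp (- signed_integral (?A (a + e n)) 1) \<le> 1"
      by (rule mult_right_le_imp_le) (use g e(1)[of n] in linarith)
    then show ?thesis by simp
  qed
  moreover have "(\<lambda>n. signed_integral (?A (a + e n)) 1) \<longlonglongrightarrow> c / lam * integral {0..1} (\<lambda>z. slope (s z))"
  proof (rule lim)
    show "(\<lambda>n. a + e n) \<longlonglongrightarrow> a" using tendsto_add[OF tendsto_const[of a] e0] by simp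
    show "a + e n \<noteq> a" for n using e(1)[of n] by simp
  qed
  ultimately have ge: "c / lam * integral {0..1} (\<lambda>z. slope (s z)) \<ge> 0"
    by (intro LIMSEQ_le_const) auto
  have "signed_integral (?A (a - e n)) 1 \<le> 0" for n
  proof -
    have "\<bar>a - e n\<bar> \<le> sin_max" using e[of n] by (simp add: \<delta>_def abs_le_iff) linarith
    from P_ge[OF this] have g: "S (a - e n) c 1 - a \<ge> - e n" by simp
    let ?x = "exp (- signed_integral (?A (a - e n)) 1)"
    have eq: "?x * (S (a - e n) c 1 - a) = - e n" using same[of "a - e n"] by simp
    have "?x * - e n \<le> - e n" using mult_left_mono[OF g, of ?x] eq by simp
    then have "?x \<ge> 1" using e(1)[of n] by simp
    then show ?thesis by simp
  qed
  moreover have "(\<lambda>n. signed_integral (?A (a - e n)) 1) \<longlonglongrightarrow> c / lam * integral {0..1} (\<lambda>z. slope (s z))"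
  proof (rule lim)
    show "(\<lambda>n. a - e n) \<longlonglongrightarrow> a" using tendsto_diff[OF tendsto_const[of a] e0] by simp
    show "a - e n \<noteq> a" for n using e(1)[of n] by simp
  qed
  ultimately have "c / lam * integral {0..1} (\<lambda>z. slope (s z)) \<le> 0"
    by (intro LIMSEQ_le_const2) auto
  with ge have "c / lam * integral {0..1} (\<lambda>z. slope (s z)) = 0" by simp
  then have "integral {0..1} (\<lambda>z. slope (s z)) = 0" using cpos lam by simp
  moreover have "primitive s (\<lambda>z. (R z - c * cosine (s z)) / lam)"
    by (rule primitive_cong[OF tsolD[OF s(1)]]) (use sb in \<open>simp add: tcos_eq less_imp_le\<close>)
  moreover have "\<bar>s z\<bar> < 1" for z using sb[of z] sin_max by linarith
  ultimately have "profile lam c s" using per by (simp add: profile_def)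
  then show ?thesis using cpos c0 sb by blast
qed

end

section \<open>Linearization operators\<close>

lemma param_smooth_cosine:
  assumes "param_smooth n S f" "\<And>l z. l \<in> S \<Longrightarrow> \<bar>f l z\<bar> < 1"
  shows "param_smooth n S (\<lambda>l z. cosine (f l z))"
  unfolding cosine_def power2_eq_square
proof (intro param_smooth_sqrt param_smooth_diff param_smooth_mult param_smooth_const assms(1))
  show "0 < 1 - f l z * f l z" if "l \<in> S" for l z
    using assms(2)[OF that, of z] abs_square_less_1[of "f l z"] by (simp add: power2_eq_square)
qed

lemma param_smooth_secant:
  assumes "param_smooth n S f" "\<And>l z. l \<in> S \<Longrightarrow> \<bar>f l z\<bar> < 1"
    "param_smooth n S g" "\<And>l z. l \<in> S \<Longrightarrow> \<bar>g l z\<bar> < 1"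
  shows "param_smooth n S (\<lambda>l z. secant (f l z) (g l z))"
  unfolding secant_def
proof (intro param_smooth_divide param_smooth_add param_smooth_cosine assms)
  show "cosine (f l z) + cosine (g l z) \<noteq> 0" if "l \<in> S" for l z
    using cosine_pos[OF assms(2)[OF that]] cosine_pos[OF assms(4)[OF that]] by (smt (verit))
qed

text \<open>The difference quotient of the slope, again in a form that is continuous across the diagonal.\<close>
definition slope_quotient :: "real \<Rightarrow> real \<Rightarrow> real" where
  "slope_quotient x y = (cosine x + x * secant x y) / (cosine x * cosine y)"

lemma slope_diff:
  assumes "\<bar>x\<bar> < 1" "\<bar>y\<bar> < 1" shows "slope y - slope x = slope_quotient x y * (y - x)"
proof -
  note p = cosine_pos[OF assms(1)] cosine_pos[OF assms(2)]
  have e: "cosine y = cosine x - secant x y * (y - x)" using cosine_diff[OF assms] by simp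
  have "slope y - slope x = (y * cosine x - x * cosine y) / (cosine x * cosine y)"
    using p by (simp add: slope_def field_simps)
  also have "y * cosine x - x * cosine y = (cosine x + x * secant x y) * (y - x)"
    unfolding e by (simp add: algebra_simps)
  finally show ?thesis by (simp add: slope_quotient_def)
qed

lemma slope_quotient_diag_pos:
  assumes "\<bar>x\<bar> < 1" shows "slope_quotient x x > 0"
proof -
  have "x * secant x x \<ge> 0"
    using cosine_pos[OF assms] by (simp add: secant_diag slope_def power2_eq_square[symmetric])
  then show ?thesis using cosine_pos[OF assms] unfolding slope_quotient_def
    by (intro divide_pos_pos add_pos_nonneg mult_pos_pos) auto
qed

lemma param_smooth_slope_quotient:
  assumes "param_smooth n S f" "\<And>l z. l \<in> S \<Longrightarrow> \<bar>f l z\<bar> < 1"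
    "param_smooth n S g" "\<And>l z. l \<in> S \<Longrightarrow> \<bar>g l z\<bar> < 1"
  shows "param_smooth n S (\<lambda>l z. slope_quotient (f l z) (g l z))"
  unfolding slope_quotient_def
proof (intro param_smooth_divide param_smooth_add param_smooth_mult param_smooth_cosine param_smooth_secant assms)
  show "cosine (f l z) * cosine (g l z) \<noteq> 0" if "l \<in> S" for l z
    using cosine_pos[OF assms(2)[OF that, of z]] cosine_pos[OF assms(4)[OF that, of z]] by simp
qed

text \<open>For two profiles \<open>x\<close> (at \<open>l0\<close>) and \<open>y\<close> (at \<open>l1\<close>) and \<open>b = c0 / l0\<close>, the \<open>weight\<close> is the integrating
  factor of the equation for \<open>y - x\<close>. Write \<open>d\<close> and \<open>D\<close> for the difference quotients of the speed and of the
  profile. Integrating the equation for \<open>weight \<sdot> (y - x)\<close>, with the irregular term \<open>weight \<sdot> y'\<close> integrated by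
  parts, gives
  \<open>l0 weight D + weight y + d drift + bend = k\<close> with a constant \<open>k\<close> (the offset). Periodicity of \<open>D\<close>
  is one linear equation for \<open>(d, k)\<close>, the equality of the mean slopes is another; the last four
  definitions are Cramer's rule for them and the resulting value of \<open>D\<close>.\<close>
definition weight :: "real \<Rightarrow> (real \<Rightarrow> real) \<Rightarrow> (real \<Rightarrow> real) \<Rightarrow> real \<Rightarrow> real" where
  "weight b x y z = exp (- signed_integral (\<lambda>t. b * secant (x t) (y t)) z)"

definition drift :: "real \<Rightarrow> (real \<Rightarrow> real) \<Rightarrow> (real \<Rightarrow> real) \<Rightarrow> real \<Rightarrow> real" where
  "drift b x y z = signed_integral (\<lambda>t. weight b x y t * cosine (y t)) z"

definition bend :: "real \<Rightarrow> (real \<Rightarrow> real) \<Rightarrow> (real \<Rightarrow> real) \<Rightarrow> real \<Rightarrow> real" where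
  "bend b x y z = signed_integral (\<lambda>t. b * secant (x t) (y t) * (weight b x y t * y t)) z"

definition slope_mean :: "real \<Rightarrow> (real \<Rightarrow> real) \<Rightarrow> (real \<Rightarrow> real) \<Rightarrow> (real \<Rightarrow> real) \<Rightarrow> real" where
  "slope_mean b x y f = signed_integral (\<lambda>t. slope_quotient (x t) (y t) / weight b x y t * f t) 1"

definition determinant :: "real \<Rightarrow> (real \<Rightarrow> real) \<Rightarrow> (real \<Rightarrow> real) \<Rightarrow> real" where
  "determinant b x y = - (weight b x y 1 - 1) * slope_mean b x y (drift b x y) - drift b x y 1 * slope_mean b x y (\<lambda>t. 1)"

definition speed_rate :: "real \<Rightarrow> (real \<Rightarrow> real) \<Rightarrow> (real \<Rightarrow> real) \<Rightarrow> real" where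
  "speed_rate b x y = ((weight b x y 1 - 1) * slope_mean b x y (\<lambda>t. weight b x y t * y t + bend b x y t)
     + slope_mean b x y (\<lambda>t. 1) * bend b x y 1) / determinant b x y"

definition offset_rate :: "real \<Rightarrow> (real \<Rightarrow> real) \<Rightarrow> (real \<Rightarrow> real) \<Rightarrow> real" where
  "offset_rate b x y = (bend b x y 1 * slope_mean b x y (drift b x y)
     - drift b x y 1 * slope_mean b x y (\<lambda>t. weight b x y t * y t + bend b x y t)) / determinant b x y"

definition profile_rate :: "real \<Rightarrow> (real \<Rightarrow> real) \<Rightarrow> (real \<Rightarrow> real) \<Rightarrow> real \<Rightarrow> real \<Rightarrow> real" where
  "profile_rate b x y l z =
     (offset_rate b x y - weight b x y z * y z - speed_rate b x y * drift b x y z - bend b x y z) / (l * weight b x y z)"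

lemma weight_pos: "weight b x y z > 0"
  by (simp add: weight_def)

lemma weight_0 [simp]: "weight b x y 0 = 1"
  by (simp add: weight_def)

text \<open>All operators preserve smooth dependence on a parameter. The families \<open>X\<close> and \<open>Y\<close> are used in two ways:
  with \<open>X\<close> frozen, to pass to the limit in difference quotients, and with \<open>X = Y\<close>, to see that the
  limits are again smooth.\<close>
context
  fixes n :: nat and S :: "real set" and b :: "real \<Rightarrow> real" and X Y :: "real \<Rightarrow> real \<Rightarrow> real"
  assumes S: "open S" and b: "param_smooth n S (\<lambda>l z. b l)"
    and X: "param_smooth n S X" "\<And>l z. l \<in> S \<Longrightarrow> \<bar>X l z\<bar> < 1"
    and Y: "param_smooth n S Y" "\<And>l z. l \<in> S \<Longrightarrow> \<bar>Y l z\<bar> < 1"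
begin

lemma param_smooth_bsecant: "param_smooth n S (\<lambda>l z. b l * secant (X l z) (Y l z))"
  by (intro param_smooth_mult b param_smooth_secant X Y)

lemma param_smooth_weight: "param_smooth n S (\<lambda>l z. weight (b l) (X l) (Y l) z)"
  unfolding weight_def
  by (intro param_smooth_exp param_smooth_minus)
     (rule param_smooth_signed_integral[OF S, of n "\<lambda>l t. b l * secant (X l t) (Y l t)", OF param_smooth_bsecant])

lemma param_smooth_drift: "param_smooth n S (\<lambda>l z. drift (b l) (X l) (Y l) z)"
  unfolding drift_def
  by (rule param_smooth_signed_integral[OF S, of n "\<lambda>l t. weight (b l) (X l) (Y l) t * cosine (Y l t)"])
     (intro param_smooth_mult param_smooth_weight param_smooth_cosine Y)

lemma param_smooth_bend: "param_smooth n S (\<lambda>l z. bend (b l) (X l) (Y l) z)"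
  unfolding bend_def
  by (rule param_smooth_signed_integral[OF S, of n "\<lambda>l t. b l * secant (X l t) (Y l t) * (weight (b l) (X l) (Y l) t * Y l t)"])
     (intro param_smooth_mult param_smooth_weight b param_smooth_secant X Y)

lemma param_smooth_slope_density: "param_smooth n S (\<lambda>l z. slope_quotient (X l z) (Y l z) / weight (b l) (X l) (Y l) z)"
  by (intro param_smooth_divide param_smooth_weight param_smooth_slope_quotient X Y)
     (assumption | rule less_imp_neq[OF weight_pos, symmetric])+

lemma param_smooth_slope_mean:
  "param_smooth n S F \<Longrightarrow> param_smooth n S (\<lambda>l z. slope_mean (b l) (X l) (Y l) (F l))"
  unfolding slope_mean_def
  by (rule param_smooth_freeze[OF param_smooth_signed_integral[OF S, of n
          "\<lambda>l t. slope_quotient (X l t) (Y l t) / weight (b l) (X l) (Y l) t * F l t"]])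
     (intro param_smooth_mult param_smooth_slope_density)

lemma param_smooth_determinant: "param_smooth n S (\<lambda>l z. determinant (b l) (X l) (Y l))"
  unfolding determinant_def
  by (intro param_smooth_diff param_smooth_mult param_smooth_minus param_smooth_const
      param_smooth_freeze[OF param_smooth_weight] param_smooth_freeze[OF param_smooth_drift]
      param_smooth_slope_mean param_smooth_drift)

lemma param_smooth_speed_rate:
  assumes "\<And>l. l \<in> S \<Longrightarrow> determinant (b l) (X l) (Y l) \<noteq> 0"
  shows "param_smooth n S (\<lambda>l z. speed_rate (b l) (X l) (Y l))"
  unfolding speed_rate_def
  by (intro param_smooth_divide param_smooth_diff param_smooth_mult param_smooth_add param_smooth_const
      param_smooth_freeze[OF param_smooth_weight] param_smooth_freeze[OF param_smooth_bend]
      param_smooth_slope_mean param_smooth_bend param_smooth_weight Y param_smooth_determinant assms)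

lemma param_smooth_offset_rate:
  assumes "\<And>l. l \<in> S \<Longrightarrow> determinant (b l) (X l) (Y l) \<noteq> 0"
  shows "param_smooth n S (\<lambda>l z. offset_rate (b l) (X l) (Y l))"
  unfolding offset_rate_def
  by (intro param_smooth_divide param_smooth_diff param_smooth_mult param_smooth_add param_smooth_const
      param_smooth_freeze[OF param_smooth_drift] param_smooth_freeze[OF param_smooth_bend]
      param_smooth_slope_mean param_smooth_bend param_smooth_drift param_smooth_weight Y param_smooth_determinant assms)

lemma param_smooth_profile_rate:
  assumes "\<And>l. l \<in> S \<Longrightarrow> determinant (b l) (X l) (Y l) \<noteq> 0"
    and "param_smooth n S (\<lambda>l z. k l)" "\<And>l. l \<in> S \<Longrightarrow> k l \<noteq> 0"
  shows "param_smooth n S (\<lambda>l z. profile_rate (b l) (X l) (Y l) (k l) z)"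
  unfolding profile_rate_def
proof (intro param_smooth_divide param_smooth_diff param_smooth_mult param_smooth_offset_rate
      param_smooth_speed_rate param_smooth_weight param_smooth_drift param_smooth_bend assms Y)
  show "k l * weight (b l) (X l) (Y l) z \<noteq> 0" if "l \<in> S" for l z
    using assms(3)[OF that] weight_pos[of "b l" "X l" "Y l" z] by simp
qed

end

section \<open>Lipschitz dependence on the parameter\<close>

lemma linear_ode_bound_from:
  assumes d: "primitive d (\<lambda>z. A z * d z + B z)" and A: "loc_bounded A" "\<And>z. \<bar>A z\<bar> \<le> L"
    and B: "\<And>z. \<bar>B z\<bar> \<le> \<beta>" and z: "z0 \<le> z" "z \<le> z0 + 1"
  shows "\<bar>d z\<bar> \<le> exp (2 * L) * (\<bar>d z0\<bar> + \<beta>)"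
proof -
  have "\<bar>d (z - z0 + z0)\<bar> \<le> exp (2 * L) * (\<bar>d (0 + z0)\<bar> + \<beta>)"
    by (rule linear_ode_bound[OF primitive_shift[OF d]
          primitive_loc_bounded[OF primitive_shift[OF primitive_signed_integral[OF A(1)]]]])
       (use A B z in auto)
  then show ?thesis by simp
qed

lemma weighted_integral_pos:
  fixes W B :: "real \<Rightarrow> real"
  assumes W: "continuous_on UNIV W" "\<And>z. W z > 0" and B: "\<And>z. B z \<ge> \<eta>" "\<eta> > 0"
    and i: "((\<lambda>z. W z * B z) has_integral I) {a..a+1}"
  shows "(I::real) > 0"
proof -
  have c: "continuous_on {a..a+1} W" using W(1) continuous_on_subset by blast
  obtain x where x: "x \<in> {a..a+1}" "\<And>y. y \<in> {a..a+1} \<Longrightarrow> W x \<le> W y"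
    using continuous_attains_inf[OF compact_Icc _ c] by (auto simp del: atLeastAtMost_iff)
  have "((\<lambda>z. W x * \<eta>) has_integral (W x * \<eta>)) {a..a+1}"
    using has_integral_const_real[of "W x * \<eta>" a "a + 1"] by simp
  then have "W x * \<eta> \<le> I"
  proof (rule has_integral_le[OF _ i])
    fix y assume "y \<in> {a..a+1}"
    then show "W x * \<eta> \<le> W y * B y" by (intro mult_mono x(2) B(1) less_imp_le[OF W(2)] less_imp_le[OF B(2)])
  qed
  moreover have "W x * \<eta> > 0" using W B by simp
  ultimately show ?thesis by linarith
qed

context medium
begin

definition prof :: "real \<Rightarrow> real \<Rightarrow> real" where
  "prof lam = (SOME s. profile lam (speed R lam) s)"

lemma speed_eq:
  assumes lam: "lam > 0" and p: "profile lam c s" shows "speed R lam = c"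
  unfolding speed_def
proof (rule the_equality)
  show "\<exists>h. speed_profile R lam c h" using profile_imp_speed_profile[OF lam p] by blast
  fix c' assume "\<exists>h. speed_profile R lam c' h"
  then obtain s' where "profile lam c' s'" using speed_profile_imp_profile[OF lam] by blast
  then show "c' = c" by (rule profile_speed_unique[OF lam p])
qed

lemma
  assumes lam: "lam > 0"
  shows profile_prof: "profile lam (speed R lam) (prof lam)"
    and speed_pos: "0 < speed R lam" and speed_le: "speed R lam \<le> M"
    and prof_bound: "\<bar>prof lam z\<bar> < sin_max"
proof -
  obtain c s where cs: "profile lam c s" "0 < c" "c \<le> M" "\<And>z. \<bar>s z\<bar> < sin_max"
    using profile_exists[OF lam] by blast
  have c: "speed R lam = c" by (rule speed_eq[OF lam cs(1)])
  show p: "profile lam (speed R lam) (prof lam)" unfolding prof_def c by (rule someI[of "profile lam c", OF cs(1)])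
  have "prof lam = s" using profile_unique[OF lam cs(1)] p unfolding c by blast
  then show "0 < speed R lam" "speed R lam \<le> M" "\<bar>prof lam z\<bar> < sin_max" using cs c by auto
qed

lemma prof_lt_1: "lam > 0 \<Longrightarrow> \<bar>prof lam z\<bar> < 1"
  by (rule profileD(2)[OF profile_prof])

text \<open>Both \<open>R\<close> and \<open>c cosine s\<close> lie between 0 and \<open>M\<close>.\<close>
lemma flux_bound:
  assumes "l > 0" shows "\<bar>(R z - speed R l * cosine (prof l z)) / l\<bar> \<le> M / l"
proof -
  have "0 \<le> speed R l * cosine (prof l z)" "speed R l * cosine (prof l z) \<le> M * 1"
    using speed_pos[OF assms] speed_le[OF assms] cosine_pos[OF prof_lt_1[OF assms], of z] cosine_le_1[of "prof l z"]
      M_pos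
    by (auto intro!: mult_mono simp del: mult_1_right)
  then have "\<bar>R z - speed R l * cosine (prof l z)\<bar> \<le> M" using R_ge[of z] R_le[of z] m_pos by simp
  then show ?thesis using assms by (simp add: abs_divide divide_right_mono)
qed

text \<open>If the speeds differed by more, the term \<open>(c1 - c0) cosine s1\<close> would dominate in the balance at a
  crossing and give the integrand a sign. The bound for the profiles follows from the linear equation for
  their difference, starting at the crossing.\<close>
lemma
  assumes l0: "l0 > 0" and l1: "l1 > 0"
  shows speed_lipschitz: "\<bar>speed R l1 - speed R l0\<bar> \<le> M / (l1 * cos_min) * \<bar>l1 - l0\<bar>" (is "\<bar>?dc\<bar> \<le> _")
    and prof_lipschitz: "\<bar>prof l1 z - prof l0 z\<bar>
      \<le> exp (2 * (M / l0 * (1 / cos_min))) * ((M / l1 + M / (l1 * cos_min)) / l0) * \<bar>l1 - l0\<bar>"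
proof -
  note p0 = profile_prof[OF l0] and p1 = profile_prof[OF l1]
  obtain z0 where z0: "prof l1 z0 = prof l0 z0" by (rule profiles_cross[OF p0 p1])
  let ?q = "\<lambda>z. cosine (prof l1 z)"
  let ?g = "\<lambda>z. (R z - speed R l1 * ?q z) / l1"
  let ?A = "\<lambda>z. speed R l0 / l0 * secant (prof l0 z) (prof l1 z)"
  let ?B = "\<lambda>z. - ((l1 - l0) * ?g z + ?dc * ?q z) / l0"
  let ?W = "\<lambda>z. exp (- signed_integral ?A z)"
  have A: "loc_bounded ?A"
    by (intro loc_bounded_cmult loc_bounded_continuous continuous_profile_secant[OF p0 p1])
  have W: "continuous_on UNIV ?W"
    by (intro continuous_intros primitive_continuous[OF primitive_signed_integral[OF A]])
  note bal = profile_crossing_balance[OF l0 l1 p0 p1 z0]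
  have g: "\<bar>(l1 - l0) * ?g z\<bar> \<le> M / l1 * \<bar>l1 - l0\<bar>" for z
    using mult_left_mono[OF flux_bound[OF l1, of z], of "\<bar>l1 - l0\<bar>"] by (simp add: abs_mult mult.commute)
  have q: "cos_min \<le> ?q z" "?q z \<le> 1" for z
    using cosine_ge_cos_min[OF less_imp_le[OF prof_bound[OF l1]]] cosine_le_1 by auto
  show dc: "\<bar>?dc\<bar> \<le> M / (l1 * cos_min) * \<bar>l1 - l0\<bar>"
  proof (rule ccontr)
    assume "\<not> ?thesis"
    then have gt: "\<bar>?dc\<bar> * cos_min > M / l1 * \<bar>l1 - l0\<bar>"
      using cos_min(1) l1 by (simp add: field_simps not_le)
    define \<eta> where "\<eta> = (\<bar>?dc\<bar> * cos_min - M / l1 * \<bar>l1 - l0\<bar>) / l0"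
    have \<eta>: "\<eta> > 0" using gt l0 by (simp add: \<eta>_def)
    have comb: "x - K \<le> u + y" if "x \<le> y" "\<bar>u\<bar> \<le> K" for x y u K :: real using that by linarith
    have dq: "\<bar>?dc\<bar> * cos_min \<le> \<bar>?dc\<bar> * ?q z" for z using q(1)[of z] by (intro mult_left_mono) auto
    show False
    proof (cases "?dc > 0")
      case True
      have "((\<lambda>z. ?W z * - ?B z) has_integral - 0) {z0..z0+1}"
        using has_integral_neg[OF bal] by simp
      then have "- 0 > (0::real)"
      proof (rule weighted_integral_pos[OF W _ _ \<eta>, rotated 2])
        show "- ?B z \<ge> \<eta>" for z
        proof -
          have ad: "\<bar>?dc\<bar> = ?dc" using True by simp
          have "\<bar>?dc\<bar> * cos_min - M / l1 * \<bar>l1 - l0\<bar> \<le> (l1 - l0) * ?g z + ?dc * ?q z"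
            using comb[OF dq[of z] g[of z]] unfolding ad .
          then have "(\<bar>?dc\<bar> * cos_min - M / l1 * \<bar>l1 - l0\<bar>) / l0 \<le> ((l1 - l0) * ?g z + ?dc * ?q z) / l0"
            using l0 by (intro divide_right_mono) simp_all
          then show ?thesis by (simp only: \<eta>_def minus_divide_left minus_minus)
        qed
      qed auto
      then show False by simp
    next
      case False
      have "(0::real) > 0"
      proof (rule weighted_integral_pos[OF W _ _ \<eta> bal])
        show "?B z \<ge> \<eta>" for z
        proof -
          have ad: "\<bar>?dc\<bar> = - ?dc" using False by simp
          have "\<bar>?dc\<bar> * cos_min - M / l1 * \<bar>l1 - l0\<bar> \<le> - ((l1 - l0) * ?g z + ?dc * ?q z)"
            using comb[OF dq[of z] g[of z, folded abs_minus_cancel[of "(l1 - l0) * ?g z"]]]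
            unfolding ad minus_mult_left[symmetric] minus_add_distrib .
          then have "(\<bar>?dc\<bar> * cos_min - M / l1 * \<bar>l1 - l0\<bar>) / l0 \<le> - ((l1 - l0) * ?g z + ?dc * ?q z) / l0"
            using l0 by (intro divide_right_mono) simp_all
          then show ?thesis by (simp add: \<eta>_def)
        qed
      qed auto
      then show False by simp
    qed
  qed
  define \<beta> where "\<beta> = (M / l1 + M / (l1 * cos_min)) / l0 * \<bar>l1 - l0\<bar>"
  have B: "\<bar>?B x\<bar> \<le> \<beta>" for x
  proof -
    have dq: "\<bar>?dc * ?q x\<bar> \<le> \<bar>?dc\<bar> * 1"
      unfolding abs_mult using q[of x] cos_min by (intro mult_left_mono) auto
    have tri: "\<bar>u + v\<bar> \<le> K + L" if "\<bar>u\<bar> \<le> K" "\<bar>v\<bar> \<le> k * 1" "k \<le> L" for u v k K L :: real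
      using that by linarith
    have "\<bar>(l1 - l0) * ?g x + ?dc * ?q x\<bar> \<le> M / l1 * \<bar>l1 - l0\<bar> + M / (l1 * cos_min) * \<bar>l1 - l0\<bar>"
      by (rule tri[OF g dq dc])
    then have "\<bar>?B x\<bar> \<le> (M / l1 * \<bar>l1 - l0\<bar> + M / (l1 * cos_min) * \<bar>l1 - l0\<bar>) / l0"
      using l0 by (simp add: abs_divide divide_right_mono)
    also have "\<dots> = \<beta>" by (simp add: \<beta>_def add_divide_distrib distrib_right)
    finally show ?thesis .
  qed
  have Ab: "\<bar>?A x\<bar> \<le> M / l0 * (1 / cos_min)" for x
    unfolding abs_mult
    by (intro mult_mono secant_bound less_imp_le[OF prof_bound] l0 l1)
       (use speed_pos[OF l0] speed_le[OF l0] l0 M_pos in \<open>auto simp: abs_divide divide_right_mono\<close>)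
  have main: "\<bar>prof l1 z - prof l0 z\<bar> \<le> exp (2 * (M / l0 * (1 / cos_min))) * (\<bar>prof l1 z0 - prof l0 z0\<bar> + \<beta>)"
    if "z0 \<le> z" "z \<le> z0 + 1" for z
    by (rule linear_ode_bound_from[OF profile_difference[OF l0 l1 p0 p1] A Ab B that])
  obtain y where y: "y \<in> {z0..z0+1}" "prof l1 z - prof l0 z = prof l1 y - prof l0 y"
    using periodic_representative[where f="\<lambda>z. prof l1 z - prof l0 z" and a=z0 and z=z]
      profileD(3)[OF p0] profileD(3)[OF p1] by auto
  show "\<bar>prof l1 z - prof l0 z\<bar>
      \<le> exp (2 * (M / l0 * (1 / cos_min))) * ((M / l1 + M / (l1 * cos_min)) / l0) * \<bar>l1 - l0\<bar>"
    using main[of y] y z0 by (simp add: \<beta>_def mult.assoc)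
qed

lemma lipschitz_tendsto:
  assumes l0: "l0 > 0"
  shows "(speed R \<longlongrightarrow> speed R l0) (at l0)"
    and "\<And>e. e > 0 \<Longrightarrow> eventually (\<lambda>l. \<forall>z. \<bar>prof l z - prof l0 z\<bar> < e) (at l0)"
proof -
  have pos: "eventually (\<lambda>l. l > 0) (at l0)"
    using eventually_at_topological l0 by (metis open_greaterThan greaterThan_iff)
  show "(speed R \<longlongrightarrow> speed R l0) (at l0)"
  proof (rule LIM_zero_cancel, rule Lim_null_comparison)
    show "\<forall>\<^sub>F l in at l0. norm (speed R l - speed R l0) \<le> M / (l * cos_min) * \<bar>l - l0\<bar>"
      using pos by eventually_elim (simp add: speed_lipschitz[OF l0, simplified])
    have "((\<lambda>l. M / (l * cos_min) * \<bar>l - l0\<bar>) \<longlongrightarrow> M / (l0 * cos_min) * \<bar>l0 - l0\<bar>) (at l0)"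
      using l0 cos_min by (intro tendsto_intros) auto
    then show "((\<lambda>l. M / (l * cos_min) * \<bar>l - l0\<bar>) \<longlongrightarrow> 0) (at l0)" by simp
  qed
  fix e :: real assume e: "e > 0"
  let ?C = "\<lambda>l. exp (2 * (M / l0 * (1 / cos_min))) * ((M / l + M / (l * cos_min)) / l0) * \<bar>l - l0\<bar>"
  have "(?C \<longlongrightarrow> ?C l0) (at l0)" using l0 cos_min by (intro tendsto_intros) auto
  then have "eventually (\<lambda>l. ?C l < e) (at l0)" using e by (intro order_tendstoD(2)) auto
  then show "eventually (\<lambda>l. \<forall>z. \<bar>prof l z - prof l0 z\<bar> < e) (at l0)"
    using pos
  proof eventually_elim
    case (elim l)
    then show ?case using le_less_trans[OF prof_lipschitz[OF l0 elim(2)] elim(1)] by blast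
  qed
qed

lemma param_continuous_speed: "param_smooth 0 {0<..} (\<lambda>l z. speed R l)"
proof -
  have "continuous_on {0<..} (speed R)"
    using lipschitz_tendsto(1) by (intro continuous_at_imp_continuous_on) (auto simp: isCont_def)
  from continuous_on_compose2[OF this continuous_on_fst[OF continuous_on_id], of "{0<..} \<times> UNIV"]
  show ?thesis by auto
qed

text \<open>The estimate in the parameter is uniform in \<open>z\<close>, so it combines with continuity in \<open>z\<close> at a fixed
  parameter.\<close>
lemma param_continuous_prof: "param_smooth 0 {0<..} prof"
  unfolding param_smooth.simps continuous_on_iff
proof (intro ballI allI impI)
  fix p :: "real \<times> real" and e :: real assume p: "p \<in> {0<..} \<times> UNIV" and e: "e > 0"
  have l0: "fst p > 0" using p by auto
  obtain d1 where d1: "d1 > 0" "\<And>l z. l \<noteq> fst p \<Longrightarrow> dist l (fst p) < d1 \<Longrightarrow> \<bar>prof l z - prof (fst p) z\<bar> < e / 2"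
    using lipschitz_tendsto(2)[OF l0, of "e/2"] e unfolding eventually_at by auto
  have "isCont (prof (fst p)) (snd p)"
    using profileD(5)[OF profile_prof[OF l0]] by (simp add: continuous_on_eq_continuous_at)
  then obtain d2 where d2: "d2 > 0" "\<And>z. dist z (snd p) < d2 \<Longrightarrow> dist (prof (fst p) z) (prof (fst p) (snd p)) < e / 2"
    unfolding continuous_at_eps_delta using e half_gt_zero by metis
  show "\<exists>d>0. \<forall>x'\<in>{0<..} \<times> UNIV. dist x' p < d \<longrightarrow> dist (prof (fst x') (snd x')) (prof (fst p) (snd p)) < e"
  proof (intro exI[of _ "min d1 d2"] conjI ballI impI)
    fix x' assume "dist x' p < min d1 d2"
    then have "dist (fst x') (fst p) < d1" "dist (snd x') (snd p) < d2"
      using dist_fst_le[of x' p] dist_snd_le[of x' p] by auto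
    then have "\<bar>prof (fst x') (snd x') - prof (fst p) (snd x')\<bar> < e / 2"
      "dist (prof (fst p) (snd x')) (prof (fst p) (snd p)) < e / 2"
      using d1 d2 e by (cases "fst x' = fst p"; auto)+
    then show "dist (prof (fst x') (snd x')) (prof (fst p) (snd p)) < e"
      unfolding dist_real_def by linarith
  qed (use d1 d2 in auto)
qed

end

section \<open>Differentiation in the parameter\<close>

lemma signed_integral_1_pos:
  assumes "continuous_on UNIV f" "\<And>t. f t > 0" shows "signed_integral f 1 > 0"
proof -
  have "((\<lambda>z. f z * 1) has_integral signed_integral f 1) {0..0+1}"
    using primitive_has_integral[OF primitive_signed_integral[OF loc_bounded_continuous[OF assms(1)]], of 0 1] by simp
  then show ?thesis by (rule weighted_integral_pos[OF assms, rotated 2]) auto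
qed

lemma signed_integral_1: "signed_integral f 1 = integral {0..1} f"
  by (simp add: signed_integral_def)

context
  fixes b :: real and x y :: "real \<Rightarrow> real"
  assumes x: "continuous_on UNIV x" "\<And>z. \<bar>x z\<bar> < 1" and y: "continuous_on UNIV y" "\<And>z. \<bar>y z\<bar> < 1"
begin

lemma continuous_operators:
  shows "continuous_on UNIV (weight b x y)" "continuous_on UNIV (drift b x y)" "continuous_on UNIV (bend b x y)"
    "continuous_on UNIV (\<lambda>z. slope_quotient (x z) (y z) / weight b x y z)"
    "continuous_on UNIV (\<lambda>z. b * secant (x z) (y z))"
proof -
  have p: "param_smooth 0 UNIV (\<lambda>l z. b)" "param_smooth 0 UNIV (\<lambda>l. x)" "param_smooth 0 UNIV (\<lambda>l. y)"
    using param_smooth_const_param[OF x(1)] param_smooth_const_param[OF y(1)] param_smooth_const by blast+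
  note q = open_UNIV p(1) p(2) x(2) p(3) y(2)
  show "continuous_on UNIV (weight b x y)"
    by (rule param_smooth_slice[OF param_smooth_weight[OF q] UNIV_I])
  show "continuous_on UNIV (drift b x y)"
    by (rule param_smooth_slice[OF param_smooth_drift[OF q] UNIV_I])
  show "continuous_on UNIV (bend b x y)"
    by (rule param_smooth_slice[OF param_smooth_bend[OF q] UNIV_I])
  show "continuous_on UNIV (\<lambda>z. slope_quotient (x z) (y z) / weight b x y z)"
    by (rule param_smooth_slice[OF param_smooth_slope_density[OF q] UNIV_I])
  show "continuous_on UNIV (\<lambda>z. b * secant (x z) (y z))"
    by (rule param_smooth_slice[OF param_smooth_bsecant[OF q] UNIV_I])
qed

lemma primitive_weight: "primitive (weight b x y) (\<lambda>z. weight b x y z * - (b * secant (x z) (y z)))"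
proof -
  have 1: "primitive (\<lambda>z. - signed_integral (\<lambda>z. b * secant (x z) (y z)) z) (\<lambda>z. - (b * secant (x z) (y z)))"
    using primitive_cmult[OF primitive_signed_integral[OF loc_bounded_continuous[OF continuous_operators(5)]], of "-1"]
    by simp
  have "primitive (\<lambda>z. exp (- signed_integral (\<lambda>z. b * secant (x z) (y z)) z))
      (\<lambda>z. exp (- signed_integral (\<lambda>z. b * secant (x z) (y z)) z) * - (b * secant (x z) (y z)))"
    by (rule primitive_chain[OF 1, where U=UNIV and F=exp and F'=exp]) (auto intro!: derivative_eq_intros continuous_intros)
  then show ?thesis unfolding weight_def .
qed

lemma primitive_drift: "primitive (drift b x y) (\<lambda>z. weight b x y z * cosine (y z))"
proof -
  have "continuous_on UNIV (\<lambda>z. weight b x y z * cosine (y z))"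
    by (intro continuous_intros continuous_operators continuous_on_compose2[OF continuous_cosine[of UNIV] y(1)] subset_UNIV)
  from primitive_signed_integral[OF loc_bounded_continuous[OF this]] show ?thesis
    by (simp add: drift_def[abs_def])
qed

lemma primitive_bend: "primitive (bend b x y) (\<lambda>z. b * secant (x z) (y z) * (weight b x y z * y z))"
proof -
  have "continuous_on UNIV (\<lambda>z. b * secant (x z) (y z) * (weight b x y z * y z))"
    by (intro continuous_on_mult continuous_operators y(1))
  from primitive_signed_integral[OF loc_bounded_continuous[OF this]] show ?thesis
    by (simp add: bend_def[abs_def])
qed

lemma primitive_slope_mean:
  assumes "continuous_on UNIV f"
  shows "primitive (signed_integral (\<lambda>z. slope_quotient (x z) (y z) / weight b x y z * f z))
    (\<lambda>z. slope_quotient (x z) (y z) / weight b x y z * f z)"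
  by (intro primitive_signed_integral loc_bounded_continuous continuous_on_mult[OF continuous_operators(4) assms])

end

lemma cramer_two:
  fixes k d w a1 b1 e1 s t :: real
  assumes 1: "w * k - k = - d * s - t" and 2: "k * a1 - d * b1 - e1 = 0"
    and D: "- (w - 1) * b1 - s * a1 \<noteq> 0"
  shows "d = ((w - 1) * e1 + a1 * t) / (- (w - 1) * b1 - s * a1)"
    and "k = (t * b1 - s * e1) / (- (w - 1) * b1 - s * a1)"
proof -
  have t: "t = - d * s - (w - 1) * k" using 1 by (simp add: algebra_simps)
  have e: "e1 = k * a1 - d * b1" using 2 by simp
  have "d * (- (w - 1) * b1 - s * a1) = (w - 1) * e1 + a1 * t" unfolding t e by (simp add: algebra_simps)
  then show "d = ((w - 1) * e1 + a1 * t) / (- (w - 1) * b1 - s * a1)" using D by (simp add: nonzero_eq_divide_eq)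
  have "k * (- (w - 1) * b1 - s * a1) = t * b1 - s * e1" unfolding t e by (simp add: algebra_simps)
  then show "k = (t * b1 - s * e1) / (- (w - 1) * b1 - s * a1)" using D by (simp add: nonzero_eq_divide_eq)
qed

context medium
begin

text \<open>The two identities behind Cramer's rule. Exact formulas for difference quotients, rather than
  for derivatives, make differentiability a matter of continuity of the right-hand sides.\<close>
lemma
  assumes l0: "l0 > 0" and l1: "l1 > 0" and ne: "l1 \<noteq> l0"
    and det: "determinant (speed R l0 / l0) (prof l0) (prof l1) \<noteq> 0"
  shows speed_difference_quotient:
      "(speed R l1 - speed R l0) / (l1 - l0) = speed_rate (speed R l0 / l0) (prof l0) (prof l1)"
    and prof_difference_quotient:
      "(prof l1 z - prof l0 z) / (l1 - l0) = profile_rate (speed R l0 / l0) (prof l0) (prof l1) l0 z"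
proof -
  note p0 = profile_prof[OF l0] and p1 = profile_prof[OF l1]
  define x where "x = prof l0"
  define y where "y = prof l1"
  define b where "b = speed R l0 / l0"
  define dl where "dl = l1 - l0"
  define dc where "dc = speed R l1 - speed R l0"
  have dl: "dl \<noteq> 0" using ne by (simp add: dl_def)
  have x: "continuous_on UNIV x" "\<And>z. \<bar>x z\<bar> < 1" unfolding x_def using profileD[OF p0] by auto
  have y: "continuous_on UNIV y" "\<And>z. \<bar>y z\<bar> < 1" unfolding y_def using profileD[OF p1] by auto
  define W where "W = weight b x y"
  define g where "g = (\<lambda>z. (R z - speed R l1 * cosine (y z)) / l1)"
  have Wp: "W z > 0" for z by (simp add: W_def weight_pos)
  have Py: "primitive y g" using profileD(1)[OF p1] by (simp add: y_def g_def)
  have A: "loc_bounded (\<lambda>z. b * secant (x z) (y z))"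
    by (rule loc_bounded_continuous[OF continuous_operators(5)[OF x y]])
  have P1: "primitive (\<lambda>z. W z * (y z - x z)) (\<lambda>z. W z * (- (dl * g z + dc * cosine (y z)) / l0))"
    using linear_ode_integrating_factor[OF profile_difference[OF l0 l1 p0 p1] A[unfolded b_def x_def y_def]]
    unfolding W_def weight_def g_def dl_def dc_def b_def x_def y_def .
  have P2: "primitive (\<lambda>z. W z * y z) (\<lambda>z. W z * - (b * secant (x z) (y z)) * y z + W z * g z)"
    unfolding W_def by (rule primitive_mult[OF primitive_weight[OF x y] Py])
  \<comment> \<open>adding \<open>dl * W * y\<close> cancels the term with \<open>R\<close>, which enters through \<open>g = y'\<close>\<close>
  have "primitive (\<lambda>z. l0 * (W z * (y z - x z)) + dl * (W z * y z))
      (\<lambda>z. - dc * (W z * cosine (y z)) + - dl * (b * secant (x z) (y z) * (W z * y z)))"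
    by (rule primitive_cong[OF primitive_add[OF primitive_cmult[OF P1, of l0] primitive_cmult[OF P2, of dl]]])
       (use l0 in \<open>simp add: field_simps\<close>)
  moreover have "primitive (\<lambda>z. - dc * drift b x y z + - dl * bend b x y z)
      (\<lambda>z. - dc * (W z * cosine (y z)) + - dl * (b * secant (x z) (y z) * (W z * y z)))"
    unfolding W_def by (intro primitive_add primitive_cmult primitive_drift[OF x y] primitive_bend[OF x y])
  ultimately have "l0 * (W z * (y z - x z)) + dl * (W z * y z) - (- dc * drift b x y z + - dl * bend b x y z)
      = l0 * (W 0 * (y 0 - x 0)) + dl * (W 0 * y 0) - (- dc * drift b x y 0 + - dl * bend b x y 0)" for z
    by (rule primitive_unique)
  then have E0: "l0 * (W z * (y z - x z)) + dl * (W z * y z) - (- dc * drift b x y z + - dl * bend b x y z)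
      = l0 * (y 0 - x 0) + dl * y 0" for z
    by (simp add: W_def drift_def bend_def)
  define D where "D = (\<lambda>z. (y z - x z) / dl)"
  define d where "d = dc / dl"
  define k where "k = l0 * D 0 + y 0"
  have E: "l0 * (W z * D z) + W z * y z + d * drift b x y z + bend b x y z = k" for z
  proof -
    have D: "dl * D t = y t - x t" for t using dl by (simp add: D_def)
    have "dl * d = dc" using dl by (simp add: d_def)
    then have "dl * (l0 * (W z * D z) + W z * y z + d * drift b x y z + bend b x y z)
        = l0 * (W z * (dl * D z)) + dl * (W z * y z) + dc * drift b x y z + dl * bend b x y z"
      by (simp add: algebra_simps)
    also have "\<dots> = l0 * (dl * D 0) + dl * y 0" using E0[of z] unfolding D by simp
    also have "\<dots> = dl * k" by (simp add: k_def algebra_simps)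
    finally have "dl * (l0 * (W z * D z) + W z * y z + d * drift b x y z + bend b x y z) = dl * k" .
    then show ?thesis using dl by simp
  qed
  have per: "x 1 = x 0" "y 1 = y 0"
    using profileD(3)[OF p0, of 0] profileD(3)[OF p1, of 0] by (auto simp: x_def y_def)
  then have D1: "D 1 = D 0" by (simp add: D_def)
  have eq1: "W 1 * k - k = - d * drift b x y 1 - bend b x y 1"
    using E[of 1] unfolding k_def per D1 by (simp add: algebra_simps)
  let ?F = "\<lambda>z. slope_quotient (x z) (y z) / W z"
  let ?SI = "\<lambda>f. signed_integral (\<lambda>z. ?F z * f z)"
  have c: "continuous_on UNIV (drift b x y)" "continuous_on UNIV (\<lambda>z. W z * y z + bend b x y z)"
    unfolding W_def by (intro continuous_intros continuous_operators[OF x y] y(1))+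
  have "primitive (\<lambda>z. k * ?SI (\<lambda>z. 1) z - d * ?SI (drift b x y) z - ?SI (\<lambda>z. W z * y z + bend b x y z) z)
      (\<lambda>z. k * (?F z * 1) - d * (?F z * drift b x y z) - ?F z * (W z * y z + bend b x y z))"
    unfolding W_def
    by (intro primitive_diff primitive_cmult primitive_slope_mean[OF x y] continuous_on_const c[unfolded W_def])
  then have S1: "primitive (\<lambda>z. k * ?SI (\<lambda>z. 1) z - d * ?SI (drift b x y) z - ?SI (\<lambda>z. W z * y z + bend b x y z) z)
      (\<lambda>z. l0 / dl * (slope (y z) - slope (x z)))"
  proof (rule primitive_cong)
    fix z
    have "slope (y z) - slope (x z) = slope_quotient (x z) (y z) * (dl * D z)"
      using slope_diff[OF x(2) y(2), of z z] dl by (simp add: D_def)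
    then have "l0 / dl * (slope (y z) - slope (x z)) = ?F z * (l0 * (W z * D z))"
      using dl Wp[of z] by simp
    also have "l0 * (W z * D z) = k - d * drift b x y z - (W z * y z + bend b x y z)" using E[of z] by simp
    finally show "l0 / dl * (slope (y z) - slope (x z)) =
        k * (?F z * 1) - d * (?F z * drift b x y z) - ?F z * (W z * y z + bend b x y z)"
      by (simp only: right_diff_distrib mult_ac mult_1_right)
  qed
  have S2: "primitive (\<lambda>z. l0 / dl * (signed_integral (\<lambda>z. slope (y z)) z - signed_integral (\<lambda>z. slope (x z)) z))
      (\<lambda>z. l0 / dl * (slope (y z) - slope (x z)))"
    by (intro primitive_cmult primitive_diff primitive_signed_integral loc_bounded_continuous continuous_slope_compose x y)
  have "signed_integral (\<lambda>z. slope (y z)) 1 = 0" "signed_integral (\<lambda>z. slope (x z)) 1 = 0"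
    using profileD(4)[OF p0] profileD(4)[OF p1] by (simp_all add: signed_integral_1 x_def y_def)
  then have eq2: "k * slope_mean b x y (\<lambda>z. 1) - d * slope_mean b x y (drift b x y)
      - slope_mean b x y (\<lambda>z. W z * y z + bend b x y z) = 0"
    using primitive_unique[OF S1 S2, of 1 0] by (simp add: slope_mean_def W_def)
  have det': "- (W 1 - 1) * slope_mean b x y (drift b x y) - drift b x y 1 * slope_mean b x y (\<lambda>z. 1) \<noteq> 0"
    using det by (simp add: determinant_def W_def b_def x_def y_def)
  note cr = cramer_two[OF eq1 eq2 det']
  have dr: "d = speed_rate b x y"
    unfolding speed_rate_def determinant_def using cr(1) by (simp only: W_def)
  have kr: "k = offset_rate b x y"
    unfolding offset_rate_def determinant_def using cr(2) by (simp only: W_def)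
  show "(speed R l1 - speed R l0) / (l1 - l0) = speed_rate (speed R l0 / l0) (prof l0) (prof l1)"
    using dr by (simp add: d_def dc_def dl_def b_def x_def y_def)
  have "l0 * W z \<noteq> 0" using l0 Wp[of z] by simp
  moreover have "D z * (l0 * W z) = k - W z * y z - d * drift b x y z - bend b x y z"
    using E[of z] by (simp add: algebra_simps)
  ultimately have "D z = (k - W z * y z - d * drift b x y z - bend b x y z) / (l0 * W z)"
    by (rule nonzero_eq_divide_eq[THEN iffD2])
  then show "(prof l1 z - prof l0 z) / (l1 - l0) = profile_rate (speed R l0 / l0) (prof l0) (prof l1) l0 z"
    unfolding profile_rate_def dr kr by (simp only: D_def dl_def b_def x_def y_def W_def)
qed

text \<open>On the diagonal the weight is periodic because the slope has mean zero. So one entry of the system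
  vanishes and the determinant is a product of two nonzero integrals.\<close>
lemma
  assumes l: "l > 0"
  shows weight_diag_1: "weight (speed R l / l) (prof l) (prof l) 1 = 1"
    and drift_diag_pos: "drift (speed R l / l) (prof l) (prof l) 1 > 0"
    and slope_mean_diag_pos: "slope_mean (speed R l / l) (prof l) (prof l) (\<lambda>t. 1) > 0"
proof -
  note p = profileD[OF profile_prof[OF l]]
  note c = continuous_operators[OF p(5,2) p(5,2), of "speed R l / l"]
  have "integral {0..1} (\<lambda>z. speed R l / l * slope (prof l z)) = 0"
    using p(4) by simp
  then show "weight (speed R l / l) (prof l) (prof l) 1 = 1"
    by (simp add: weight_def signed_integral_1 secant_diag)
  show "drift (speed R l / l) (prof l) (prof l) 1 > 0"
    unfolding drift_def
    by (intro signed_integral_1_pos continuous_on_mult c p(6) mult_pos_pos weight_pos cosine_pos p(2))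
  have "signed_integral (\<lambda>t. slope_quotient (prof l t) (prof l t) / weight (speed R l / l) (prof l) (prof l) t * 1) 1 > 0"
  proof (rule signed_integral_1_pos)
    show "continuous_on UNIV (\<lambda>t. slope_quotient (prof l t) (prof l t) / weight (speed R l / l) (prof l) (prof l) t * 1)"
      using c(4) by simp
    show "slope_quotient (prof l t) (prof l t) / weight (speed R l / l) (prof l) (prof l) t * 1 > 0" for t
      using slope_quotient_diag_pos[OF p(2)] weight_pos by simp
  qed
  then show "slope_mean (speed R l / l) (prof l) (prof l) (\<lambda>t. 1) > 0" by (simp only: slope_mean_def)
qed

lemma determinant_diag:
  assumes "l > 0" shows "determinant (speed R l / l) (prof l) (prof l) \<noteq> 0"
  using weight_diag_1[OF assms] drift_diag_pos[OF assms] slope_mean_diag_pos[OF assms]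
  unfolding determinant_def by simp

lemma speed_rate_diag:
  assumes "l > 0"
  shows "speed_rate (speed R l / l) (prof l) (prof l) =
    - bend (speed R l / l) (prof l) (prof l) 1 / drift (speed R l / l) (prof l) (prof l) 1"
  using weight_diag_1[OF assms] drift_diag_pos[OF assms] slope_mean_diag_pos[OF assms]
  unfolding speed_rate_def determinant_def by (simp add: field_simps)

text \<open>The determinant is nonzero for parameters near \<open>l0\<close>, by continuity in the second profile.\<close>
lemma
  assumes l0: "l0 > 0"
  shows speed_derivative: "(speed R has_real_derivative speed_rate (speed R l0 / l0) (prof l0) (prof l0)) (at l0)"
    and prof_derivative: "((\<lambda>l. prof l z) has_real_derivative
      profile_rate (speed R l0 / l0) (prof l0) (prof l0) l0 z) (at l0)"
proof -
  define b where "b = speed R l0 / l0"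
  define x where "x = prof l0"
  have xc: "continuous_on UNIV x" unfolding x_def by (rule profileD(5)[OF profile_prof[OF l0]])
  have x1: "\<bar>x z\<bar> < 1" for z unfolding x_def by (rule prof_lt_1[OF l0])
  have q: "param_smooth 0 S (\<lambda>l z. b)" "param_smooth 0 S (\<lambda>l. x)" for S
    using param_smooth_const_param[OF xc] by auto
  have y1: "\<bar>prof l z\<bar> < 1" if "l \<in> {0<..}" for l z using that prof_lt_1 by simp
  \<comment> \<open>the parameters for which the formulas for the difference quotients hold\<close>
  define T where "T = {0<..} \<inter> (\<lambda>l. determinant b x (prof l)) -` (- {0})"
  have "continuous_on {0<..} (\<lambda>l. determinant b x (prof l))"
    using param_smooth_param_slice[OF param_smooth_determinant[OF open_greaterThan q(1) q(2) x1 param_continuous_prof y1]] .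
  then have T: "open T" unfolding T_def by (intro continuous_open_preimage) auto
  have l0T: "l0 \<in> T" using determinant_diag[OF l0] l0 by (simp add: T_def b_def x_def)
  have T0: "T \<subseteq> {0<..}" by (auto simp: T_def)
  have det: "determinant b x (prof l) \<noteq> 0" if "l \<in> T" for l using that by (simp add: T_def)
  have y1T: "\<bar>prof l z\<bar> < 1" if "l \<in> T" for l z using that T0 y1 by blast
  note P = T q(1) q(2) x1 param_smooth_subset[OF param_continuous_prof T0] y1T det
  have evT: "eventually (\<lambda>l. l \<in> T \<and> l \<noteq> l0) (at l0)"
    using eventually_at_topological T l0T by blast
  have "isCont (\<lambda>l. speed_rate b x (prof l)) l0"
    using param_smooth_param_slice[OF param_smooth_speed_rate[OF P]] l0T T
    by (simp add: continuous_on_eq_continuous_at)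
  then have "((\<lambda>l. speed_rate b x (prof l)) \<longlongrightarrow> speed_rate b x (prof l0)) (at l0)" by (simp add: isCont_def)
  moreover have "eventually (\<lambda>l. speed_rate b x (prof l) = (speed R l - speed R l0) / (l - l0)) (at l0)"
    using evT
  proof eventually_elim
    case (elim l)
    then show ?case
      using speed_difference_quotient[OF l0, of l] det[of l] T0 by (force simp: b_def x_def)
  qed
  ultimately show "(speed R has_real_derivative speed_rate (speed R l0 / l0) (prof l0) (prof l0)) (at l0)"
    unfolding has_field_derivative_iff b_def x_def by (rule Lim_transform_eventually)
  have "param_smooth 0 T (\<lambda>l z. profile_rate b x (prof l) l0 z)"
    by (rule param_smooth_profile_rate[OF P param_smooth_const]) (use l0 in simp_all)
  from param_smooth_param_slice[OF this]
  have "isCont (\<lambda>l. profile_rate b x (prof l) l0 z) l0"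
    using l0T T
    by (simp add: continuous_on_eq_continuous_at)
  then have "((\<lambda>l. profile_rate b x (prof l) l0 z) \<longlongrightarrow> profile_rate b x (prof l0) l0 z) (at l0)" by (simp add: isCont_def)
  moreover have "eventually (\<lambda>l. profile_rate b x (prof l) l0 z = (prof l z - prof l0 z) / (l - l0)) (at l0)"
    using evT
  proof eventually_elim
    case (elim l)
    then show ?case
      using prof_difference_quotient[OF l0, of l z] det[of l] T0 by (force simp: b_def x_def)
  qed
  ultimately show "((\<lambda>l. prof l z) has_real_derivative profile_rate (speed R l0 / l0) (prof l0) (prof l0) l0 z) (at l0)"
    unfolding has_field_derivative_iff b_def x_def by (rule Lim_transform_eventually)
qed

text \<open>The derivatives are smooth expressions in the parameter, the speed and the profile, which is all the
  induction needs.\<close>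
lemma param_smooth_speed_prof:
  "param_smooth n {0<..} (\<lambda>l z. speed R l) \<and> param_smooth n {0<..} prof"
proof (induction n)
  case 0
  show ?case using param_continuous_speed param_continuous_prof by blast
next
  case (Suc n)
  have b: "param_smooth n {0<..} (\<lambda>l z. speed R l / l)"
    using Suc by (intro param_smooth_divide param_smooth_id) auto
  have p: "param_smooth n {0<..} prof" using Suc by blast
  have p1: "\<bar>prof l z\<bar> < 1" if "l \<in> {0<..}" for l z using that prof_lt_1 by simp
  have det: "determinant (speed R l / l) (prof l) (prof l) \<noteq> 0" if "l \<in> {0<..}" for l
    using determinant_diag that by simp
  note P = open_greaterThan[of 0] b p p1 p p1 det
  have "param_smooth (Suc n) {0<..} (\<lambda>l z. speed R l)"
    by (rule param_smooth_SucI[OF conjunct1[OF Suc] param_smooth_speed_rate[OF P]])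
       (assumption | (rule speed_derivative, simp))+
  moreover have "param_smooth (Suc n) {0<..} prof"
    by (rule param_smooth_SucI[OF conjunct2[OF Suc] param_smooth_profile_rate[OF P param_smooth_id]])
       (auto intro: prof_derivative)
  ultimately show ?case by blast
qed

section \<open>Monotonicity and limits of the speed\<close>

lemma smooth_on_speed: "smooth_on {0<..} (speed R)"
  using param_smooth_speed_prof by (intro param_smooth_imp_smooth_on) auto

text \<open>The integrand is \<open>c / l\<close> times the weight times \<open>s\<^sup>2 / cosine s\<close>.\<close>
lemma bend_diag:
  assumes l: "l > 0"
  shows "bend (speed R l / l) (prof l) (prof l) 1 \<ge> 0"
    and "bend (speed R l / l) (prof l) (prof l) 1 = 0 \<Longrightarrow> prof l z = 0"
proof -
  note p = profileD[OF profile_prof[OF l]]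
  let ?W = "weight (speed R l / l) (prof l) (prof l)"
  let ?f = "\<lambda>t. speed R l / l * secant (prof l t) (prof l t) * (?W t * prof l t)"
  have f: "?f t = speed R l / l * ?W t / cosine (prof l t) * (prof l t)\<^sup>2" for t
    by (simp add: secant_diag slope_def power2_eq_square)
  have pos: "speed R l / l * ?W t / cosine (prof l t) > 0" for t
    using speed_pos[OF l] l weight_pos cosine_pos[OF p(2)] by simp
  have nn: "?f t \<ge> 0" for t unfolding f by (rule mult_nonneg_nonneg[OF less_imp_le[OF pos] zero_le_power2])
  have P: "primitive (bend (speed R l / l) (prof l) (prof l)) ?f" by (rule primitive_bend[OF p(5,2) p(5,2)])
  have i: "(?f has_integral bend (speed R l / l) (prof l) (prof l) 1) {0..1}"
    using primitive_has_integral[OF P, of 0 1] by (simp add: bend_def)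
  show "bend (speed R l / l) (prof l) (prof l) 1 \<ge> 0"
    by (rule has_integral_nonneg[OF i]) (rule nn)
  assume 0: "bend (speed R l / l) (prof l) (prof l) 1 = 0"
  have c: "continuous_on {0..1} ?f"
    by (rule continuous_on_subset[OF _ subset_UNIV])
       (intro continuous_on_mult continuous_operators[OF p(5,2) p(5,2)] p(5))
  obtain t where t: "t \<in> {0..1}" "prof l z = prof l t"
    using periodic_representative[where f="prof l" and a=0 and z=z] p(3) by auto
  have "?f t = 0"
    using has_integral_0_cbox_imp_0[of 0 1 ?f t] c nn i t unfolding 0 by simp
  then have "speed R l / l * ?W t / cosine (prof l t) * (prof l t)\<^sup>2 = 0" unfolding f .
  then have "(prof l t)\<^sup>2 = 0" using pos[of t] by (metis less_irrefl mult_eq_0_iff)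
  then show "prof l z = 0" using t by simp
qed

lemma speed_derivative_nonpos:
  assumes "l > 0" shows "speed_rate (speed R l / l) (prof l) (prof l) \<le> 0"
  using bend_diag(1)[OF assms] drift_diag_pos[OF assms] unfolding speed_rate_diag[OF assms]
  by (simp add: divide_nonpos_pos)

text \<open>If the derivative vanished, the profile would be zero and the equation would read \<open>R = c\<close>.\<close>
lemma speed_derivative_neg:
  assumes l: "l > 0" and R: "\<nexists>k. AE z in lebesgue. R z = k"
  shows "speed_rate (speed R l / l) (prof l) (prof l) < 0"
proof -
  have "bend (speed R l / l) (prof l) (prof l) 1 \<noteq> 0"
  proof
    assume 0: "bend (speed R l / l) (prof l) (prof l) 1 = 0"
    have z: "prof l z = 0" for z by (rule bend_diag(2)[OF l 0])
    have P: "primitive (prof l) (\<lambda>z. (R z - speed R l) / l)"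
      using profileD(1)[OF profile_prof[OF l]] by (simp add: z)
    have "integral {a..b} (\<lambda>z. (R z - speed R l) / l) = 0" if "a \<le> b" for a b
      using primitive_integral[OF P that] by (simp add: z)
    then have "AE z in lebesgue. (R z - speed R l) / l = 0"
      by (rule AE_eq_zero_of_interval_integrals[OF primitive_loc_bounded[OF P]])
    then have "AE z in lebesgue. R z = speed R l" using l by simp
    then show False using R by blast
  qed
  then show ?thesis
    using bend_diag(1)[OF l] drift_diag_pos[OF l] unfolding speed_rate_diag[OF l] by (simp add: divide_neg_pos)
qed

lemma antimono_speed: "antimono_on {0<..} (speed R)"
proof (rule monotone_onI)
  fix l l' :: real assume l: "l \<in> {0<..}" "l \<le> l'"
  show "speed R l \<ge> speed R l'"
  proof (rule DERIV_nonpos_imp_nonincreasing[OF l(2)])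
    fix t assume "l \<le> t" "t \<le> l'"
    then have "t > 0" using l by simp
    then show "\<exists>d. (speed R has_real_derivative d) (at t) \<and> d \<le> 0"
      using speed_derivative speed_derivative_nonpos by blast
  qed
qed

text \<open>On some interval the integral of \<open>R - K\<close> is positive. If \<open>c < K\<close>, the profile would rise by more than
  this integral divided by \<open>l\<close>, but it can rise by at most 2.\<close>
lemma eventually_speed_ge:
  assumes K: "\<not> (AE z in lebesgue. R z \<le> K)"
  shows "eventually (\<lambda>l. speed R l \<ge> K) (at_right 0)"
proof -
  have lb: "loc_bounded (\<lambda>z. R z - K)" by (intro loc_bounded_diff loc_bounded_R loc_bounded_const)
  have "\<exists>a b. a \<le> b \<and> integral {a..b} (\<lambda>z. R z - K) > 0"
  proof (rule ccontr)
    assume "\<not> ?thesis"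
    then have "AE z in lebesgue. R z - K \<le> 0"
      by (intro AE_nonpos_of_interval_integrals lb) (auto simp: not_less)
    then show False using K by simp
  qed
  then obtain a b where ab: "a \<le> b" "integral {a..b} (\<lambda>z. R z - K) > 0" by blast
  define \<kappa> where "\<kappa> = integral {a..b} (\<lambda>z. R z - K)"
  have "speed R l \<ge> K" if l: "0 < l" "l < \<kappa> / 2" for l
  proof (rule ccontr)
    assume n: "\<not> ?thesis"
    note p = profileD[OF profile_prof[OF l(1)]]
    have "l * ((signed_integral (\<lambda>z. R z - K) b) / l - signed_integral (\<lambda>z. R z - K) a / l) \<le> l * (prof l b - prof l a)"
    proof (intro mult_left_mono primitive_mono[OF _ p(1) ab(1)])
      show "primitive (\<lambda>z. signed_integral (\<lambda>z. R z - K) z / l) (\<lambda>z. (R z - K) / l)"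
        using primitive_cmult[OF primitive_signed_integral[OF lb], of "1/l"] by simp
      show "(R z - K) / l \<le> (R z - speed R l * cosine (prof l z)) / l" for z
      proof -
        have "speed R l * cosine (prof l z) \<le> speed R l * 1"
          using speed_pos[OF l(1)] cosine_le_1 by (intro mult_left_mono) auto
        then show ?thesis using n l(1) by (intro divide_right_mono) auto
      qed
    qed (use l in auto)
    also have "l * ((signed_integral (\<lambda>z. R z - K) b) / l - signed_integral (\<lambda>z. R z - K) a / l) = \<kappa>"
      using primitive_integral[OF primitive_signed_integral[OF lb] ab(1)] l by (simp add: \<kappa>_def right_diff_distrib)
    finally have "\<kappa> \<le> l * (prof l b - prof l a)" .
    also have "\<dots> \<le> l * 2" using p(2)[of a] p(2)[of b] l by (intro mult_left_mono) auto
    finally show False using l by simp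
  qed
  moreover have "eventually (\<lambda>l::real. 0 < l \<and> l < \<kappa> / 2) (at_right 0)"
    using eventually_at_right_real[of 0 "\<kappa> / 2"] ab by (simp add: \<kappa>_def)
  ultimately show ?thesis by (auto elim: eventually_mono)
qed

lemma speed_tendsto_at_right_0:
  assumes least: "\<And>K. K < M \<Longrightarrow> \<not> (AE z in lebesgue. R z \<le> K)"
  shows "(speed R \<longlongrightarrow> M) (at_right 0)"
proof (rule order_tendstoI)
  fix a assume "a < M"
  then have "eventually (\<lambda>l. speed R l \<ge> (a + M) / 2) (at_right 0)" by (intro eventually_speed_ge least) simp
  then show "eventually (\<lambda>l. speed R l > a) (at_right 0)"
    by (rule eventually_mono) (use \<open>a < M\<close> in auto)
next
  fix a assume a: "M < a"
  have "eventually (\<lambda>l::real. 0 < l) (at_right 0)" by (simp add: eventually_at_right_less)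
  then show "eventually (\<lambda>l. speed R l < a) (at_right 0)"
    by eventually_elim (use speed_le a in force)
qed

text \<open>The profile has a zero and derivative at most \<open>M / l\<close>, so \<open>1 - (M / l)\<^sup>2 \<le> cosine s \<le> 1\<close>, while
  \<open>\<integral> R = c \<integral> cosine s\<close>.\<close>
lemma speed_deviation:
  assumes l: "l > 0"
  shows "\<bar>speed R l - integral {0..1} R\<bar> \<le> M * (M / l)\<^sup>2"
proof -
  note p = profileD[OF profile_prof[OF l]]
  let ?s = "prof l"
  let ?c = "speed R l"
  obtain z0 where z0: "z0 \<in> {0..1}" "?s z0 = 0"
    using equal_mean_slope_cross[OF continuous_on_const[of UNIV 0] _ p(5,2)] p(4) by (auto simp: slope_def)
  have s: "\<bar>?s z\<bar> \<le> M / l" if "z \<in> {0..1}" for z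
  proof -
    have "\<bar>?s z\<bar> \<le> M / l * \<bar>z - z0\<bar>"
      using primitive_abs_le[OF p(1), of z0 z "M / l"] primitive_abs_le[OF p(1), of z z0 "M / l"] flux_bound[OF l] z0
      by (cases "z0 \<le> z") auto
    also have "\<dots> \<le> M / l * 1" using that z0 M_pos l by (intro mult_left_mono) auto
    finally show ?thesis by simp
  qed
  have ci: "(\<lambda>z. cosine (?s z)) integrable_on {0..1}"
    by (intro loc_bounded_integrable loc_bounded_continuous p(6))
  have "primitive (\<lambda>z. l * ?s z) (\<lambda>z. R z - ?c * cosine (?s z))"
    by (rule primitive_cong[OF primitive_cmult[OF p(1), of l]]) (use l in simp)
  from primitive_integral[OF this, of 0 1] have "integral {0..1} (\<lambda>z. R z - ?c * cosine (?s z)) = 0"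
    using p(3)[of 0] by simp
  moreover have "integral {0..1} (\<lambda>z. R z - ?c * cosine (?s z)) = integral {0..1} R - integral {0..1} (\<lambda>z. ?c * cosine (?s z))"
    by (intro Henstock_Kurzweil_Integration.integral_diff loc_bounded_integrable loc_bounded_R
        loc_bounded_cmult loc_bounded_continuous p(6))
  ultimately have eq: "integral {0..1} R = ?c * integral {0..1} (\<lambda>z. cosine (?s z))" by simp
  have up: "integral {0..1} (\<lambda>z. cosine (?s z)) \<le> 1"
    using integral_le[OF ci integrable_const_ivl[of 1 0 1]] cosine_le_1 by simp
  have "integral {0..1} (\<lambda>z::real. 1 - (M / l)\<^sup>2) \<le> integral {0..1} (\<lambda>z. cosine (?s z))"
  proof (rule integral_le[OF integrable_const_ivl ci])
    fix z :: real assume z: "z \<in> {0..1}"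
    have "(?s z)\<^sup>2 \<le> (M / l)\<^sup>2" using power_mono[OF s[OF z] abs_ge_zero, of 2] by simp
    moreover have "1 - (?s z)\<^sup>2 \<le> cosine (?s z)"
    proof -
      have "cosine (?s z) * cosine (?s z) \<le> 1 * cosine (?s z)"
        using cosine_pos[OF p(2)] cosine_le_1 by (intro mult_right_mono) (auto simp: less_imp_le)
      then show ?thesis using cosine_square[OF p(2), of z] by (simp add: power2_eq_square)
    qed
    ultimately show "1 - (M / l)\<^sup>2 \<le> cosine (?s z)" by simp
  qed
  then have lo: "1 - (M / l)\<^sup>2 \<le> integral {0..1} (\<lambda>z. cosine (?s z))" by simp
  have "?c - integral {0..1} R = ?c * (1 - integral {0..1} (\<lambda>z. cosine (?s z)))"
    unfolding eq by (simp add: right_diff_distrib)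
  then have "\<bar>?c - integral {0..1} R\<bar> = ?c * \<bar>1 - integral {0..1} (\<lambda>z. cosine (?s z))\<bar>"
    using speed_pos[OF l] by (simp add: abs_mult)
  also have "\<dots> \<le> M * (M / l)\<^sup>2"
    using speed_pos[OF l] speed_le[OF l] up lo M_pos by (intro mult_mono) auto
  finally show ?thesis .
qed

lemma speed_tendsto_at_top: "(speed R \<longlongrightarrow> integral {0..1} R) at_top"
proof (rule LIM_zero_cancel, rule Lim_null_comparison)
  show "\<forall>\<^sub>F l in at_top. norm (speed R l - integral {0..1} R) \<le> M * (M / l)\<^sup>2"
    using eventually_gt_at_top[of 0] by eventually_elim (simp add: speed_deviation)
  have "((\<lambda>l. M / l) \<longlongrightarrow> 0) at_top" by (intro tendsto_divide_0[OF tendsto_const] filterlim_at_top_imp_at_infinity filterlim_ident)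
  then have "((\<lambda>l. M * (M / l)\<^sup>2) \<longlongrightarrow> M * 0\<^sup>2) at_top" by (intro tendsto_intros)
  then show "((\<lambda>l. M * (M / l)\<^sup>2) \<longlongrightarrow> 0) at_top" by simp
qed

end

lemma speed_cong_AE:
  assumes "AE z in lebesgue. R z = R0 z" shows "speed R = speed R0"
proof -
  have "(AE z in lebesgue. - c + R z * sqrt (1 + (h z)\<^sup>2) = lam * (hz z / (1 + (h z)\<^sup>2))) \<longleftrightarrow>
      (AE z in lebesgue. - c + R0 z * sqrt (1 + (h z)\<^sup>2) = lam * (hz z / (1 + (h z)\<^sup>2)))" for c h hz lam
    using assms by (intro eventually_cong[OF assms]) auto
  then show ?thesis by (intro ext) (simp add: speed_def speed_profile_def)
qed

text \<open>The points all of whose integer translates are good form a periodic set of full measure; the coefficient is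
  kept there and made constant elsewhere.\<close>
lemma medium_representative:
  assumes R: "R \<in> borel_measurable lebesgue" and per: "AE z in lebesgue. R (z + 1) = R z"
    and m: "0 < m" "AE z in lebesgue. m \<le> R z" and M: "AE z in lebesgue. R z \<le> M" and mM: "m \<le> M"
  obtains R0 where "medium R0 m M" "AE z in lebesgue. R z = R0 z"
proof -
  define good where "good = (\<lambda>z. R (z + 1) = R z \<and> m \<le> R z \<and> R z \<le> M)"
  define R0 where "R0 = (\<lambda>z. if \<forall>n::int. good (z + of_int n) then R z else m)"
  have g: "AE z in lebesgue. good z" using per m(2) M unfolding good_def by eventually_elim auto
  have "AE z in lebesgue. \<forall>n::int. good (z + of_int n)"
    unfolding AE_all_countable by (intro allI AE_lebesgue_translate g)
  then have eq: "AE z in lebesgue. R z = R0 z" by eventually_elim (simp add: R0_def)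
  have "medium R0 m M"
  proof
    show "R0 \<in> borel_measurable lebesgue" by (rule borel_measurable_AE[OF R eq])
    show "0 < m" by (rule m)
    show "m \<le> R0 z" "R0 z \<le> M" for z
      using mM by (auto simp: R0_def good_def dest: spec[of _ 0])
    show "R0 (z + 1) = R0 z" for z
    proof -
      have "(\<forall>n::int. good (z + 1 + of_int n)) \<longleftrightarrow> (\<forall>n::int. good (z + of_int n))"
      proof
        assume *: "\<forall>n::int. good (z + 1 + of_int n)"
        show "\<forall>n::int. good (z + of_int n)"
        proof
          fix n :: int show "good (z + of_int n)" using *[rule_format, of "n - 1"] by simp
        qed
      next
        assume *: "\<forall>n::int. good (z + of_int n)"
        show "\<forall>n::int. good (z + 1 + of_int n)"
        proof
          fix n :: int show "good (z + 1 + of_int n)" using *[rule_format, of "n + 1"] by (simp add: add_ac)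
        qed
      qed
      then show ?thesis by (auto simp: R0_def good_def dest: spec[of _ 0])
    qed
  qed
  then show ?thesis using eq that by blast
qed

theorem theorem9:
  fixes R :: "real \<Rightarrow> real"
  assumes "R \<in> L_infinity"
    and "AE z in lebesgue. R (z + 1) = R z"
    and "\<exists>m>0. AE z in lebesgue. m \<le> R z"
  shows "smooth_on {0<..} (speed R)
    \<and> antimono_on {0<..} (speed R)
    \<and> ((\<lambda>lam. ereal (speed R lam)) \<longlongrightarrow> esssup lebesgue (\<lambda>z. ereal (R z))) (at_right 0)
    \<and> (speed R \<longlongrightarrow> (LINT z:{0..1}|lebesgue. R z)) at_top
    \<and> ((\<nexists>k. AE z in lebesgue. R z = k) \<longrightarrow> (\<forall>lam>0. deriv (speed R) lam < 0))"
proof -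
  have Rm[measurable]: "R \<in> borel_measurable lebesgue" using assms(1) by (simp add: L_infinity_def)
  obtain K where K: "AE z in lebesgue. \<bar>R z\<bar> \<le> K" using assms(1) by (auto simp: L_infinity_def)
  obtain m where m: "0 < m" "AE z in lebesgue. m \<le> R z" using assms(3) by blast
  define E where "E = esssup lebesgue (\<lambda>z. ereal (R z))"
  have nz: "emeasure lebesgue (space (lebesgue :: real measure)) \<noteq> 0" by simp
  have "E \<le> ereal K" unfolding E_def
    by (rule esssup_I) (use K in \<open>auto elim!: eventually_mono\<close>)
  moreover have "ereal m \<le> E"
  proof -
    have "ereal m = esssup lebesgue (\<lambda>z::real. ereal m)" using esssup_const[OF nz] by metis
    also have "\<dots> \<le> E" unfolding E_def by (rule esssup_AE_mono) (use m(2) in auto)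
    finally show ?thesis .
  qed
  ultimately obtain M where M: "E = ereal M" by (cases E) auto
  have mM: "m \<le> M" using \<open>ereal m \<le> E\<close> M by simp
  have RM: "AE z in lebesgue. R z \<le> M"
    using esssup_AE[of "\<lambda>z. ereal (R z)" lebesgue] M by (simp add: E_def)
  have least: "\<not> (AE z in lebesgue. R z \<le> k)" if "k < M" for k
  proof
    assume "AE z in lebesgue. R z \<le> k"
    then have "E \<le> ereal k" unfolding E_def by (intro esssup_I) auto
    then show False using M that by simp
  qed
  obtain R0 where R0: "medium R0 m M" "AE z in lebesgue. R z = R0 z"
    by (rule medium_representative[OF Rm assms(2) m RM mM])
  interpret medium R0 m M by (rule R0(1))
  have sp: "speed R = speed R0" by (rule speed_cong_AE[OF R0(2)])
  have least0: "\<not> (AE z in lebesgue. R0 z \<le> k)" if "k < M" for k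
  proof
    assume "AE z in lebesgue. R0 z \<le> k"
    then have "AE z in lebesgue. R z \<le> k" using R0(2) by eventually_elim simp
    then show False using least[OF that] by blast
  qed
  have int: "(LINT z:{0..1}|lebesgue. R z) = integral {0..1} R0"
  proof -
    have "(LINT z:{0..1}|lebesgue. R z) = (LINT z:{0..1}|lebesgue. R0 z)"
      unfolding set_lebesgue_integral_def
    proof (rule integral_cong_AE)
      show "(\<lambda>x. indicator {0..1} x *\<^sub>R R x) \<in> borel_measurable lebesgue"
        "(\<lambda>x. indicator {0..1} x *\<^sub>R R0 x) \<in> borel_measurable lebesgue"
        by (intro borel_measurable_scaleR borel_measurable_indicator; simp)+
    qed (use R0(2) in auto)
    also have "\<dots> = integral {0..1} R0"
      by (rule set_lebesgue_integral_eq_integral(2)[OF loc_bounded_absolutely_integrable[OF loc_bounded_R]])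
    finally show ?thesis .
  qed
  have neg: "\<forall>lam>0. deriv (speed R0) lam < 0" if "\<nexists>k. AE z in lebesgue. R z = k"
  proof (intro allI impI)
    fix lam :: real assume lam: "lam > 0"
    have "\<nexists>k. AE z in lebesgue. R0 z = k"
    proof
      assume "\<exists>k. AE z in lebesgue. R0 z = k"
      then obtain k where "AE z in lebesgue. R0 z = k" by blast
      then have "AE z in lebesgue. R z = k" using R0(2) by eventually_elim simp
      then show False using that by blast
    qed
    then show "deriv (speed R0) lam < 0"
      using speed_derivative_neg[OF lam] DERIV_imp_deriv[OF speed_derivative[OF lam]] by simp
  qed
  show ?thesis
    unfolding sp int
    using smooth_on_speed antimono_speed speed_tendsto_at_right_0[OF least0] speed_tendsto_at_top neg
    unfolding E_def[symmetric] M by (auto intro: tendsto_intros)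
qed

end
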